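(* Let $k$ be a field of characteristic zero, $B=k[x,y,z]$, $K=k(x)$, and let $D$ be an irreducible locally nilpotent derivation of $B$ of rank $2$ with $D(x)=0$. Let $\alpha\in\Psi(D)$. Then $\mathrm{ulev}(D)=c(\alpha)+2$.
   Context: $D$ extends to a $K$-linear LND $\tilde D$ of $K[y,z]$. $\Psi(D)$ is the set of $K$-automorphisms $\alpha$ of $K[y,z]$ such that $K[y,z]=K[\alpha(y),\alpha(z)]$, $\alpha(y)$ generates $\mathrm{Ker}\,\tilde D$ over $K$ and $\tilde D(\alpha(z))\in K^*$. Automorphisms are written $\beta=(\beta(y),\beta(z))$ and composed by $\beta\circ\alpha=(\beta(y)(\alpha(y),\alpha(z)),\ \beta(z)(\alpha(y),\alpha(z)))$. $\mathrm{T}_2(K)$ is the group of automorphisms $(ay+b,\ cz+p(y))$ with $a,c\in K^*$, $b\in K$, $p\in K[t]$; $\theta=(z,y)$ is the swap. The complexity $c(\alpha)$ is the minimal $m\ge0$ such that there are $\tau_0,\dots,\tau_m\in\mathrm{T}_2(K)$ for which $\varphi=\tau_m\circ\theta\circ\tau_{m-1}\circ\cdots\circ\theta\circ\tau_0\circ\alpha$ (with $m$ swaps) satisfies $\varphi(y),\varphi(z)\in k[x,y,z]$ and $k[x,\varphi(y),\varphi(z)]=k[x,y,z]$. Universal level: for a coordinate system $\mathbf y=(y_1,y_2,y_3)$ of $B$ with $D(y_3)=0$, a full irreducible MC-chain ending at $D$ is a sequence of irreducible LNDs $\partial_1=\partial/\partial y_1,\partial_2=\partial/\partial y_2,\dots,\partial_l=D$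 all vanishing on $y_3$, with $h_i\partial_i=\sigma\partial_{i-1}+f_i\partial_{i-2}$ for $3\le i\le l$, some $\sigma\in\mathrm{Ker}\,\partial_{i-1}$, $f_i,h_i\in k[y_3]\setminus\{0\}$; $\mathrm{lev}_{\mathbf y}(D)$ is the minimal such $l$, and $\mathrm{ulev}(D)$ is the minimum of $\mathrm{lev}_{\mathbf y}(D)$ over all coordinate systems $\mathbf y$ with $D(y_3)=0$. Irreducible: image not in a proper principal ideal; rank: least $i$ with a coordinate system $(x_1,x_2,x_3)$ having $k[x_{i+1},\dots,x_3]\subseteq\mathrm{Ker}\,D$. *)

theory Defs
  imports "HOL-Computational_Algebra.Polynomial" "HOL-Computational_Algebra.Fraction_Field"
begin

text \<open>
  B = k[x,y,z] is modelled as the nested polynomial ring ((k[x])[y])[z], i.e. the type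
  'k poly poly poly (x innermost, z outermost).  K = k(x) is 'k poly fract, and
  K[y,z] = (K[y])[z] is 'k poly fract poly poly (y inner, z outer).
\<close>

type_synonym 'k B3 = "'k poly poly poly"
type_synonym 'k KF = "'k poly fract"
type_synonym 'k KYZ = "'k poly fract poly poly"

definition constB :: "'k::field \<Rightarrow> 'k B3" where
  "constB c = [:[:[:c:]:]:]"

definition varX :: "'k::field B3" where "varX = [:[:[:0, 1:]:]:]"

inductive_set kalg :: "('a \<Rightarrow> 'r::comm_ring_1) \<Rightarrow> 'r set \<Rightarrow> 'r set"
  for emb :: "'a \<Rightarrow> 'r" and S :: "'r set" where
  const: "emb c \<in> kalg emb S"
| gen: "s \<in> S \<Longrightarrow> s \<in> kalg emb S"
| add: "a \<in> kalg emb S \<Longrightarrow> b \<in> kalg emb S \<Longrightarrow> a + b \<in> kalg emb S"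
| mult: "a \<in> kalg emb S \<Longrightarrow> b \<in> kalg emb S \<Longrightarrow> a * b \<in> kalg emb S"

definition coordsys :: "'k::field B3 \<Rightarrow> 'k B3 \<Rightarrow> 'k B3 \<Rightarrow> bool" where
  "coordsys a b c \<longleftrightarrow> kalg constB {a, b, c} = UNIV"

definition is_der :: "('a \<Rightarrow> 'r::comm_ring_1) \<Rightarrow> ('r \<Rightarrow> 'r) \<Rightarrow> bool" where
  "is_der emb d \<longleftrightarrow> (\<forall>c. d (emb c) = 0) \<and> (\<forall>f g. d (f + g) = d f + d g)
      \<and> (\<forall>f g. d (f * g) = f * d g + g * d f)"

definition is_LND :: "('a \<Rightarrow> 'r::comm_ring_1) \<Rightarrow> ('r \<Rightarrow> 'r) \<Rightarrow> bool" where
  "is_LND emb d \<longleftrightarrow> is_der emb d \<and> (\<forall>f. \<exists>n. (d ^^ n) f = 0)"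

definition ker :: "('r \<Rightarrow> 'r::zero) \<Rightarrow> 'r set" where
  "ker d = {f. d f = 0}"

definition irreducible_der :: "('r \<Rightarrow> 'r::comm_ring_1) \<Rightarrow> bool" where
  "irreducible_der d \<longleftrightarrow>
     \<not> (\<exists>g. {g * h |h. True} \<noteq> UNIV \<and> range d \<subseteq> {g * h |h. True})"

definition rank_der :: "('k::field B3 \<Rightarrow> 'k B3) \<Rightarrow> nat" where
  "rank_der d = (LEAST i. \<exists>a b c. coordsys a b c
       \<and> kalg constB (set (drop i [a, b, c])) \<subseteq> ker d)"

definition embK :: "'k::field KF \<Rightarrow> 'k KYZ" where
  "embK c = [:[:c:]:]"

definition varY :: "'k::field KYZ" where "varY = [:[:0, 1:]:]"
definition varZ :: "'k::field KYZ" where "varZ = [:0, 1:]"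

definition toK :: "'k::field B3 \<Rightarrow> 'k KYZ" where
  "toK f = map_poly (map_poly (\<lambda>r. Fract r 1)) f"

definition eval2 :: "'k::field KYZ \<Rightarrow> 'k KYZ \<Rightarrow> 'k KYZ \<Rightarrow> 'k KYZ" where
  "eval2 f p q = poly (map_poly (\<lambda>u. poly (map_poly embK u) p) f) q"

text \<open>Automorphisms written as pairs (beta(y), beta(z)); composition as in the paper.\<close>
type_synonym 'k aut = "'k KYZ \<times> 'k KYZ"

definition comp_aut :: "'k::field aut \<Rightarrow> 'k aut \<Rightarrow> 'k aut" where
  "comp_aut \<beta> \<alpha> = (eval2 (fst \<beta>) (fst \<alpha>) (snd \<alpha>), eval2 (snd \<beta>) (fst \<alpha>) (snd \<alpha>))"

definition is_Kaut :: "'k::field aut \<Rightarrow> bool" where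
  "is_Kaut \<alpha> \<longleftrightarrow> bij (\<lambda>f. eval2 f (fst \<alpha>) (snd \<alpha>))"

definition Psi :: "('k::field B3 \<Rightarrow> 'k B3) \<Rightarrow> 'k aut set" where
  "Psi d = {\<alpha>. is_Kaut \<alpha> \<and> kalg embK {fst \<alpha>, snd \<alpha>} = UNIV \<and>
      (\<exists>dt. is_LND embK dt \<and> (\<forall>f. dt (toK f) = toK (d f)) \<and>
            ker dt = kalg embK {fst \<alpha>} \<and>
            (\<exists>c. c \<noteq> 0 \<and> dt (snd \<alpha>) = embK c))}"

definition T2 :: "'k::field aut set" where
  "T2 = {([:[:b, a:]:], [:p, [:c:]:]) | a b c p. a \<noteq> 0 \<and> c \<noteq> 0}"

definition swap_aut :: "'k::field aut" where
  "swap_aut = (varZ, varY)"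

fun swapchain :: "'k::field aut list \<Rightarrow> 'k aut \<Rightarrow> 'k aut" where
  "swapchain [] acc = acc"
| "swapchain (t # ts) acc = swapchain ts (comp_aut t (comp_aut swap_aut acc))"

definition complexity :: "'k::field aut \<Rightarrow> nat" where
  "complexity \<alpha> = (LEAST m. \<exists>t0 ts. t0 \<in> T2 \<and> set ts \<subseteq> T2 \<and> length ts = m \<and>
      (let \<phi> = swapchain ts (comp_aut t0 \<alpha>) in
        \<exists>g1 g2. toK g1 = fst \<phi> \<and> toK g2 = snd \<phi> \<and> coordsys varX g1 g2))"

definition is_partial :: "('k::field B3 \<Rightarrow> 'k B3) \<Rightarrow> 'k B3 \<Rightarrow> 'k B3 \<Rightarrow> 'k B3 \<Rightarrow> bool" where
  "is_partial d u v w \<longleftrightarrow> is_der constB d \<and> d u = 1 \<and> d v = 0 \<and> d w = 0"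

text \<open>Full irreducible MC-chain (list index j corresponds to the paper's index j+1).\<close>
definition MC_chain :: "'k::field B3 \<Rightarrow> 'k B3 \<Rightarrow> 'k B3 \<Rightarrow> ('k B3 \<Rightarrow> 'k B3) list
                        \<Rightarrow> ('k B3 \<Rightarrow> 'k B3) \<Rightarrow> bool" where
  "MC_chain y1 y2 y3 ds d \<longleftrightarrow> length ds \<ge> 2 \<and>
     (\<forall>e\<in>set ds. is_LND constB e \<and> irreducible_der e \<and> e y3 = 0) \<and>
     is_partial (ds ! 0) y1 y2 y3 \<and> is_partial (ds ! 1) y2 y1 y3 \<and> last ds = d \<and>
     (\<forall>i. 2 \<le> i \<and> i < length ds \<longrightarrow>
        (\<exists>\<sigma> f h. (ds ! (i - 1)) \<sigma> = 0 \<and>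
           f \<in> kalg constB {y3} \<and> f \<noteq> 0 \<and> h \<in> kalg constB {y3} \<and> h \<noteq> 0 \<and>
           (\<forall>g. h * (ds ! i) g = \<sigma> * (ds ! (i - 1)) g + f * (ds ! (i - 2)) g)))"

definition lev :: "'k::field B3 \<Rightarrow> 'k B3 \<Rightarrow> 'k B3 \<Rightarrow> ('k B3 \<Rightarrow> 'k B3) \<Rightarrow> nat" where
  "lev y1 y2 y3 d = (LEAST l. \<exists>ds. MC_chain y1 y2 y3 ds d \<and> length ds = l)"

definition ulev :: "('k::field B3 \<Rightarrow> 'k B3) \<Rightarrow> nat" where
  "ulev d = (LEAST l. \<exists>y1 y2 y3. coordsys y1 y2 y3 \<and> d y3 = 0 \<and>
       (\<exists>ds. MC_chain y1 y2 y3 ds d \<and> length ds = l))"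

end

theory Submission
  imports "HOL-Algebra.Algebraic_Closure_Type" Defs
begin

text \<open>
  Over \<open>K = k(x)\<close> a derivation with kernel \<open>K[u]\<close>, \<open>u\<close> a variable, is a multiple of the Jacobian
  derivation \<open>J(u, \<cdot>)\<close>. A chain relation \<open>h \<partial>\<^sub>i = \<sigma> \<partial>\<^sub>i\<^sub>-\<^sub>1 + f \<partial>\<^sub>i\<^sub>-\<^sub>2\<close> says that
  \<open>u\<^sub>i = c u\<^sub>i\<^sub>-\<^sub>2 + p(u\<^sub>i\<^sub>-\<^sub>1)\<close>, where \<open>p\<close> is an antiderivative of \<open>\<sigma>\<close> up to a factor; this is one swap
  followed by a triangular automorphism. So chains of length \<open>l\<close> in coordinates \<open>(y1, y2, x)\<close>
  correspond to swap chains of length \<open>l - 2\<close>. Two points remain.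

  Both minima are over nonempty sets, because automorphisms of \<open>K[y,z]\<close> are tame. This follows from
  Rentschler's theorem: with \<open>a\<close>, \<open>b\<close> the nilpotency degrees of \<open>y\<close>, \<open>z\<close> as weights, the leading form
  of a kernel element is divisible by some \<open>y\<^sup>m - r z\<^sup>n\<close> with \<open>m\<close>, \<open>n\<close> coprime, which the leading part of
  the derivation kills; this forces \<open>m = 1\<close> or \<open>n = 1\<close>, so that a shear lowers \<open>a + b\<close>.

  A coordinate \<open>w\<close> of \<open>k[x,y,z]\<close> in the kernel lies in \<open>k[x]\<close>. Otherwise Rentschler's theorem over \<open>k(w)\<close>
  and irreducibility give \<open>t\<close> such that \<open>D t\<close> is in the kernel and is divisible by no prime of \<open>k[x]\<close>, from which a
  slice is obtained, so that the rank would be at most one.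
\<close>

section \<open>Polynomials in two variables and their derivations\<close>

text \<open>The coefficient ring stays abstract: k[x,y,z] and K[y,z] are both
  \<open>'c poly poly\<close>, with \<open>cst\<close> embedding k[x] or K, so the lemmas on
  \<open>sub\<close>, \<open>evp\<close> and \<open>Jac\<close> apply over k[x], over K, over the
  algebraic closure of k (reduction modulo a prime) and, after an automorphism, over k[w]. A
  coordinate pair (F, G) of K[y,z] stands for two consecutive derivations of a chain, the later one
  with kernel K[F], the earlier one with kernel K[G]. Two pairs with the same K[F] differ by a
  triangular automorphism, so only the swaps count. The offset 2 is the chain that consists of the
  two partial derivatives alone, whose pair is already integral. Passing to pairs forgets scalars
  from K. Irreducibility recovers them: each class of proportional derivations contains an
  irreducible derivation of k[x,y,z], and the factors f, h in k[x] of a chain relation absorb the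
  denominators. Rank 2 is what excludes chains along a coordinate outside k[x], for which no such
  pair over K is available.\<close>

locale rhom =
  fixes h :: "'a::comm_ring_1 \<Rightarrow> 'b::comm_ring_1"
  assumes hom_one: "h 1 = 1"
    and hom_add: "h (a + b) = h a + h b"
    and hom_mult: "h (a * b) = h a * h b"
begin

lemma hom_zero [simp]: "h 0 = 0"
  using hom_add[of 0 0] by simp

lemma hom_uminus: "h (- a) = - h a"
  using hom_add[of a "- a"] by (simp add: eq_neg_iff_add_eq_0 add.commute)

lemma hom_diff: "h (a - b) = h a - h b"
  using hom_add[of a "- b"] by (simp add: hom_uminus)

lemma hom_power: "h (a ^ n) = h a ^ n"
  by (induction n) (simp_all add: hom_one hom_mult)

lemma hom_sum: "h (\<Sum>i\<in>A. f i) = (\<Sum>i\<in>A. h (f i))"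
  by (induction A rule: infinite_finite_induct) (simp_all add: hom_add)

lemma hom_of_nat: "h (of_nat n) = of_nat n"
  by (induction n) (simp_all add: hom_one hom_add)

lemma rhom_map_poly: "rhom (map_poly h)"
proof
  show "map_poly h 1 = 1"
    by (simp add: map_poly_1' hom_one)
  show "map_poly h (p + q) = map_poly h p + map_poly h q" for p q
    by (rule poly_eqI) (simp add: coeff_map_poly hom_add)
  show "map_poly h (p * q) = map_poly h p * map_poly h q" for p q
    by (rule poly_eqI) (simp add: coeff_map_poly coeff_mult hom_sum hom_mult)
qed

lemma rhom_poly_map_poly: "rhom (\<lambda>p. poly (map_poly h p) a)"
proof -
  interpret m: rhom "map_poly h" by (rule rhom_map_poly)
  show ?thesis
    by standard (simp_all add: m.hom_one m.hom_add m.hom_mult)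
qed

lemma map_poly_pCons_hom: "map_poly h (pCons a p) = pCons (h a) (map_poly h p)"
  by (simp add: map_poly_pCons)

end

lemma pderiv_map_poly:
  fixes h :: "'a::idom \<Rightarrow> 'b::idom"
  assumes "rhom h"
  shows "pderiv (map_poly h p) = map_poly h (pderiv p)"
proof -
  interpret rhom h by fact
  show ?thesis
    by (rule poly_eqI) (simp add: coeff_pderiv coeff_map_poly hom_mult hom_of_nat del: of_nat_Suc)
qed

section \<open>The ring c[y,z] over a coefficient ring c\<close>

definition cst :: "'c::comm_ring_1 \<Rightarrow> 'c poly poly" where "cst c = [:[:c:]:]"
definition YY :: "'c::comm_ring_1 poly poly" where "YY = [:[:0, 1:]:]"
definition ZZ :: "'c::comm_ring_1 poly poly" where "ZZ = [:0, 1:]"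

lemma rhom_cst: "rhom cst"
  by standard (simp_all add: cst_def one_pCons)

interpretation cst: rhom cst by (rule rhom_cst)

lemma cst_eq_iff [simp]: "cst a = cst b \<longleftrightarrow> a = b"
  by (simp add: cst_def)

lemma cst_eq_0_iff [simp]: "cst a = 0 \<longleftrightarrow> a = 0"
  by (simp add: cst_def)

lemma coeff2_cst_mult: "coeff (coeff (cst c * f) j) i = c * coeff (coeff f j) i"
  by (simp add: cst_def)

lemma poly2_induct [case_names cst YY ZZ add mult]:
  assumes "\<And>c. P (cst c)" "P YY" "P ZZ"
    and "\<And>f g. P f \<Longrightarrow> P g \<Longrightarrow> P (f + g)" "\<And>f g. P f \<Longrightarrow> P g \<Longrightarrow> P (f * g)"
  shows "P (f :: 'c::comm_ring_1 poly poly)"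
proof -
  have c: "P [:a:]" for a
  proof (induction a)
    case 0
    then show ?case using assms(1)[of 0] by (simp add: cst_def)
  next
    case (pCons c a)
    have e: "[:pCons c a:] = cst c + YY * [:a:]" by (simp add: cst_def YY_def)
    show ?case unfolding e by (intro assms(1,2,4,5) pCons)
  qed
  show ?thesis
  proof (induction f)
    case 0
    then show ?case using c[of 0] by simp
  next
    case (pCons a f)
    have e: "pCons a f = [:a:] + ZZ * f" by (simp add: ZZ_def)
    show ?case unfolding e by (intro assms(3,4,5) pCons c)
  qed
qed

definition dy :: "'c::idom poly poly \<Rightarrow> 'c poly poly" where "dy = map_poly pderiv"
definition dz :: "'c::idom poly poly \<Rightarrow> 'c poly poly" where "dz = pderiv"

lemma coeff_dy: "coeff (dy f) n = pderiv (coeff f n)"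
  by (simp add: dy_def coeff_map_poly)

lemma dy_simps [simp]: "dy (cst c) = 0" "dy YY = 1" "dy ZZ = 0"
  by (rule poly_eqI, simp add: coeff_dy cst_def YY_def ZZ_def coeff_pCons pderiv_pCons one_pCons split: nat.splits)+

lemma dz_simps [simp]: "dz (cst c) = 0" "dz YY = 0" "dz ZZ = 1"
  by (simp_all add: dz_def cst_def YY_def ZZ_def pderiv_pCons one_pCons)

lemma dy_add: "dy (f + g) = dy f + dy g"
  by (rule poly_eqI) (simp add: coeff_dy pderiv_add)

lemma dz_add: "dz (f + g) = dz f + dz g"
  by (simp add: dz_def pderiv_add)

lemma dz_mult: "dz (f * g) = f * dz g + g * dz f"
  by (simp add: dz_def pderiv_mult)

lemma map_poly_derivation:
  fixes d :: "'a::comm_ring_1 \<Rightarrow> 'a"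
  assumes add: "\<And>f g. d (f + g) = d f + d g" and mult: "\<And>f g. d (f * g) = f * d g + g * d f"
  shows "map_poly d (f * g) = f * map_poly d g + g * map_poly d f"
proof (rule poly_eqI)
  fix n
  have z: "d 0 = 0" using add[of 0 0] by simp
  have sum: "d (\<Sum>i\<in>A. f i) = (\<Sum>i\<in>A. d (f i))" for A and f :: "nat \<Rightarrow> 'a"
    by (induction A rule: infinite_finite_induct) (simp_all add: z add)
  have s: "coeff (g * map_poly d f) n = (\<Sum>i\<le>n. d (coeff f i) * coeff g (n - i))"
    unfolding mult.commute[of g] by (simp add: coeff_mult coeff_map_poly z)
  have "d (\<Sum>i\<le>n. coeff f i * coeff g (n - i)) =
      (\<Sum>i\<le>n. coeff f i * d (coeff g (n - i)) + d (coeff f i) * coeff g (n - i))"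
    by (simp add: sum mult mult.commute)
  then show "coeff (map_poly d (f * g)) n = coeff (f * map_poly d g + g * map_poly d f) n"
    by (simp add: z coeff_map_poly s coeff_mult[of f "map_poly d g"] coeff_mult[of f g] sum.distrib)
qed

lemma dy_mult: "dy (f * g) = f * dy g + g * dy f"
  unfolding dy_def by (rule map_poly_derivation) (simp_all add: pderiv_add pderiv_mult)

text \<open>A derivation into the target of \<phi>, regarded as a module through \<phi>. Composites
  such as a derivation after a substitution are of this kind, so that every chain rule below is an
  instance of \<open>der_along_eq\<close>.\<close>

definition der_along :: "('r::comm_ring_1 \<Rightarrow> 's::comm_ring_1) \<Rightarrow> ('r \<Rightarrow> 's) \<Rightarrow> bool" where
  "der_along \<phi> \<delta> \<longleftrightarrow> (\<forall>f g. \<delta> (f + g) = \<delta> f + \<delta> g) \<and> (\<forall>f g. \<delta> (f * g) = \<phi> f * \<delta> g + \<phi> g * \<delta> f)"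

lemma der_along_eq:
  assumes "rhom \<phi>" "der_along \<phi> \<delta>" "\<And>c. \<delta> (cst c) = 0"
  shows "\<delta> f = \<phi> (dy f) * \<delta> YY + \<phi> (dz f) * \<delta> ZZ"
proof -
  interpret rhom \<phi> by fact
  show ?thesis
    using assms(2,3)
    by (induction f rule: poly2_induct)
      (simp_all add: der_along_def hom_one dy_add dz_add dy_mult dz_mult hom_add hom_mult algebra_simps)
qed

lemma rhom_id: "rhom (\<lambda>x. x)"
  by standard simp_all

lemma is_der_zero: "is_der emb d \<Longrightarrow> d 0 = 0"
  using is_der_def[of emb d] by (metis add_cancel_right_right mult_zero_left)

lemma is_der_alt: "is_der emb d \<longleftrightarrow> (\<forall>c. d (emb c) = 0) \<and> der_along (\<lambda>x. x) d"
  by (simp add: is_der_def der_along_def)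

lemma is_der_eq:
  assumes "is_der cst d"
  shows "d f = dy f * d YY + dz f * d ZZ"
  using der_along_eq[OF rhom_id, of d f] assms by (simp add: is_der_alt)

section \<open>Jacobian determinants and substitution\<close>

definition Jac :: "'c::idom poly poly \<Rightarrow> 'c poly poly \<Rightarrow> 'c poly poly" where
  "Jac f g = dy f * dz g - dz f * dy g"

lemma Jac_add_left: "Jac (f + g) k = Jac f k + Jac g k"
  and Jac_add_right: "Jac k (f + g) = Jac k f + Jac k g"
  and Jac_mult_left: "Jac (f * g) k = f * Jac g k + g * Jac f k"
  and Jac_mult_right: "Jac k (f * g) = f * Jac k g + g * Jac k f"
  and Jac_self [simp]: "Jac f f = 0"
  and Jac_cst [simp]: "Jac (cst c) f = 0" "Jac f (cst c) = 0"
  and Jac_swap: "Jac f g = - Jac g f"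
  and Jac_YY_ZZ [simp]: "Jac YY ZZ = 1"
  by (simp_all add: Jac_def dy_add dz_add dy_mult dz_mult algebra_simps)

lemma Jac_cst_mult: "Jac (cst c * f) g = cst c * Jac f g" "Jac f (cst c * g) = cst c * Jac f g"
  by (simp_all add: Jac_mult_left Jac_mult_right)

lemma Jac_uminus: "Jac (- f) g = - Jac f g" "Jac f (- g) = - Jac f g"
  using Jac_cst_mult(1)[of "-1" f g] Jac_cst_mult(2)[of f "-1" g]
  by (simp_all add: cst.hom_uminus cst.hom_one)

lemma Jac_diff_left: "Jac (f - g) k = Jac f k - Jac g k"
  and Jac_diff_right: "Jac k (f - g) = Jac k f - Jac k g"
  using Jac_add_left[of f "- g" k] Jac_add_right[of k f "- g"] by (simp_all add: Jac_uminus)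

lemma is_der_Jac: "is_der cst (Jac f)"
  by (simp add: is_der_def Jac_add_right Jac_mult_right)

definition ev2 :: "('c::comm_ring_1 \<Rightarrow> 's::comm_ring_1) \<Rightarrow> 's \<Rightarrow> 's \<Rightarrow> 'c poly poly \<Rightarrow> 's" where
  "ev2 h p q f = poly (map_poly (\<lambda>u. poly (map_poly h u) p) f) q"

lemma rhom_ev2: "rhom h \<Longrightarrow> rhom (ev2 h p q)"
  unfolding ev2_def by (intro rhom.rhom_poly_map_poly)

lemma ev2_simps:
  assumes "rhom h"
  shows "ev2 h p q (cst c) = h c" "ev2 h p q YY = p" "ev2 h p q ZZ = q"
proof -
  interpret rhom h by fact
  show "ev2 h p q (cst c) = h c" "ev2 h p q YY = p" "ev2 h p q ZZ = q"
    by (simp_all add: ev2_def cst_def YY_def ZZ_def map_poly_pCons hom_one)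
qed

lemma rhom_eqI:
  assumes "rhom \<phi>" "rhom \<psi>" "\<And>c. \<phi> (cst c) = \<psi> (cst c)" "\<phi> YY = \<psi> YY" "\<phi> ZZ = \<psi> ZZ"
  shows "\<phi> f = \<psi> f"
  using assms(3-) by (induction f rule: poly2_induct)
    (simp_all add: rhom.hom_add[OF assms(1)] rhom.hom_add[OF assms(2)]
       rhom.hom_mult[OF assms(1)] rhom.hom_mult[OF assms(2)])

abbreviation sub :: "'c::comm_ring_1 poly poly \<Rightarrow> 'c poly poly \<Rightarrow> 'c poly poly \<Rightarrow> 'c poly poly" where
  "sub \<equiv> ev2 cst"

lemma rhom_sub: "rhom (sub u v)"
  by (rule rhom_ev2[OF rhom_cst])

lemmas sub_simps [simp] = ev2_simps[OF rhom_cst]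
lemmas sub_add [simp] = rhom.hom_add[OF rhom_sub]
lemmas sub_mult [simp] = rhom.hom_mult[OF rhom_sub]
lemmas sub_diff [simp] = rhom.hom_diff[OF rhom_sub]
lemmas sub_0 [simp] = rhom.hom_zero[OF rhom_sub]

definition evp :: "'c::comm_ring_1 poly poly \<Rightarrow> 'c poly \<Rightarrow> 'c poly poly" where
  "evp u p = poly (map_poly cst p) u"

lemma rhom_evp: "rhom (evp u)"
  unfolding evp_def by (rule cst.rhom_poly_map_poly)

lemmas evp_add = rhom.hom_add[OF rhom_evp]
lemmas evp_mult = rhom.hom_mult[OF rhom_evp]
lemmas evp_diff = rhom.hom_diff[OF rhom_evp]
lemmas evp_uminus = rhom.hom_uminus[OF rhom_evp]
lemmas evp_0 [simp] = rhom.hom_zero[OF rhom_evp]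

lemma evp_pCons: "evp u (pCons c p) = cst c + u * evp u p"
  by (simp add: evp_def map_poly_pCons)

lemma evp_const [simp]: "evp u [:c:] = cst c"
  by (simp add: evp_pCons)

lemma evp_smult: "evp u (smult c p) = cst c * evp u p"
  using evp_mult[of u "[:c:]" p] by simp

lemma sub_const: "sub u v [:p:] = evp u p"
  by (simp add: ev2_def evp_def map_poly_pCons)

lemma sub_id: "sub YY ZZ f = f"
  by (rule rhom_eqI[OF rhom_sub rhom_id]) simp_all

lemma der_evp:
  assumes "is_der cst d"
  shows "d (evp u p) = evp u (pderiv p) * d u"
proof -
  have d: "d (cst c) = 0" "d (f + g) = d f + d g" "d (f * g) = f * d g + g * d f" for c f g
    using assms by (simp_all add: is_der_def)
  show ?thesis
    by (induction p)
      (simp_all add: d is_der_zero[OF assms] evp_pCons pderiv_pCons evp_add algebra_simps)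
qed

lemma der_sub:
  assumes "is_der cst d"
  shows "d (sub u v f) = sub u v (dy f) * d u + sub u v (dz f) * d v"
proof -
  have "der_along (sub u v) (\<lambda>f. d (sub u v f))"
    using assms by (simp add: is_der_def der_along_def)
  from der_along_eq[OF rhom_sub this] show ?thesis
    using assms by (simp add: is_der_def)
qed

lemma Jac_evp [simp]: "Jac u (evp u p) = 0"
  using der_evp[OF is_der_Jac, of u u p] by simp

lemma Jac_evp_left: "Jac (evp u p) f = evp u (pderiv p) * Jac u f"
  using der_evp[OF is_der_Jac, of f u p] by (simp add: Jac_swap[of _ f])

lemma Jac_sub: "Jac (sub u v f) (sub u v g) = sub u v (Jac f g) * Jac u v"
proof -
  have l: "Jac (sub u v f) k = sub u v (dy f) * Jac u k + sub u v (dz f) * Jac v k" for k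
    using der_sub[OF is_der_Jac, of k u v f] by (simp add: Jac_swap[of _ k])
  have r: "Jac k (sub u v g) = sub u v (dy g) * Jac k u + sub u v (dz g) * Jac k v" for k
    by (rule der_sub[OF is_der_Jac])
  show ?thesis
    unfolding l[of "sub u v g"] r[of u] r[of v]
    by (simp add: Jac_def[of f g] Jac_swap[of v u] algebra_simps)
qed

text \<open>The Jacobian criterion in characteristic zero. As \<open>Jac u u = 0\<close>, applying
  \<open>Jac u\<close> to a relation \<open>f\<close> yields the relation \<open>dz f\<close> of
  smaller degree; what remains is a relation in \<open>u\<close> alone, which \<open>Jac v\<close>
  lowers in the same way.\<close>

lemma sub_eq_0_imp:
  fixes f :: "'c::{idom,ring_char_0} poly poly"
  assumes J: "Jac u v \<noteq> 0" and "sub u v f = 0"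
  shows "f = 0"
proof -
  have c: "a = 0" if "evp u a = 0" for a
    using that
  proof (induction "degree a" arbitrary: a rule: less_induct)
    case less
    have "evp u (pderiv a) * Jac v u = 0"
      using der_evp[OF is_der_Jac, of v u a] less.prems by (simp add: is_der_zero[OF is_der_Jac])
    with J have "evp u (pderiv a) = 0" by (auto simp: Jac_swap[of u v])
    then have "pderiv a = 0"
      using less.hyps[of "pderiv a"] by (metis degree_pderiv diff_less gr0I less_one pderiv_eq_0_iff)
    then obtain c where "a = [:c:]" by (metis degree_eq_zeroE pderiv_eq_0_iff)
    then show ?case using less.prems by simp
  qed
  show ?thesis
    using assms(2)
  proof (induction "degree f" arbitrary: f rule: less_induct)
    case less
    have "sub u v (dz f) * Jac u v = 0"
      using der_sub[OF is_der_Jac, of u u v f] less.prems by (simp add: is_der_zero[OF is_der_Jac])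
    with J have "sub u v (dz f) = 0" by auto
    then have "pderiv f = 0"
      using less.hyps[of "dz f"] unfolding dz_def
      by (metis degree_pderiv diff_less gr0I less_one pderiv_eq_0_iff)
    then obtain p where "f = [:p:]" by (metis degree_eq_zeroE pderiv_eq_0_iff)
    then show ?case using less.prems c by (simp add: sub_const)
  qed
qed

lemma inj_sub:
  fixes u v :: "'c::{idom,ring_char_0} poly poly"
  assumes "Jac u v \<noteq> 0"
  shows "inj (sub u v)"
  by (rule injI) (metis assms eq_iff_diff_eq_0 sub_diff sub_eq_0_imp)

section \<open>Generated subalgebras and coordinate pairs\<close>

lemma kalg_least:
  assumes "x \<in> kalg emb S" "\<And>c. emb c \<in> T" "S \<subseteq> T"
    "\<And>a b. a \<in> T \<Longrightarrow> b \<in> T \<Longrightarrow> a + b \<in> T" "\<And>a b. a \<in> T \<Longrightarrow> b \<in> T \<Longrightarrow> a * b \<in> T"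
  shows "x \<in> T"
  using assms(1) by induction (use assms in auto)

lemma kalg_mono_gen:
  assumes "S \<subseteq> kalg emb T"
  shows "kalg emb S \<subseteq> kalg emb T"
  using kalg_least[of _ emb S "kalg emb T"] assms by (auto intro: kalg.intros)

lemma sub_in_kalg: "sub u v f \<in> kalg cst {u, v}"
  by (induction f rule: poly2_induct) (auto intro: kalg.intros)

lemma evp_in_kalg: "evp u p \<in> kalg cst {u}"
proof (induction p)
  case 0
  show ?case using kalg.const[of cst 0 "{u}"] by simp
next
  case (pCons c p)
  then show ?case by (auto simp: evp_pCons intro!: kalg.add kalg.mult intro: kalg.const kalg.gen)
qed

lemma kalg2_eq: "kalg cst {u, v} = range (sub u v)"
proof
  show "range (sub u v) \<subseteq> kalg cst {u, v}" using sub_in_kalg by auto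
  show "kalg cst {u, v} \<subseteq> range (sub u v)"
  proof
    fix x assume "x \<in> kalg cst {u, v}"
    then show "x \<in> range (sub u v)"
    proof (rule kalg_least)
      show "cst c \<in> range (sub u v)" for c by (rule range_eqI[of _ _ "cst c"]) simp
      have "u \<in> range (sub u v)" by (rule range_eqI[of _ _ YY]) simp
      moreover have "v \<in> range (sub u v)" by (rule range_eqI[of _ _ ZZ]) simp
      ultimately show "{u, v} \<subseteq> range (sub u v)" by simp
    qed (auto simp flip: sub_add sub_mult)
  qed
qed

abbreviation gen :: "'c::comm_ring_1 poly poly \<Rightarrow> 'c poly poly \<Rightarrow> bool" where
  "gen u v \<equiv> kalg cst {u, v} = UNIV"

lemma gen_YY_ZZ: "gen YY ZZ"
  by (simp add: kalg2_eq sub_id[abs_def])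

lemma gen_subset:
  assumes "gen u v" "u \<in> kalg cst {u', v'}" "v \<in> kalg cst {u', v'}"
  shows "gen u' v'"
  using kalg_mono_gen[of "{u, v}" cst "{u', v'}"] assms by auto

lemma gen_swap: "gen u v \<Longrightarrow> gen v u"
  by (simp add: insert_commute)

lemma unit_poly2:
  fixes f :: "'c::idom poly poly"
  assumes "f dvd 1"
  obtains c where "f = cst c" "c dvd 1"
  using assms by (auto simp: is_unit_poly_iff cst_def)

text \<open>Writing \<open>YY\<close> and \<open>ZZ\<close> through \<open>u\<close>,
  \<open>v\<close>, the chain rule exhibits \<open>1 = Jac YY ZZ\<close> as a multiple of
  \<open>Jac u v\<close>.\<close>

lemma gen_Jac:
  fixes u v :: "'c::{idom,ring_char_0} poly poly"
  assumes "gen u v"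
  obtains c where "Jac u v = cst c" "c dvd 1"
proof -
  obtain f g where "YY = sub u v f" "ZZ = sub u v g"
    using assms unfolding kalg2_eq by (metis UNIV_I imageE)
  with Jac_sub[of u v f g] have "1 = sub u v (Jac f g) * Jac u v" by simp
  then have "Jac u v dvd 1" by (metis dvd_triv_right)
  then show thesis using that by (elim unit_poly2)
qed

lemma gen_Jac_field:
  fixes u v :: "'c::field_char_0 poly poly"
  assumes "gen u v"
  obtains c where "Jac u v = cst c" "c \<noteq> 0"
  using gen_Jac[OF assms] by (metis dvd_0_left_iff zero_neq_one)

text \<open>In the coordinates \<open>u\<close>, \<open>v\<close> the derivation
  \<open>Jac u\<close> is a unit times the partial derivative by \<open>v\<close>, so in
  characteristic zero its kernel consists of the polynomials in \<open>u\<close>.\<close>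

lemma Jac_eq_0_imp_evp:
  fixes u v :: "'c::{idom,ring_char_0} poly poly"
  assumes "gen u v" "Jac u f = 0"
  obtains p where "f = evp u p"
proof -
  obtain c where c: "Jac u v = cst c" "c dvd 1" using gen_Jac[OF assms(1)] .
  then have J: "Jac u v \<noteq> 0" by auto
  obtain \<Phi> where \<Phi>: "f = sub u v \<Phi>" using assms(1) unfolding kalg2_eq by (metis UNIV_I imageE)
  have "sub u v (dz \<Phi>) * Jac u v = 0"
    using der_sub[OF is_der_Jac, of u u v \<Phi>] assms(2) \<Phi> by simp
  with J have "dz \<Phi> = 0" using sub_eq_0_imp[OF J] by auto
  then obtain p where "\<Phi> = [:p:]" by (metis degree_eq_zeroE dz_def pderiv_eq_0_iff)
  then show thesis using that \<Phi> by (simp add: sub_const)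
qed

lemma is_der_pow_add:
  assumes "is_der emb d"
  shows "(d ^^ n) (f + g) = (d ^^ n) f + (d ^^ n) g"
  using assms by (induction n) (simp_all add: is_der_def)

lemma is_der_pow_zero: "is_der emb d \<Longrightarrow> (d ^^ n) 0 = 0"
  by (induction n) (simp_all add: is_der_zero)

text \<open>Leibniz without binomial coefficients: one derivative falls on either factor and lowers
  \<open>a\<close> or \<open>b\<close>, hence the induction on \<open>a + b\<close>.\<close>

lemma is_der_pow_mult_eq_0:
  assumes "is_der emb d" "(d ^^ a) f = 0" "(d ^^ b) g = 0"
  shows "(d ^^ (a + b)) (f * g) = 0"
  using assms(2,3)
proof (induction "a + b" arbitrary: a b f g)
  case 0
  then show ?case by simp
next
  case (Suc n)
  show ?case
  proof (cases "a = 0 \<or> b = 0")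
    case True
    then show ?thesis using Suc.prems is_der_pow_zero[OF assms(1)] by auto
  next
    case False
    then obtain a' b' where ab: "a = Suc a'" "b = Suc b'" by (metis not0_implies_Suc)
    have 1: "(d ^^ (a + b')) (f * d g) = 0"
      by (rule Suc.hyps) (use Suc ab in \<open>simp_all add: funpow_swap1\<close>)
    have 2: "(d ^^ (b + a')) (g * d f) = 0"
      by (rule Suc.hyps) (use Suc ab in \<open>simp_all add: funpow_swap1\<close>)
    have "(d ^^ (a + b)) (f * g) = (d ^^ (a + b')) (d (f * g))"
      by (simp add: ab funpow_swap1)
    also have "d (f * g) = f * d g + g * d f" using assms(1) by (simp add: is_der_def)
    finally have "(d ^^ (a + b)) (f * g) = (d ^^ (a + b')) (f * d g) + (d ^^ (a + b')) (g * d f)"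
      by (simp only: is_der_pow_add[OF assms(1)])
    moreover have "a + b' = b + a'" by (simp add: ab)
    ultimately show ?thesis using 1 2 by simp
  qed
qed

lemma is_LND_generators:
  assumes d: "is_der emb d" and gen: "kalg emb S = UNIV" and S: "\<And>s. s \<in> S \<Longrightarrow> \<exists>n. (d ^^ n) s = 0"
  shows "is_LND emb d"
proof -
  have "f \<in> {f. \<exists>n. (d ^^ n) f = 0}" for f
  proof (rule kalg_least[of f emb S])
    show "f \<in> kalg emb S" using gen by simp
    show "emb c \<in> {f. \<exists>n. (d ^^ n) f = 0}" for c
      using d by (auto simp: is_der_def intro!: exI[of _ 1])
    show "S \<subseteq> {f. \<exists>n. (d ^^ n) f = 0}" using S by auto
  next
    fix a b assume "a \<in> {f. \<exists>n. (d ^^ n) f = 0}" "b \<in> {f. \<exists>n. (d ^^ n) f = 0}"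
    then obtain m n where "(d ^^ m) a = 0" "(d ^^ n) b = 0" by auto
    then have "(d ^^ (n + m)) a = 0" "(d ^^ (m + n)) b = 0"
      using is_der_pow_zero[OF d] by (simp_all add: funpow_add)
    then have "(d ^^ (m + n)) (a + b) = 0" by (simp add: is_der_pow_add[OF d] add.commute)
    then show "a + b \<in> {f. \<exists>n. (d ^^ n) f = 0}" by auto
  next
    fix a b assume "a \<in> {f. \<exists>n. (d ^^ n) f = 0}" "b \<in> {f. \<exists>n. (d ^^ n) f = 0}"
    then show "a * b \<in> {f. \<exists>n. (d ^^ n) f = 0}"
      using is_der_pow_mult_eq_0[OF d, of _ a _ b] by blast
  qed
  then show ?thesis using d by (auto simp: is_LND_def)
qed

section \<open>Leading forms\<close>

text \<open>Only bounds on the degrees are assumed, so the formal top coefficients may vanish.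
  Leading forms are computed with such bounds throughout, which avoids distinguishing cases of
  cancellation.\<close>

lemma coeff_mult_top:
  fixes p q :: "'a::comm_ring_1 poly"
  assumes "degree p \<le> a" "degree q \<le> b"
  shows "coeff (p * q) (a + b) = coeff p a * coeff q b"
proof -
  have "coeff (p * q) (a + b) = (\<Sum>i\<le>a + b. coeff p i * coeff q (a + b - i))"
    by (rule coeff_mult)
  also have "\<dots> = (\<Sum>i\<in>{a}. coeff p i * coeff q (a + b - i))"
  proof (rule sum.mono_neutral_right)
    show "\<forall>i\<in>{..a + b} - {a}. coeff p i * coeff q (a + b - i) = 0"
    proof
      fix i assume i: "i \<in> {..a + b} - {a}"
      show "coeff p i * coeff q (a + b - i) = 0"
      proof (cases "i < a")
        case True
        then have "coeff q (a + b - i) = 0" using assms by (intro coeff_eq_0) auto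
        then show ?thesis by simp
      next
        case False
        then have "coeff p i = 0" using assms i by (intro coeff_eq_0) auto
        then show ?thesis by simp
      qed
    qed
  qed auto
  finally show ?thesis by simp
qed

lemma degree_mult_le': "degree p \<le> a \<Longrightarrow> degree q \<le> b \<Longrightarrow> degree (p * q) \<le> a + b"
  for p q :: "'a::comm_ring_1 poly"
  by (rule order.trans[OF degree_mult_le]) simp

lemma degree_coeff_power_top:
  fixes p :: "'a::comm_ring_1 poly"
  assumes "degree p \<le> a"
  shows "degree (p ^ i) \<le> i * a \<and> coeff (p ^ i) (i * a) = coeff p a ^ i"
proof (induction i)
  case (Suc i)
  then show ?case
    using coeff_mult_top[OF assms, of "p ^ i" "i * a"] degree_mult_le'[OF assms, of "p ^ i" "i * a"]
    by simp
qed simp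

lemma degree_coeff_mono_top:
  fixes p q :: "'a::comm_ring_1 poly"
  assumes "degree p \<le> a" "degree q \<le> b"
  shows "degree (p ^ i * q ^ j) \<le> i * a + j * b"
    and "coeff (p ^ i * q ^ j) (i * a + j * b) = coeff p a ^ i * coeff q b ^ j"
  using degree_coeff_power_top[OF assms(1), of i] degree_coeff_power_top[OF assms(2), of j]
  by (simp_all add: coeff_mult_top degree_mult_le')

definition supp2 :: "'c::comm_ring_1 poly poly \<Rightarrow> (nat \<times> nat) set" where
  "supp2 f = {(i, j). coeff (coeff f j) i \<noteq> 0}"

lemma finite_supp2: "finite (supp2 f)"
proof (rule finite_subset)
  show "supp2 f \<subseteq> (\<Union>j\<le>degree f. {..degree (coeff f j)} \<times> {j})"
  proof (clarsimp simp: supp2_def)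
    fix i j assume "coeff (coeff f j) i \<noteq> 0"
    moreover from this have "coeff f j \<noteq> 0" by auto
    ultimately show "j \<le> degree f \<and> i \<le> degree (coeff f j)" by (simp add: le_degree)
  qed
qed auto

lemma cst_YY_ZZ_monom: "cst c * YY ^ i * ZZ ^ j = monom (monom c i) j"
proof -
  have y: "YY ^ i = [:monom 1 i:]"
    by (simp add: YY_def poly_const_pow monom_altdef)
  have z: "ZZ ^ j = monom 1 j"
    by (simp add: ZZ_def monom_altdef)
  show ?thesis by (simp add: y z cst_def smult_monom)
qed

lemma supp2_sum: "f = (\<Sum>(i, j)\<in>supp2 f. cst (coeff (coeff f j) i) * YY ^ i * ZZ ^ j)"
proof (intro poly_eqI)
  fix j i
  have "coeff (coeff (\<Sum>x\<in>supp2 f. monom (monom (coeff (coeff f (snd x)) (fst x)) (fst x)) (snd x)) j) i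
      = (\<Sum>x\<in>supp2 f. if x = (i, j) then coeff (coeff f j) i else 0)"
    by (simp add: coeff_sum) (intro sum.cong refl, auto)
  also have "\<dots> = coeff (coeff f j) i"
    using finite_supp2[of f] by (simp add: supp2_def)
  finally show "coeff (coeff f j) i = coeff (coeff (\<Sum>(i, j)\<in>supp2 f. cst (coeff (coeff f j) i) * YY ^ i * ZZ ^ j) j) i"
    by (simp add: cst_YY_ZZ_monom case_prod_unfold)
qed

lemma ev2_supp2_sum:
  assumes "rhom h"
  shows "ev2 h p q f = (\<Sum>(i, j)\<in>supp2 f. h (coeff (coeff f j) i) * p ^ i * q ^ j)"
proof -
  interpret e: rhom "ev2 h p q" by (rule rhom_ev2[OF assms])
  have "ev2 h p q f = ev2 h p q (\<Sum>(i, j)\<in>supp2 f. cst (coeff (coeff f j) i) * YY ^ i * ZZ ^ j)"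
    using supp2_sum[of f] by simp
  then show ?thesis
    by (simp add: e.hom_sum e.hom_mult e.hom_power ev2_simps[OF assms] case_prod_unfold)
qed

definition topset :: "nat \<Rightarrow> nat \<Rightarrow> nat \<Rightarrow> 'c::comm_ring_1 poly poly \<Rightarrow> (nat \<times> nat) set" where
  "topset a b w f = {(i, j) \<in> supp2 f. i * a + j * b = w}"

text \<open>The component of weight \<open>w\<close>, already evaluated at \<open>x\<close>,
  \<open>y\<close>: it is needed both at the leading coefficients of the exponentials of the
  variables and at the variables themselves.\<close>

definition toppart :: "nat \<Rightarrow> nat \<Rightarrow> nat \<Rightarrow> 'c::comm_ring_1 poly poly \<Rightarrow> 'c poly poly \<Rightarrow> 'c poly poly \<Rightarrow> 'c poly poly" where
  "toppart a b w f x y = (\<Sum>(i, j)\<in>topset a b w f. cst (coeff (coeff f j) i) * x ^ i * y ^ j)"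

abbreviation ccst :: "'c::comm_ring_1 \<Rightarrow> 'c poly poly poly" where
  "ccst c \<equiv> [:cst c:]"

lemma rhom_ccst: "rhom ccst"
  by standard (simp_all add: cst.hom_add cst.hom_mult cst.hom_one one_pCons)

text \<open>A monomial of weight below \<open>w\<close> cannot reach degree \<open>w\<close>, and
  one of weight \<open>w\<close> contributes to that coefficient only through the top coefficients
  of \<open>p\<close> and \<open>q\<close>.\<close>

lemma ev2_top:
  assumes w: "\<And>i j. (i, j) \<in> supp2 f \<Longrightarrow> i * a + j * b \<le> w"
    and p: "degree p \<le> a" and q: "degree q \<le> b"
  shows "degree (ev2 ccst p q f) \<le> w"
    and "coeff (ev2 ccst p q f) w = toppart a b w f (coeff p a) (coeff q b)"
proof -
  have e: "ev2 ccst p q f = (\<Sum>(i, j)\<in>supp2 f. smult (cst (coeff (coeff f j) i)) (p ^ i * q ^ j))"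
    by (simp add: ev2_supp2_sum[OF rhom_ccst] mult.assoc)
  show "degree (ev2 ccst p q f) \<le> w"
    unfolding e
    by (intro degree_sum_le finite_supp2)
      (auto intro!: order.trans[OF degree_smult_le] order.trans[OF degree_coeff_mono_top(1)[OF p q] w])
  have c: "coeff (smult (cst (coeff (coeff f j) i)) (p ^ i * q ^ j)) w =
     (if (i, j) \<in> topset a b w f then cst (coeff (coeff f j) i) * coeff p a ^ i * coeff q b ^ j else 0)"
    if "(i, j) \<in> supp2 f" for i j
  proof (cases "i * a + j * b = w")
    case True
    then show ?thesis using degree_coeff_mono_top(2)[OF p q, of i j] that
      by (simp add: topset_def mult.assoc)
  next
    case False
    then have "degree (p ^ i * q ^ j) < w" using w[OF that] degree_coeff_mono_top(1)[OF p q, of i j] by simp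
    then show ?thesis using False by (simp add: topset_def coeff_eq_0)
  qed
  have "coeff (ev2 ccst p q f) w =
     (\<Sum>(i, j)\<in>supp2 f. if (i, j) \<in> topset a b w f then cst (coeff (coeff f j) i) * coeff p a ^ i * coeff q b ^ j else 0)"
    unfolding e coeff_sum by (intro sum.cong refl) (use c in auto)
  also have "\<dots> = (\<Sum>x\<in>supp2 f. if x \<in> topset a b w f then (case x of (i, j) \<Rightarrow> cst (coeff (coeff f j) i) * coeff p a ^ i * coeff q b ^ j) else 0)"
    by (intro sum.cong refl) auto
  also have "\<dots> = toppart a b w f (coeff p a) (coeff q b)"
    unfolding toppart_def using finite_supp2[of f]
    by (subst sum.inter_restrict[symmetric]) (auto simp: topset_def intro!: sum.cong)
  finally show "coeff (ev2 ccst p q f) w = toppart a b w f (coeff p a) (coeff q b)" .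
qed

text \<open>The homogenization of \<open>c\<close> to degree \<open>n\<close>.\<close>

definition form :: "nat \<Rightarrow> 'c::comm_ring_1 poly \<Rightarrow> 'c poly poly \<Rightarrow> 'c poly poly \<Rightarrow> 'c poly poly" where
  "form n c U V = (\<Sum>s\<le>n. cst (coeff c s) * U ^ s * V ^ (n - s))"

lemma form_root_factor:
  fixes c :: "'f::field poly"
  assumes "c \<noteq> 0" "degree c \<le> n" "poly c r = 0"
  obtains c' where "c' \<noteq> 0" "n \<ge> 1" "degree c' \<le> n - 1"
    "\<And>U V. form n c U V = (U - cst r * V) * form (n - 1) c' U V"
proof -
  obtain c' where c': "c = [:- r, 1:] * c'" using assms(3) by (auto simp: poly_eq_0_iff_dvd)
  with assms(1) have nz: "c' \<noteq> 0" by auto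
  have "degree c = Suc (degree c')" using nz unfolding c' by (subst degree_mult_eq) auto
  then obtain m where m: "n = Suc m" "degree c' \<le> m" using assms(2) by (cases n) auto
  have "form n c U V = (U - cst r * V) * form (n - 1) c' U V" for U V
  proof -
    have e: "c = pCons 0 c' - smult r c'" by (simp add: c')
    have 1: "form (Suc m) (pCons 0 c') U V = U * form m c' U V"
      by (simp add: form_def sum.atMost_Suc_shift sum_distrib_left algebra_simps del: sum.atMost_Suc)
    have "form (Suc m) c' U V = (\<Sum>s\<le>m. cst (coeff c' s) * U ^ s * V ^ (Suc m - s))"
      using m by (simp add: form_def coeff_eq_0)
    also have "\<dots> = V * form m c' U V"
      unfolding form_def sum_distrib_left
      by (intro sum.cong refl) (simp add: Suc_diff_le)
    finally have 2: "form (Suc m) c' U V = V * form m c' U V" .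
    have "form n c U V = form (Suc m) (pCons 0 c') U V - cst r * form (Suc m) c' U V"
      unfolding m(1) form_def
      by (simp only: e coeff_diff coeff_smult cst.hom_diff cst.hom_mult sum_distrib_left
          sum_subtractf[symmetric] left_diff_distrib mult.assoc)
    then show ?thesis by (simp add: 1 2 m(1) algebra_simps)
  qed
  with nz m show thesis using that[of c'] by simp
qed

lemma ex_nonzero_value:
  fixes f :: "'f::field_char_0 poly poly"
  assumes "f \<noteq> 0"
  obtains y z where "ev2 (\<lambda>c. c) y z f \<noteq> 0"
proof -
  have ex: "\<exists>x. poly p x \<noteq> 0" if "p \<noteq> 0" for p :: "'f poly"
    using that poly_all_0_iff_0 by blast
  from ex[of "lead_coeff f"] assms obtain y where y: "poly (lead_coeff f) y \<noteq> 0" by auto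
  then have "coeff (map_poly (\<lambda>u. poly (map_poly (\<lambda>c. c) u) y) f) (degree f) \<noteq> 0"
    by (simp add: coeff_map_poly)
  then have "map_poly (\<lambda>u. poly (map_poly (\<lambda>c. c) u) y) f \<noteq> 0" by auto
  from ex[OF this] that show thesis unfolding ev2_def by blast
qed

text \<open>The field need not contain all roots of \<open>c\<close>. Specializing the relation at a
  point where \<open>V\<close> does not vanish shows that the ratio of the values there is a root
  \<open>r\<close>; then \<open>U - r V\<close> splits off, and unless this factor is zero the
  cofactor is a vanishing form of smaller degree with the same ratio.\<close>

lemma form_eq_0_imp_proportional:
  fixes U V :: "'f::field_char_0 poly poly"
  assumes "V \<noteq> 0" "c \<noteq> 0" "degree c \<le> n" "form n c U V = 0"
  obtains r where "U = cst r * V" "poly c r = 0"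
proof -
  obtain y z where yz: "ev2 (\<lambda>c. c) y z V \<noteq> 0" using ex_nonzero_value[OF assms(1)] .
  define r where "r = ev2 (\<lambda>c. c) y z U / ev2 (\<lambda>c. c) y z V"
  interpret e: rhom "ev2 (\<lambda>c. c) y z" by (rule rhom_ev2[OF rhom_id])
  have root: "poly c r = 0" if "degree c \<le> n" "form n c U V = 0" for n c
  proof -
    have "0 = ev2 (\<lambda>c. c) y z (form n c U V)" using that by simp
    also have "\<dots> = (\<Sum>s\<le>n. coeff c s * ev2 (\<lambda>c. c) y z U ^ s * ev2 (\<lambda>c. c) y z V ^ (n - s))"
      by (simp add: form_def e.hom_sum e.hom_mult e.hom_power ev2_simps[OF rhom_id])
    also have "\<dots> = (\<Sum>s\<le>n. coeff c s * r ^ s) * ev2 (\<lambda>c. c) y z V ^ n"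
      unfolding sum_distrib_right r_def using yz
      by (intro sum.cong refl) (simp add: power_divide power_diff)
    also have "(\<Sum>s\<le>n. coeff c s * r ^ s) = poly c r"
      unfolding poly_altdef
      using that by (intro sum.mono_neutral_right) (auto simp: coeff_eq_0)
    finally show ?thesis using yz by simp
  qed
  have "U = cst r * V" if "c \<noteq> 0" "degree c \<le> n" "form n c U V = 0" for c n
    using that
  proof (induction n arbitrary: c)
    case 0
    from form_root_factor[OF 0(1,2) root[OF 0(2,3)]] show ?case by (metis not_one_le_zero)
  next
    case (Suc n)
    from form_root_factor[OF Suc.prems(1,2) root[OF Suc.prems(2,3)]]
    obtain c' where c': "c' \<noteq> 0" "degree c' \<le> Suc n - 1"
      "\<And>U V. form (Suc n) c U V = (U - cst r * V) * form (Suc n - 1) c' U V" by metis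
    show ?case
    proof (cases "U = cst r * V")
      case False
      then have "form n c' U V = 0" using Suc.prems c' by simp
      then show ?thesis using Suc.IH[of c'] c' by simp
    qed
  qed
  then show thesis using that assms root by blast
qed

text \<open>Exponents of equal weight lie on a line with primitive direction (b', -a'). Starting
  from the point with smallest first exponent, the component is a monomial times a form in
  \<open>x ^ b'\<close> and \<open>y ^ a'\<close>.\<close>

lemma toppart_form:
  fixes f :: "'f::field poly poly"
  assumes ab: "a = g * a'" "b = g * b'" "g > 0" "coprime a' b'" "a' > 0" "b' > 0"
    and ne: "topset a b w f \<noteq> {}"
  obtains i0 j0 n c where "c \<noteq> 0" "degree c \<le> n"
    "\<And>x y. toppart a b w f x y = x ^ i0 * y ^ j0 * form n c (x ^ b') (y ^ a')"
proof -
  let ?T = "topset a b w f"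
  have fin: "finite ?T" using finite_supp2[of f] by (rule finite_subset[rotated]) (auto simp: topset_def)
  define i0 where "i0 = Min (fst ` ?T)"
  have "i0 \<in> fst ` ?T" unfolding i0_def using fin ne by (intro Min_in) auto
  then obtain j1 where j1: "(i0, j1) \<in> ?T" by auto
  have par: "\<exists>s. i = i0 + b' * s \<and> j1 = j + a' * s" if "(i, j) \<in> ?T" for i j
  proof -
    have i: "i0 \<le> i" unfolding i0_def using fin that by (intro Min_le) (auto intro!: image_eqI[of _ _ "(i, j)"])
    have "g * (i * a' + j * b') = g * (i0 * a' + j1 * b')"
      using that j1 ab by (simp add: topset_def algebra_simps)
    then have e: "i * a' + j * b' = i0 * a' + j1 * b'" using ab by simp
    then have e2: "(i - i0) * a' + j * b' = j1 * b'" using i by (simp add: diff_mult_distrib)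
    then have "j * b' \<le> j1 * b'" by linarith
    then have jj: "j \<le> j1" using ab by simp
    then have e3: "(i - i0) * a' = (j1 - j) * b'" using e2 by (simp add: diff_mult_distrib)
    then have "b' dvd (i - i0) * a'" by simp
    then have "b' dvd i - i0" using ab(4) by (simp add: coprime_commute coprime_dvd_mult_left_iff)
    then obtain s where s: "i - i0 = b' * s" by auto
    with e3 have "s * a' = j1 - j" using ab by simp
    then have "j1 - j = a' * s" by (metis mult.commute)
    with s i jj show ?thesis by (intro exI[of _ s]) auto
  qed
  \<comment> \<open>The number of steps (b', -a') possible before the second exponent becomes
    negative; \<open>j0\<close> is what is left over and belongs to the monomial factor.\<close>
  define n where "n = j1 div a'"
  define j0 where "j0 = j1 mod a'"
  have j1e: "j1 = j0 + a' * n" by (simp add: n_def j0_def)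
  define S where "S = {s. s \<le> n \<and> (i0 + b' * s, j1 - a' * s) \<in> ?T}"
  define cf where "cf s = (if s \<in> S then coeff (coeff f (j1 - a' * s)) (i0 + b' * s) else 0)" for s
  define c where "c = (\<Sum>s\<le>n. monom (cf s) s)"
  have cc: "coeff c s = (if s \<le> n then cf s else 0)" for s
    by (simp add: c_def coeff_sum)
  have T: "?T = (\<lambda>s. (i0 + b' * s, j1 - a' * s)) ` S"
  proof
    show "?T \<subseteq> (\<lambda>s. (i0 + b' * s, j1 - a' * s)) ` S"
    proof
      fix x assume x: "x \<in> ?T"
      obtain i j where ij: "x = (i, j)" by force
      with par x obtain s where s: "i = i0 + b' * s" "j1 = j + a' * s" by metis
      have "s \<le> n" unfolding n_def using s ab by (simp add: less_eq_div_iff_mult_less_eq mult.commute)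
      then show "x \<in> (\<lambda>s. (i0 + b' * s, j1 - a' * s)) ` S" using s x ij by (auto simp: S_def intro!: image_eqI[of _ _ s])
    qed
  qed (auto simp: S_def)
  have "c \<noteq> 0"
  proof -
    have "0 \<in> S" using j1 by (simp add: S_def)
    then have "coeff c 0 \<noteq> 0" using j1 by (simp add: cc cf_def topset_def supp2_def)
    then show ?thesis by auto
  qed
  moreover have "degree c \<le> n" by (rule degree_le) (simp add: cc)
  moreover have "toppart a b w f x y = x ^ i0 * y ^ j0 * form n c (x ^ b') (y ^ a')" for x y
  proof -
    have inj: "inj_on (\<lambda>s. (i0 + b' * s, j1 - a' * s)) S" using ab by (auto simp: inj_on_def)
    have "toppart a b w f x y = (\<Sum>s\<in>S. cst (cf s) * x ^ (i0 + b' * s) * y ^ (j1 - a' * s))"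
      unfolding toppart_def by (subst T, subst sum.reindex[OF inj]) (auto simp: cf_def intro!: sum.cong)
    also have "\<dots> = (\<Sum>s\<le>n. cst (cf s) * x ^ (i0 + b' * s) * y ^ (j1 - a' * s))"
      by (rule sum.mono_neutral_left) (auto simp: S_def cf_def)
    also have "\<dots> = x ^ i0 * y ^ j0 * form n c (x ^ b') (y ^ a')"
      unfolding form_def sum_distrib_left
    proof (intro sum.cong refl)
      fix s assume s: "s \<in> {..n}"
      then have "j1 - a' * s = j0 + a' * (n - s)" by (simp add: j1e diff_mult_distrib2)
      then show "cst (cf s) * x ^ (i0 + b' * s) * y ^ (j1 - a' * s) =
        x ^ i0 * y ^ j0 * (cst (coeff c s) * (x ^ b') ^ s * (y ^ a') ^ (n - s))"
        using s by (simp add: cc power_add power_mult mult_ac)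
    qed
    finally show ?thesis .
  qed
  ultimately show thesis using that by blast
qed

section \<open>Rentschler's theorem\<close>

locale lnd =
  fixes D :: "'f::field_char_0 poly poly \<Rightarrow> 'f poly poly"
  assumes LND: "is_LND cst D"
begin

lemma der: "is_der cst D"
  using LND by (simp add: is_LND_def)

lemma D_cst [simp]: "D (cst c) = 0"
  and D_add: "D (f + g) = D f + D g"
  and D_mult: "D (f * g) = f * D g + g * D f"
  using der by (simp_all add: is_der_def)

lemma D_0 [simp]: "D 0 = 0"
  by (rule is_der_zero[OF der])

lemma nilpotent: "\<exists>n. (D ^^ n) f = 0"
  using LND by (simp add: is_LND_def)

lemma D_cst_mult: "D (cst c * f) = cst c * D f"
  by (simp add: D_mult)

text \<open>The exponential exp(t D) as a polynomial in a new outermost variable t. It is a ring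
  homomorphism, which turns nilpotency orders into degrees in t.\<close>

definition EE :: "'f poly poly \<Rightarrow> 'f poly poly poly" where
  "EE f = Abs_poly (\<lambda>n. cst (inverse (fact n)) * (D ^^ n) f)"

lemma coeff_EE: "coeff (EE f) n = cst (inverse (fact n)) * (D ^^ n) f"
proof -
  obtain N where N: "(D ^^ N) f = 0" using nilpotent by blast
  have "cst (inverse (fact i)) * (D ^^ i) f = 0" if "i > N" for i
  proof -
    have "(D ^^ i) f = (D ^^ (i - N)) ((D ^^ N) f)"
      using that by (simp flip: funpow_add[THEN fun_cong, unfolded o_def])
    then show ?thesis by (simp add: N is_der_pow_zero[OF der])
  qed
  then have "coeff (EE f) = (\<lambda>n. cst (inverse (fact n)) * (D ^^ n) f)"
    unfolding EE_def by (rule coeff_Abs_poly)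
  then show ?thesis by simp
qed

lemma coeff_EE_0 [simp]: "coeff (EE f) 0 = f"
  by (simp add: coeff_EE cst.hom_one)

lemma EE_0 [simp]: "EE 0 = 0"
  by (rule poly_eqI) (simp add: coeff_EE is_der_pow_zero[OF der])

lemma EE_add: "EE (f + g) = EE f + EE g"
  by (rule poly_eqI) (simp add: coeff_EE is_der_pow_add[OF der] distrib_left)

lemma EE_D: "EE (D f) = pderiv (EE f)"
proof (rule poly_eqI)
  fix n
  have e: "(of_nat (Suc n) :: 'f) * inverse (fact (Suc n)) = inverse (fact n)"
    by (simp add: field_simps del: of_nat_Suc)
  have "coeff (pderiv (EE f)) n = cst (of_nat (Suc n)) * cst (inverse (fact (Suc n))) * (D ^^ Suc n) f"
    by (simp add: coeff_pderiv coeff_EE cst.hom_of_nat mult.assoc del: of_nat_Suc fact_Suc)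
  also have "cst (of_nat (Suc n)) * cst (inverse (fact (Suc n))) = cst (inverse (fact n) :: 'f)"
    by (simp only: cst.hom_mult[symmetric] e)
  finally show "coeff (EE (D f)) n = coeff (pderiv (EE f)) n"
    by (simp add: coeff_EE funpow_swap1)
qed

lemma EE_cst: "EE (cst c) = ccst c"
proof -
  have "pderiv (EE (cst c)) = 0" by (simp add: EE_D[symmetric])
  then obtain a where "EE (cst c) = [:a:]" by (metis degree_eq_zeroE pderiv_eq_0_iff)
  then show ?thesis using coeff_EE_0[of "cst c"] by simp
qed

text \<open>Both sides have the same constant term in t, and by induction on the nilpotency orders
  the same derivative by t.\<close>

lemma EE_mult: "EE (f * g) = EE f * EE g"
proof -
  have "EE (f * g) = EE f * EE g" if "(D ^^ a) f = 0" "(D ^^ b) g = 0" for a b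
    using that
  proof (induction "a + b" arbitrary: a b f g)
    case 0
    then show ?case by simp
  next
    case (Suc n)
    show ?case
    proof (cases "a = 0 \<or> b = 0")
      case True
      then show ?thesis using Suc.prems by auto
    next
      case False
      then obtain a' b' where ab: "a = Suc a'" "b = Suc b'" by (metis not0_implies_Suc)
      have 1: "EE (f * D g) = EE f * EE (D g)"
        by (rule Suc.hyps(1)[of a b']) (use Suc ab in \<open>simp_all add: funpow_swap1\<close>)
      have 2: "EE (g * D f) = EE g * EE (D f)"
        by (rule Suc.hyps(1)[of b a']) (use Suc ab in \<open>simp_all add: funpow_swap1\<close>)
      have "pderiv (EE (f * g) - EE f * EE g) = 0"
        by (simp add: pderiv_diff pderiv_mult EE_D[symmetric] D_mult EE_add 1 2)
      then obtain c where c: "EE (f * g) - EE f * EE g = [:c:]" by (metis degree_eq_zeroE pderiv_eq_0_iff)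
      have "coeff (EE (f * g) - EE f * EE g) 0 = 0" by (simp add: coeff_mult)
      with c show ?thesis by simp
    qed
  qed
  then show ?thesis using nilpotent by blast
qed

lemma rhom_EE: "rhom EE"
  by standard (simp_all add: EE_add EE_mult EE_cst[of 1, unfolded cst.hom_one] one_pCons[symmetric])

lemma EE_ev2: "EE f = ev2 ccst (EE YY) (EE ZZ) f"
  by (rule rhom_eqI[OF rhom_EE rhom_ev2[OF rhom_ccst]]) (simp_all add: ev2_simps[OF rhom_ccst] EE_cst)

text \<open>The largest n with \<open>(D ^^ n) f\<close> nonzero. The zero polynomial also gets
  degree 0, so that degree 0 describes exactly the kernel.\<close>

definition ddeg :: "'f poly poly \<Rightarrow> nat" where "ddeg f = degree (EE f)"

lemma EE_eq_0_iff [simp]: "EE f = 0 \<longleftrightarrow> f = 0"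
  by (metis EE_0 coeff_0 coeff_EE_0)

lemma ddeg_mult: "f \<noteq> 0 \<Longrightarrow> g \<noteq> 0 \<Longrightarrow> ddeg (f * g) = ddeg f + ddeg g"
  by (simp add: ddeg_def EE_mult degree_mult_eq)

lemma D_eq_0_iff: "D f = 0 \<longleftrightarrow> ddeg f = 0"
  by (metis EE_D EE_eq_0_iff ddeg_def pderiv_eq_0_iff)

lemma ddeg_D: "ddeg (D f) = ddeg f - 1"
  by (simp add: ddeg_def EE_D degree_pderiv)

lemma ddeg_dvd_le: "f dvd g \<Longrightarrow> g \<noteq> 0 \<Longrightarrow> ddeg f \<le> ddeg g"
  by (auto simp: ddeg_mult)

text \<open>If neither derivative vanished, each of the two degrees would be at most the other minus
  one.\<close>

lemma dvd_D_swap: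
  assumes "f dvd D g" "g dvd D f"
  shows "D f = 0 \<or> D g = 0"
proof (rule ccontr)
  assume n: "\<not> ?thesis"
  then have "ddeg f \<le> ddeg g - 1" "ddeg g \<le> ddeg f - 1"
    using assms ddeg_dvd_le[of f "D g"] ddeg_dvd_le[of g "D f"] by (auto simp: ddeg_D)
  moreover have "ddeg f > 0" "ddeg g > 0" using n by (auto simp: D_eq_0_iff)
  ultimately show False by linarith
qed

text \<open>The kernel is factorially closed, because degrees add up in products.\<close>

lemma ker_factor:
  assumes "D (f * g) = 0" "f * g \<noteq> 0"
  shows "D f = 0"
  using assms by (auto simp: D_eq_0_iff ddeg_mult)

end

section \<open>Divisibility by the variables\<close>

lemma dvd_X_iff: "[:0, 1:] dvd f \<longleftrightarrow> poly f 0 = 0" for f :: "'a::idom poly"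
  using poly_eq_0_iff_dvd[of f 0] by simp

lemma prime_X: "prime_elem ([:0, 1:] :: 'a::idom poly)"
  by (rule prime_elemI) (auto simp: dvd_X_iff)

lemma prime_YY: "prime_elem (YY :: 'a::idom poly poly)"
  unfolding YY_def using prime_X by (simp add: prime_elem_const_poly_iff)

lemma prime_ZZ: "prime_elem (ZZ :: 'a::idom poly poly)"
  unfolding ZZ_def by (rule prime_X)

lemma not_YY_dvd_ZZ_power: "\<not> (YY :: 'a::idom poly poly) dvd ZZ ^ n"
proof
  assume "(YY :: 'a poly poly) dvd ZZ ^ n"
  then have "(YY :: 'a poly poly) dvd ZZ" using prime_YY prime_elem_dvd_power by blast
  then have "[:0, 1:] dvd coeff (ZZ :: 'a poly poly) 1" unfolding YY_def const_poly_dvd_iff by blast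
  then show False by (simp add: ZZ_def dvd_X_iff)
qed

lemma not_ZZ_dvd_YY_power: "\<not> (ZZ :: 'a::idom poly poly) dvd YY ^ n"
proof
  assume "(ZZ :: 'a poly poly) dvd YY ^ n"
  then have "(ZZ :: 'a poly poly) dvd YY" using prime_ZZ prime_elem_dvd_power by blast
  then show False unfolding ZZ_def dvd_X_iff by (simp add: YY_def)
qed

text \<open>The weighted grading is encoded by the substitution \<open>YY \<mapsto> YY t\<^sup>a\<close>, \<open>ZZ \<mapsto> ZZ t\<^sup>b\<close>.\<close>
lemma (in lnd) leading_derivation:
  assumes nz: "D YY \<noteq> 0"
  obtains D' A B where "is_LND cst D'" "\<forall>f. D' f = A * dy f + B * dz f" "A \<noteq> 0 \<or> B \<noteq> 0"
    "\<forall>f w. D f = 0 \<longrightarrow> degree (ev2 ccst (monom YY a) (monom ZZ b) f) \<le> w \<longrightarrow>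
        D' (coeff (ev2 ccst (monom YY a) (monom ZZ b) f) w) = 0"
proof -
  define \<Phi> :: "'f poly poly \<Rightarrow> 'f poly poly poly" where "\<Phi> = ev2 ccst (monom YY a) (monom ZZ b)"
  interpret \<Phi>: rhom \<Phi> unfolding \<Phi>_def by (rule rhom_ev2[OF rhom_ccst])
  have \<Phi>s: "\<Phi> (cst c) = ccst c" "\<Phi> YY = monom YY a" "\<Phi> ZZ = monom ZZ b" for c
    by (simp_all add: \<Phi>_def ev2_simps[OF rhom_ccst])
  \<comment> \<open>Setting t = 1 recovers \<open>f\<close>.\<close>
  have inj: "f = 0" if "\<Phi> f = 0" for f
  proof -
    have "poly (\<Phi> f) 1 = f"
    proof (rule rhom_eqI[OF _ rhom_id])
      show "rhom (\<lambda>f. poly (\<Phi> f) 1)"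
        by standard (simp_all add: \<Phi>.hom_one \<Phi>.hom_add \<Phi>.hom_mult)
    qed (simp_all add: \<Phi>s poly_monom)
    with that show ?thesis by simp
  qed
  define dY dZ :: "'f poly poly poly \<Rightarrow> 'f poly poly poly"
    where "dY = map_poly dy" and "dZ = map_poly dz"
  have z0: "dy 0 = (0 :: 'f poly poly)" "dz 0 = (0 :: 'f poly poly)"
    by (simp_all add: dy_def dz_def)
  have dYZ: "dY (f + g) = dY f + dY g" "dZ (f + g) = dZ f + dZ g"
     "dY (f * g) = f * dY g + g * dY f" "dZ (f * g) = f * dZ g + g * dZ f"
     "dY (monom c n) = monom (dy c) n" "dZ (monom c n) = monom (dz c) n" for f g c n
    unfolding dY_def dZ_def
    by (simp_all add: map_poly_derivation dy_add dz_add dy_mult dz_mult map_poly_monom z0)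
      (rule poly_eqI, simp add: coeff_map_poly z0 dy_add dz_add)+
  have dYc: "dY (ccst c) = 0" "dZ (ccst c) = 0" for c
    using dYZ(5,6)[of "cst c" 0] by (simp_all add: monom_0)
  have dY\<Phi>: "dY (\<Phi> f) = monom 1 a * \<Phi> (dy f)" for f
    using der_along_eq[of \<Phi> "\<lambda>f. dY (\<Phi> f)" f]
    by (simp add: \<Phi>.rhom_axioms der_along_def \<Phi>.hom_add \<Phi>.hom_mult dYZ \<Phi>s dYc mult.commute)
  have dZ\<Phi>: "dZ (\<Phi> f) = monom 1 b * \<Phi> (dz f)" for f
    using der_along_eq[of \<Phi> "\<lambda>f. dZ (\<Phi> f)" f]
    by (simp add: \<Phi>.rhom_axioms der_along_def \<Phi>.hom_add \<Phi>.hom_mult dYZ \<Phi>s dYc mult.commute)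
  \<comment> \<open>The partial derivatives lower the weight by a and b; multiplying by t^(a+b)
    avoids negative powers of t, and \<Delta> is the transported \<open>D\<close> after this
    multiplication.\<close>
  define P Q where "P = monom 1 b * \<Phi> (D YY)" and "Q = monom 1 a * \<Phi> (D ZZ)"
  define \<Delta> where "\<Delta> g = P * dY g + Q * dZ g" for g
  have "P \<noteq> 0" using nz inj unfolding P_def by (auto simp: monom_eq_0_iff)
  \<comment> \<open>\<open>A\<close> and \<open>B\<close> are the coefficients of the component of
    highest weight of the transported derivation; at least one is nonzero because \<open>P\<close>
    is.\<close>
  define m where "m = max (degree P) (degree Q)"
  define A B where "A = coeff P m" and "B = coeff Q m"
  have AB: "A \<noteq> 0 \<or> B \<noteq> 0"
  proof (cases "m = degree P")
    case True
    with \<open>P \<noteq> 0\<close> show ?thesis by (auto simp: A_def)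
  next
    case False
    then have "m = degree Q" "degree Q > degree P" by (auto simp: m_def max_def split: if_splits)
    then show ?thesis unfolding B_def by (metis degree_0 leading_coeff_0_iff not_less_zero)
  qed
  define D' where "D' f = A * dy f + B * dz f" for f
  have der': "is_der cst D'"
    by (simp add: is_der_def D'_def dy_add dz_add dy_mult dz_mult algebra_simps)
  have \<Delta>\<Phi>: "monom 1 (a + b) * \<Phi> (D f) = \<Delta> (\<Phi> f)" for f
    unfolding \<Delta>_def dY\<Phi> dZ\<Phi> P_def Q_def is_der_eq[OF der, of f]
    by (simp add: \<Phi>.hom_add \<Phi>.hom_mult mult_monom[symmetric] distrib_left mult_ac)
      (simp add: mult_monom mult.assoc[symmetric] add.commute)
  have \<Delta>mon: "\<Delta> (monom 1 k * g) = monom 1 k * \<Delta> g" for k g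
    unfolding \<Delta>_def dYZ by (simp add: dy_simps(1)[of 1, unfolded cst.hom_one] dz_simps(1)[of 1, unfolded cst.hom_one] algebra_simps)
  have top: "degree (\<Delta> g) \<le> m + n \<and> coeff (\<Delta> g) (m + n) = D' (coeff g n)" if "degree g \<le> n" for g n
  proof -
    have d: "degree (dY g) \<le> n" "degree (dZ g) \<le> n"
      using that unfolding dY_def dZ_def by (auto intro!: degree_le simp: coeff_map_poly z0 coeff_eq_0)
    have "degree P \<le> m" "degree Q \<le> m" by (simp_all add: m_def)
    with d show ?thesis unfolding \<Delta>_def D'_def
      by (simp add: coeff_mult_top degree_mult_le' degree_add_le)
        (simp add: A_def B_def dY_def dZ_def coeff_map_poly z0)
  qed
  have top_pow: "degree ((\<Delta> ^^ k) g) \<le> k * m + n \<and> coeff ((\<Delta> ^^ k) g) (k * m + n) = (D' ^^ k) (coeff g n)"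
    if "degree g \<le> n" for g n k
  proof (induction k)
    case (Suc k)
    then show ?case using top[of "(\<Delta> ^^ k) g" "k * m + n"] by (simp add: add.assoc)
  qed (use that in simp)
  have pow: "(\<Delta> ^^ k) (\<Phi> f) = monom 1 (k * (a + b)) * \<Phi> ((D ^^ k) f)" for k f
  proof (induction k)
    case 0
    then show ?case by simp
  next
    case (Suc k)
    then show ?case by (simp add: \<Delta>mon \<Delta>\<Phi>[symmetric] mult.assoc[symmetric] mult_monom add.commute)
  qed
  \<comment> \<open>Nilpotency passes to the highest component: the formal top coefficient of an
    iterate of \<Delta> is the iterate of \<open>D'\<close> on the top coefficient.\<close>
  have nil: "(D' ^^ k) (coeff (\<Phi> f) n) = 0" if "(D ^^ k) f = 0" "degree (\<Phi> f) \<le> n" for k f n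
    using top_pow[OF that(2), of k] that(1) by (simp add: pow)
  have "is_LND cst D'"
  proof (rule is_LND_generators[OF der' gen_YY_ZZ])
    fix s assume "s \<in> {YY, ZZ :: 'f poly poly}"
    then show "\<exists>n. (D' ^^ n) s = 0"
      using nilpotent[of YY] nilpotent[of ZZ] nil[of _ YY a] nil[of _ ZZ b] by (auto simp: \<Phi>s degree_monom_le)
  qed
  moreover have "D' (coeff (\<Phi> f) w) = 0" if "D f = 0" "degree (\<Phi> f) \<le> w" for f w
    using nil[of 1 f w] that by simp
  ultimately show thesis using that[of D' A B] AB by (simp add: D'_def \<Phi>_def)
qed

lemma is_der_power:
  assumes "is_der emb d"
  shows "d (x ^ n) = of_nat n * x ^ (n - 1) * d x"
proof (induction n)
  case 0
  have "d (1 * 1) = 1 * d 1 + 1 * d 1" using assms unfolding is_der_def by blast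
  then show ?case by simp
next
  case (Suc n)
  have "d (x ^ Suc n) = x * d (x ^ n) + x ^ n * d x"
    using assms by (simp add: is_der_def)
  with Suc show ?case by (cases n) (simp_all add: algebra_simps)
qed

lemma degree_less_of_coeff:
  assumes "degree p \<le> n" "coeff p n = 0" "n > 0"
  shows "degree p < n"
  using assms eq_zero_or_degree_less[of p n] by auto

text \<open>The leading form of \<open>F\<close> vanishes at the leading coefficients \<alpha>,
  \<beta> of the exponentials of \<open>YY\<close> and \<open>ZZ\<close>. This yields a scalar
  \<open>r\<close> in the base field with \<open>\<alpha> ^ b' = r \<beta> ^ a'\<close>, which
  serves twice: it gives a factor of the leading form, and it is the coefficient with which a shear
  cancels leading terms.\<close>

lemma (in lnd) reduction:
  assumes F: "D F = 0" "F \<notin> range cst" and nz: "D YY \<noteq> 0" "D ZZ \<noteq> 0"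
  shows "(\<exists>n c. ddeg (ZZ - cst c * YY ^ n) < ddeg ZZ) \<or> (\<exists>n c. ddeg (YY - cst c * ZZ ^ n) < ddeg YY)"
proof -
  define a b where "a = ddeg YY" and "b = ddeg ZZ"
  have ab: "a > 0" "b > 0" using nz by (simp_all add: a_def b_def D_eq_0_iff)
  define wt where "wt = (\<lambda>(i, j). i * a + j * b)"
  define w where "w = Max (wt ` supp2 F)"
  have sne: "\<exists>i j. (i, j) \<in> supp2 F \<and> (i, j) \<noteq> (0, 0)"
  proof (rule ccontr)
    assume "\<not> ?thesis"
    then have sub: "supp2 F \<subseteq> {(0, 0)}" by auto
    have "F = (\<Sum>(i, j)\<in>supp2 F. cst (coeff (coeff F j) i) * YY ^ i * ZZ ^ j)" by (rule supp2_sum)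
    also have "\<dots> = (\<Sum>(i, j)\<in>{(0, 0)}. cst (coeff (coeff F j) i) * YY ^ i * ZZ ^ j)"
      using sub by (intro sum.mono_neutral_left) (auto simp: supp2_def)
    also have "\<dots> = cst (coeff (coeff F 0) 0)" by simp
    finally show False using F(2) by auto
  qed
  have le: "i * a + j * b \<le> w" if "(i, j) \<in> supp2 F" for i j
    unfolding w_def using that finite_supp2[of F]
    by (intro Max_ge) (auto simp: wt_def intro!: image_eqI[of _ _ "(i, j)"])
  have w0: "w > 0"
  proof -
    obtain i j where "(i, j) \<in> supp2 F" "(i, j) \<noteq> (0, 0)" using sne by blast
    moreover from this have "i * a + j * b > 0" using ab by auto
    ultimately show ?thesis using le[of i j] by (meson less_le_trans)
  qed
  have "w \<in> wt ` supp2 F" unfolding w_def using sne finite_supp2[of F] by (intro Max_in) auto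
  then have ne: "topset a b w F \<noteq> {}" by (auto simp: topset_def wt_def)
  define \<alpha> \<beta> where "\<alpha> = coeff (EE YY) a" and "\<beta> = coeff (EE ZZ) b"
  have YZ: "(YY :: 'f poly poly) \<noteq> 0" "(ZZ :: 'f poly poly) \<noteq> 0" by (simp_all add: YY_def ZZ_def)
  have \<alpha>\<beta>: "\<alpha> \<noteq> 0" "\<beta> \<noteq> 0" using YZ by (simp_all add: \<alpha>_def \<beta>_def a_def b_def ddeg_def)
  \<comment> \<open>The exponential of \<open>F\<close> is constant in t because \<open>F\<close> is
    in the kernel, so its coefficient at the positive degree \<open>w\<close> is zero.\<close>
  have "toppart a b w F \<alpha> \<beta> = coeff (EE F) w"
    unfolding EE_ev2[of F] \<alpha>_def \<beta>_def
    by (rule ev2_top(2)[symmetric]) (use le in \<open>auto simp: a_def b_def ddeg_def\<close>)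
  also have "\<dots> = 0" using F(1) w0 by (intro coeff_eq_0) (simp add: D_eq_0_iff ddeg_def)
  finally have rel: "toppart a b w F \<alpha> \<beta> = 0" .
  define g a' b' where "g = gcd a b" and "a' = a div g" and "b' = b div g"
  have g: "g > 0" "a = g * a'" "b = g * b'" using ab by (simp_all add: g_def a'_def b'_def)
  have a'b': "a' > 0" "b' > 0" using ab g by (auto intro!: gr0I)
  have cop: "coprime a' b'" unfolding a'_def b'_def g_def using ab by (intro div_gcd_coprime) simp
  obtain i0 j0 n c where c: "c \<noteq> 0" "degree c \<le> n"
    and tp: "\<And>x y. toppart a b w F x y = x ^ i0 * y ^ j0 * form n c (x ^ b') (y ^ a')"
    by (rule toppart_form[OF g(2,3,1) cop a'b' ne]) (rule that)
  have "form n c (\<alpha> ^ b') (\<beta> ^ a') = 0" using rel \<alpha>\<beta> unfolding tp by simp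
  then obtain r where r: "\<alpha> ^ b' = cst r * \<beta> ^ a'" "poly c r = 0"
    using form_eq_0_imp_proportional[OF _ c] \<alpha>\<beta> by (metis power_not_zero)
  have r0: "r \<noteq> 0" using r(1) \<alpha>\<beta> by auto
  obtain c' where "c' \<noteq> 0" "n \<ge> 1" "degree c' \<le> n - 1"
    and c': "\<And>U V. form n c U V = (U - cst r * V) * form (n - 1) c' U V"
    by (rule form_root_factor[OF c r(2)]) (rule that)
  obtain D' A B where D': "is_LND cst D'" "\<forall>f. D' f = A * dy f + B * dz f" "A \<noteq> 0 \<or> B \<noteq> 0"
    "\<forall>f w. D f = 0 \<longrightarrow> degree (ev2 ccst (monom YY a) (monom ZZ b) f) \<le> w \<longrightarrow>
        D' (coeff (ev2 ccst (monom YY a) (monom ZZ b) f) w) = 0"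
    by (rule leading_derivation[OF nz(1), where a = a and b = b]) (rule that)
  interpret d: lnd D' by standard (rule D'(1))
  have mon: "degree (monom (YY :: 'f poly poly) a) \<le> a" "degree (monom (ZZ :: 'f poly poly) b) \<le> b"
    by (simp_all add: degree_monom_le)
  have "D' (toppart a b w F YY ZZ) = 0"
    using D'(4)[rule_format, OF F(1), of w] ev2_top[OF le mon] by simp
  then have k1: "D' ((YY ^ b' - cst r * ZZ ^ a') * (YY ^ i0 * ZZ ^ j0 * form (n - 1) c' (YY ^ b') (ZZ ^ a'))) = 0"
    unfolding tp c' by (simp add: mult_ac)
  have "form n c (YY ^ b') (ZZ ^ a') \<noteq> 0"
  proof
    assume f0: "form n c (YY ^ b') (ZZ ^ a') = 0"
    have "ZZ ^ a' \<noteq> (0 :: 'f poly poly)" using YZ by simp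
    from this c f0 obtain s where "YY ^ b' = cst s * ZZ ^ a'" "poly c s = 0"
      by (rule form_eq_0_imp_proportional)
    moreover have "ZZ dvd cst s * ZZ ^ a'" using a'b' by (intro dvd_mult dvd_power) simp
    ultimately have "ZZ dvd (YY :: 'f poly poly) ^ b'" by simp
    then show False using not_ZZ_dvd_YY_power by blast
  qed
  then have "(YY ^ b' - cst r * ZZ ^ a') * (YY ^ i0 * ZZ ^ j0 * form (n - 1) c' (YY ^ b') (ZZ ^ a')) \<noteq> 0"
    unfolding c' using YZ by simp
  \<comment> \<open>A factor of a nonzero kernel element is in the kernel; differentiating it
    relates \<open>A = D' YY\<close> to \<open>B = D' ZZ\<close>.\<close>
  from d.ker_factor[OF k1 this] have "D' (YY ^ b') = cst r * D' (ZZ ^ a')"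
    using d.D_add[of "YY ^ b' - cst r * ZZ ^ a'" "cst r * ZZ ^ a'"] by (simp add: d.D_cst_mult)
  then have "cst (of_nat b') * (YY ^ (b' - 1) * A) = cst (r * of_nat a') * (ZZ ^ (a' - 1) * B)"
    by (simp add: is_der_power[OF d.der] spec[OF D'(2), of YY] spec[OF D'(2), of ZZ] cst.hom_of_nat cst.hom_mult mult.assoc)
  then have "cst (inverse (of_nat b')) * (cst (of_nat b') * (YY ^ (b' - 1) * A)) =
      cst (inverse (of_nat b')) * (cst (r * of_nat a') * (ZZ ^ (a' - 1) * B))" by simp
  then have eq: "YY ^ (b' - 1) * A = cst (inverse (of_nat b') * r * of_nat a') * (ZZ ^ (a' - 1) * B)"
    using a'b' by (simp add: mult.assoc[symmetric] cst.hom_mult[symmetric] cst.hom_one)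
  define s where "s = inverse (of_nat b') * r * of_nat a'"
  have s0: "s \<noteq> 0" using r0 a'b' by (simp add: s_def)
  have eq': "ZZ ^ (a' - 1) * B = cst (inverse s) * (YY ^ (b' - 1) * A)"
    unfolding eq s_def[symmetric] using s0
    by (simp add: mult.assoc[symmetric] cst.hom_mult[symmetric] cst.hom_one)
  \<comment> \<open>If both exponents were larger, the relation would make \<open>ZZ\<close> divide
    \<open>D' YY\<close> and \<open>YY\<close> divide \<open>D' ZZ\<close>, so one of these would
    vanish, and by the relation also the other.\<close>
  have "a' = 1 \<or> b' = 1"
  proof (rule ccontr)
    assume "\<not> ?thesis"
    then have gt: "a' - 1 > 0" "b' - 1 > 0" using a'b' by auto
    have "ZZ dvd YY ^ (b' - 1) * A" unfolding eq using gt by simp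
    then have "ZZ dvd A" using prime_elem_dvd_multD[OF prime_ZZ] not_ZZ_dvd_YY_power by blast
    moreover have "YY dvd ZZ ^ (a' - 1) * B" unfolding eq' using gt by simp
    then have "YY dvd B" using prime_elem_dvd_multD[OF prime_YY] not_YY_dvd_ZZ_power by blast
    ultimately have "A = 0 \<or> B = 0"
      using d.dvd_D_swap[of ZZ YY] by (auto simp: D'(2))
    then show False using eq eq' D'(3) YZ by auto
  qed
  then show ?thesis
  proof
    assume 1: "a' = 1"
    \<comment> \<open>With \<open>a' = 1\<close> the two terms have the same degree
      \<open>b\<close>, and their leading coefficients cancel by the choice of
      \<open>r\<close>.\<close>
    have "degree (EE (ZZ - cst (inverse r) * YY ^ b')) < b"
    proof (rule degree_less_of_coeff)
      interpret E: rhom EE by (rule rhom_EE)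
      have e: "EE (ZZ - cst (inverse r) * YY ^ b') = EE ZZ - smult (cst (inverse r)) (EE YY ^ b')"
        by (simp add: E.hom_diff E.hom_mult E.hom_power EE_cst)
      have ba: "b' * a = b" using g 1 by simp
      have p: "degree (EE YY ^ b') \<le> b" "coeff (EE YY ^ b') b = \<alpha> ^ b'"
        using degree_coeff_power_top[of "EE YY" a b'] unfolding ba \<alpha>_def by (simp_all add: a_def ddeg_def)
      show "degree (EE (ZZ - cst (inverse r) * YY ^ b')) \<le> b"
        unfolding e using p(1) by (intro degree_diff_le order.trans[OF degree_smult_le]) (simp_all add: b_def ddeg_def)
      show "coeff (EE (ZZ - cst (inverse r) * YY ^ b')) b = 0"
        unfolding e using r(1) r0 1 by (simp add: p(2) \<beta>_def[symmetric] mult.assoc[symmetric] cst.hom_mult[symmetric] cst.hom_one)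
    qed (use ab in simp)
    then show ?thesis unfolding b_def ddeg_def by blast
  next
    assume 1: "b' = 1"
    have "degree (EE (YY - cst r * ZZ ^ a')) < a"
    proof (rule degree_less_of_coeff)
      interpret E: rhom EE by (rule rhom_EE)
      have e: "EE (YY - cst r * ZZ ^ a') = EE YY - smult (cst r) (EE ZZ ^ a')"
        by (simp add: E.hom_diff E.hom_mult E.hom_power EE_cst)
      have ba: "a' * b = a" using g 1 by simp
      have p: "degree (EE ZZ ^ a') \<le> a" "coeff (EE ZZ ^ a') a = \<beta> ^ a'"
        using degree_coeff_power_top[of "EE ZZ" b a'] unfolding ba \<beta>_def by (simp_all add: b_def ddeg_def)
      show "degree (EE (YY - cst r * ZZ ^ a')) \<le> a"
        unfolding e using p(1) by (intro degree_diff_le order.trans[OF degree_smult_le]) (simp_all add: a_def ddeg_def)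
      show "coeff (EE (YY - cst r * ZZ ^ a')) a = 0"
        unfolding e using r(1) 1 by (simp add: p(2) \<alpha>_def[symmetric])
    qed (use ab in simp)
    then show ?thesis unfolding a_def ddeg_def by blast
  qed
qed

text \<open>Only what the degree reduction produces: swaps and shears by a monomial. Scalings and
  translations enter later through \<open>T2\<close>.\<close>

inductive tame :: "'c::comm_ring_1 poly poly \<Rightarrow> 'c poly poly \<Rightarrow> bool" where
  tame_id: "tame YY ZZ"
| tame_swap: "tame u v \<Longrightarrow> tame v u"
| tame_shear: "tame u v \<Longrightarrow> tame u (v - cst c * u ^ n)"

lemma kalg_power: "x \<in> kalg emb S \<Longrightarrow> x ^ n \<in> kalg emb S" if "emb 1 = 1"
  by (induction n) (use that kalg.const[of emb 1 S] in \<open>auto intro: kalg.mult\<close>)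

lemma tame_gen: "tame u v \<Longrightarrow> gen u v"
proof (induction rule: tame.induct)
  case tame_id
  show ?case by (rule gen_YY_ZZ)
next
  case (tame_swap u v)
  then show ?case using gen_swap by blast
next
  case (tame_shear u v c n)
  let ?S = "kalg cst {u, v - cst c * u ^ n}"
  have u: "u \<in> ?S" by (rule kalg.gen) simp
  have "(v - cst c * u ^ n) + cst c * u ^ n \<in> ?S"
    by (intro kalg.add kalg.mult kalg.const kalg_power u cst.hom_one kalg.gen) simp
  then show ?case using gen_subset[OF tame_shear.IH u] by simp
qed

text \<open>A description by powers of \<open>D\<close>, which allows degrees to be compared between
  \<open>D\<close> and its conjugates. At n = 0 it would fail for the zero polynomial.\<close>

lemma (in lnd) ddeg_less_iff: "n > 0 \<Longrightarrow> ddeg f < n \<longleftrightarrow> (D ^^ n) f = 0"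
proof
  assume "n > 0" "(D ^^ n) f = 0"
  then have "coeff (EE f) m = 0" if "m \<ge> n" for m
  proof -
    have "(D ^^ m) f = (D ^^ (m - n)) ((D ^^ n) f)"
      using that by (simp flip: funpow_add[THEN fun_cong, unfolded o_def])
    then show ?thesis using \<open>(D ^^ n) f = 0\<close> by (simp add: coeff_EE is_der_pow_zero[OF der])
  qed
  then have "degree (EE f) < n" using \<open>n > 0\<close>
    by (metis degree_0 leading_coeff_0_iff not_le_imp_less)
  then show "ddeg f < n" by (simp add: ddeg_def)
next
  assume "ddeg f < n"
  then have "coeff (EE f) n = 0" by (simp add: ddeg_def coeff_eq_0)
  then show "(D ^^ n) f = 0" by (simp add: coeff_EE)
qed

text \<open>Descent on the sum of the two degrees. The reduction speaks of the variables
  \<open>YY\<close>, \<open>ZZ\<close>, so \<open>D\<close> is first conjugated by the automorphism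
  that sends them to the current pair; conjugation preserves degrees.\<close>

theorem (in lnd) Rentschler:
  assumes F: "D F = 0" "F \<notin> range cst"
  obtains u v where "tame u v" "D u = 0"
proof -
  have "\<exists>u v. tame u v \<and> D u = 0" if "tame u v" for u v :: "'f poly poly"
    using that
  proof (induction "ddeg u + ddeg v" arbitrary: u v rule: less_induct)
    case less
    show ?case
    proof (cases "D u = 0 \<or> D v = 0")
      case True
      then show ?thesis using less.prems tame_swap by blast
    next
      case False
      define \<sigma> where "\<sigma> = sub u v"
      have g: "gen u v" by (rule tame_gen[OF less.prems])
      obtain c where "Jac u v = cst c" "c \<noteq> 0" using gen_Jac_field[OF g] .
      then have "inj \<sigma>" unfolding \<sigma>_def by (intro inj_sub) simp
      moreover have "surj \<sigma>" using g by (simp add: kalg2_eq \<sigma>_def)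
      ultimately have \<sigma>inv: "\<sigma> (inv_into UNIV \<sigma> x) = x" "inv_into UNIV \<sigma> (\<sigma> x) = x" for x
        by (simp_all add: surj_f_inv_f)
      interpret s: rhom \<sigma> unfolding \<sigma>_def by (rule rhom_sub)
      have inv_eq: "inv_into UNIV \<sigma> x = y \<longleftrightarrow> x = \<sigma> y" for x y using \<sigma>inv by metis
      have \<sigma>s: "\<sigma> (cst c) = cst c" "\<sigma> YY = u" "\<sigma> ZZ = v" for c by (simp_all add: \<sigma>_def)
      define D' where "D' f = inv_into UNIV \<sigma> (D (\<sigma> f))" for f
      have pow: "\<sigma> ((D' ^^ n) f) = (D ^^ n) (\<sigma> f)" for n f
        by (induction n) (simp_all add: D'_def \<sigma>inv)
      have pow0: "(D' ^^ n) f = 0 \<longleftrightarrow> (D ^^ n) (\<sigma> f) = 0" for n f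
        using pow[of n f] \<sigma>inv(2)[of "(D' ^^ n) f"] inv_eq[of 0 0] by auto
      have "is_der cst D'"
        by (simp add: is_der_def D'_def inv_eq s.hom_add s.hom_mult \<sigma>s \<sigma>inv D_add D_mult)
      then have "is_LND cst D'" using nilpotent by (simp add: is_LND_def pow0)
      then interpret d: lnd D' by (rule lnd.intro)
      have dd: "d.ddeg f = ddeg (\<sigma> f)" for f
      proof -
        have "d.ddeg f < n \<longleftrightarrow> ddeg (\<sigma> f) < n" if "n > 0" for n
          using that by (simp add: d.ddeg_less_iff ddeg_less_iff pow0)
        from this[of "Suc (d.ddeg f)"] this[of "Suc (ddeg (\<sigma> f))"] show ?thesis by simp
      qed
      have "D' (inv_into UNIV \<sigma> F) = 0" using F by (simp add: D'_def \<sigma>inv inv_eq)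
      moreover have "inv_into UNIV \<sigma> F \<notin> range cst" using F(2) by (auto simp: inv_eq \<sigma>s)
      moreover have "D' YY \<noteq> 0" "D' ZZ \<noteq> 0" using False by (auto simp: D'_def inv_eq \<sigma>s)
      ultimately have "(\<exists>n c. ddeg (v - cst c * u ^ n) < ddeg v) \<or> (\<exists>n c. ddeg (u - cst c * v ^ n) < ddeg u)"
        using d.reduction[of "inv_into UNIV \<sigma> F"] by (simp add: dd \<sigma>s s.hom_diff s.hom_mult s.hom_power)
      then show ?thesis
      proof (elim disjE exE)
        fix n c assume "ddeg (v - cst c * u ^ n) < ddeg v"
        then show ?thesis using less.hyps[of u "v - cst c * u ^ n"] tame_shear[OF less.prems] by simp
      next
        fix n c assume "ddeg (u - cst c * v ^ n) < ddeg u"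
        then show ?thesis
          using less.hyps[of v "u - cst c * v ^ n"] tame_shear[OF tame_swap[OF less.prems]] by simp
      qed
    qed
  qed
  then show thesis using tame_id that by blast
qed

section \<open>Triangular automorphisms and swap chains\<close>

instance fract :: ("{idom,ring_char_0}") field_char_0
proof
  show "inj (of_nat :: nat \<Rightarrow> 'a fract)"
    by (rule injI) (simp add: of_nat_fract eq_fract)
qed

section \<open>Change of coefficients and passage from k[x] to its fraction field\<close>

abbreviation fr :: "'a::idom \<Rightarrow> 'a fract" where "fr r \<equiv> Fract r 1"

lemma rhom_fr: "rhom (fr :: 'a::idom \<Rightarrow> 'a fract)"
  by standard (simp_all add: One_fract_def)

interpretation fr: rhom "fr :: 'a::idom \<Rightarrow> 'a fract" by (rule rhom_fr)

lemma fr_eq_iff [simp]: "fr a = fr b \<longleftrightarrow> a = b"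
  by (simp add: eq_fract)

lemma fr_eq_0_iff [simp]: "fr a = 0 \<longleftrightarrow> a = 0"
  using fr_eq_iff[of a 0] by (simp del: fr_eq_iff)

abbreviation mapc :: "('a::comm_ring_1 \<Rightarrow> 'b::comm_ring_1) \<Rightarrow> 'a poly poly \<Rightarrow> 'b poly poly" where
  "mapc h \<equiv> map_poly (map_poly h)"

lemma rhom_mapc: "rhom h \<Longrightarrow> rhom (mapc h)"
  by (intro rhom.rhom_map_poly)

lemma mapc_simps:
  assumes "rhom h"
  shows "mapc h (cst c) = cst (h c)" "mapc h YY = YY" "mapc h ZZ = ZZ"
proof -
  interpret rhom h by fact
  show "mapc h (cst c) = cst (h c)" "mapc h YY = YY" "mapc h ZZ = ZZ"
    by (simp_all add: cst_def YY_def ZZ_def map_poly_pCons hom_one one_pCons)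
qed

lemma dz_mapc: "rhom h \<Longrightarrow> dz (mapc h f) = mapc h (dz f)" for h :: "'a::idom \<Rightarrow> 'b::idom"
  unfolding dz_def by (intro pderiv_map_poly rhom.rhom_map_poly)

lemma dy_mapc: "rhom h \<Longrightarrow> dy (mapc h f) = mapc h (dy f)" for h :: "'a::idom \<Rightarrow> 'b::idom"
proof (rule poly_eqI)
  fix n assume "rhom h"
  then interpret rhom h .
  interpret m: rhom "map_poly h" by (rule rhom_map_poly)
  show "coeff (dy (mapc h f)) n = coeff (mapc h (dy f)) n"
    by (simp add: coeff_dy coeff_map_poly pderiv_map_poly[OF rhom_axioms])
qed

lemma Jac_mapc: "rhom h \<Longrightarrow> Jac (mapc h f) (mapc h g) = mapc h (Jac f g)" for h :: "'a::idom \<Rightarrow> 'b::idom"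
proof -
  assume h: "rhom h"
  interpret m: rhom "mapc h" by (rule rhom_mapc[OF h])
  show ?thesis by (simp add: Jac_def dy_mapc[OF h] dz_mapc[OF h] m.hom_diff m.hom_mult)
qed

lemma mapc_evp: "rhom h \<Longrightarrow> mapc h (evp u p) = evp (mapc h u) (map_poly h p)"
proof -
  assume h: "rhom h"
  interpret h: rhom h by (rule h)
  interpret m: rhom "mapc h" by (rule rhom_mapc[OF h])
  show ?thesis
    by (induction p) (simp_all add: evp_pCons h.map_poly_pCons_hom m.hom_add m.hom_mult mapc_simps[OF h])
qed

lemma mapc_sub: "rhom h \<Longrightarrow> mapc h (sub u v f) = sub (mapc h u) (mapc h v) (mapc h f)"
proof -
  assume h: "rhom h"
  interpret m: rhom "mapc h" by (rule rhom_mapc[OF h])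
  show ?thesis
    by (induction f rule: poly2_induct) (simp_all add: m.hom_add m.hom_mult mapc_simps[OF h])
qed

lemma toK_mapc: "toK = mapc fr"
  by (simp add: toK_def fun_eq_iff)

lemma rhom_toK: "rhom toK"
  unfolding toK_mapc by (rule rhom_mapc[OF rhom_fr])

lemma rhom_fr_poly: "rhom (fr :: 'k::field poly \<Rightarrow> 'k poly fract)"
  by (rule rhom_fr)

interpretation toK: rhom toK by (rule rhom_toK)

lemmas toK_simps [simp] = mapc_simps[OF rhom_fr_poly, folded toK_mapc]
lemmas toK_evp = mapc_evp[OF rhom_fr_poly, folded toK_mapc]
lemmas toK_sub = mapc_sub[OF rhom_fr_poly, folded toK_mapc]
lemmas Jac_toK = Jac_mapc[OF rhom_fr_poly, folded toK_mapc]
lemmas dy_toK = dy_mapc[OF rhom_fr_poly, folded toK_mapc]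
lemmas dz_toK = dz_mapc[OF rhom_fr_poly, folded toK_mapc]

lemma coeff_mapc: "rhom h \<Longrightarrow> coeff (coeff (mapc h f) j) i = h (coeff (coeff f j) i)"
  by (simp add: coeff_map_poly rhom.hom_zero)

lemma toK_eq_0_iff [simp]: "toK f = 0 \<longleftrightarrow> f = 0"
proof
  assume "toK f = 0"
  then have "fr (coeff (coeff f j) i) = 0" for i j
    using coeff_mapc[OF rhom_fr, of f j i] by (simp add: toK_mapc)
  then show "f = 0" by (intro poly_eqI) simp
qed simp

lemma toK_eq_iff [simp]: "toK f = toK g \<longleftrightarrow> f = g"
  using toK_eq_0_iff[of "f - g"] by (simp add: toK.hom_diff)

lemma clear_denominators:
  fixes f :: "'k::field poly fract poly poly"
  obtains r g where "r \<noteq> 0" "cst (fr r) * f = toK g"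
proof -
  have "\<exists>r g. r \<noteq> 0 \<and> cst (fr r) * f = toK g"
  proof (induction f rule: poly2_induct)
    case (cst c)
    obtain a b where ab: "c = Fract a b" "b \<noteq> 0" by (cases c)
    then have "fr b * c = fr a" by (simp add: eq_fract)
    then have "cst (fr b) * cst c = toK (cst a)" by (simp flip: cst.hom_mult)
    with ab show ?case by blast
  next
    case YY
    show ?case by (rule exI[of _ 1], rule exI[of _ YY]) (simp add: fr.hom_one cst.hom_one)
  next
    case ZZ
    show ?case by (rule exI[of _ 1], rule exI[of _ ZZ]) (simp add: fr.hom_one cst.hom_one)
  next
    case (add f g)
    then obtain r a s b where e: "r \<noteq> 0" "cst (fr r) * f = toK a" "s \<noteq> 0" "cst (fr s) * g = toK b" by blast
    have "cst (fr (r * s)) * (f + g) = cst (fr s) * (cst (fr r) * f) + cst (fr r) * (cst (fr s) * g)"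
      by (simp only: fr.hom_mult cst.hom_mult algebra_simps)
    also have "\<dots> = toK (cst s * a + cst r * b)" unfolding e by (simp add: toK.hom_add toK.hom_mult)
    finally show ?case using e by (metis mult_eq_0_iff)
  next
    case (mult f g)
    then obtain r a s b where e: "r \<noteq> 0" "cst (fr r) * f = toK a" "s \<noteq> 0" "cst (fr s) * g = toK b" by blast
    have "cst (fr (r * s)) * (f * g) = (cst (fr r) * f) * (cst (fr s) * g)"
      by (simp only: fr.hom_mult cst.hom_mult mult_ac)
    also have "\<dots> = toK (a * b)" unfolding e by (simp add: toK.hom_mult)
    finally show ?case using e by (metis mult_eq_0_iff)
  qed
  then show thesis using that by blast
qed

section \<open>The notions of the statement expressed over k[x]\<close>

lemma embK_cst: "embK = cst"
  by (simp add: embK_def cst_def fun_eq_iff)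

lemma eval2_sub: "eval2 f p q = sub p q f"
  by (simp add: eval2_def ev2_def embK_cst)

lemma constB_cst: "constB c = cst [:c:]"
  by (simp add: constB_def cst_def)

lemma varX_cst: "varX = cst [:0, 1:]"
  by (simp add: varX_def cst_def)

lemma cst_pCons: "cst (pCons c a) = constB c + varX * cst a"
proof -
  have "pCons c a = [:c:] + [:0, 1:] * a" by simp
  then show ?thesis unfolding constB_cst varX_cst by (metis cst.hom_add cst.hom_mult)
qed

lemma is_der_cst_iff: "is_der cst d \<longleftrightarrow> is_der constB d \<and> d varX = 0"
proof
  assume d: "is_der cst d"
  then show "is_der constB d \<and> d varX = 0"
    by (simp add: is_der_def constB_cst varX_cst)
next
  assume d: "is_der constB d \<and> d varX = 0"
  have "d (cst a) = 0" for a
  proof (induction a)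
    case 0
    show ?case using d is_der_zero[of constB d] by simp
  next
    case (pCons c a)
    then show ?case using d unfolding cst_pCons by (simp add: is_der_def)
  qed
  with d show "is_der cst d" by (simp add: is_der_def)
qed

lemma is_LND_cst_iff: "is_LND cst d \<longleftrightarrow> is_LND constB d \<and> d varX = 0"
  by (auto simp: is_LND_def is_der_cst_iff)

lemma cst_in_kalg: "cst a \<in> kalg constB {varX}"
proof (induction a)
  case 0
  show ?case using kalg.const[of constB 0 "{varX}"] by (simp only: constB_cst[of 0] pCons_0_0)
next
  case (pCons c a)
  then show ?case unfolding cst_pCons by (auto intro: kalg.intros)
qed

text \<open>Moving x from the generators to the constants makes coordinate systems that contain x
  into coordinate pairs over k[x].\<close>

lemma kalg_varX: "kalg constB (insert varX S) = kalg cst S"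
proof
  show "kalg constB (insert varX S) \<subseteq> kalg cst S"
  proof
    fix x assume "x \<in> kalg constB (insert varX S)"
    then show "x \<in> kalg cst S"
      by (rule kalg_least) (auto intro: kalg.intros simp: constB_cst varX_cst)
  qed
  have c: "cst a \<in> kalg constB (insert varX S)" for a
    using kalg_mono_gen[of "{varX}" constB "insert varX S"] cst_in_kalg[of a] by (auto intro: kalg.intros)
  show "kalg cst S \<subseteq> kalg constB (insert varX S)"
  proof
    fix x assume "x \<in> kalg cst S"
    then show "x \<in> kalg constB (insert varX S)"
      by (rule kalg_least) (auto intro: kalg.intros c)
  qed
qed

lemma kalg_varX_eq: "kalg constB {varX} = range cst"
proof
  show "kalg constB {varX} \<subseteq> range cst"
  proof
    fix x assume "x \<in> kalg constB {varX}"
    then show "x \<in> range cst"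
      by (rule kalg_least) (auto simp: constB_cst varX_cst simp flip: cst.hom_add cst.hom_mult)
  qed
qed (use cst_in_kalg in auto)

lemma coordsys_varX: "coordsys varX g1 g2 \<longleftrightarrow> gen g1 g2"
  by (simp add: coordsys_def kalg_varX)

lemma coordsys_varX': "coordsys g1 g2 varX \<longleftrightarrow> gen g1 g2"
  using kalg_varX[of "{g1, g2}"] by (simp add: coordsys_def insert_commute)

lemma gen_of_coordsys:
  assumes "coordsys y1 y2 (cst \<xi>)"
  shows "gen y1 y2"
proof -
  have "kalg constB {y1, y2, cst \<xi>} \<subseteq> kalg constB {varX, y1, y2}"
    using kalg_mono_gen[of "{varX}" constB "{varX, y1, y2}"] cst_in_kalg[of \<xi>]
    by (intro kalg_mono_gen) (auto intro: kalg.intros)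
  then show ?thesis using assms by (auto simp: coordsys_def kalg_varX)
qed

lemma gen_toK:
  assumes "gen u v"
  shows "gen (toK u) (toK v)"
proof -
  have "toK f \<in> kalg cst {toK u, toK v}" for f
  proof -
    obtain \<Phi> where "f = sub u v \<Phi>" using assms unfolding kalg2_eq by (metis UNIV_I imageE)
    then show ?thesis using sub_in_kalg by (simp add: toK_sub)
  qed
  from this[of YY] this[of ZZ] show ?thesis using gen_subset[OF gen_YY_ZZ] by simp
qed

section \<open>Composition with triangular automorphisms and the swap\<close>

lemma comp_aut_eq: "comp_aut \<beta> (u, v) = (sub u v (fst \<beta>), sub u v (snd \<beta>))"
  by (simp add: comp_aut_def eval2_sub)

lemma sub_pair: "sub u v [:p, [:c:]:] = evp u p + cst c * v"
proof -
  have "[:p, [:c:]:] = [:p:] + cst c * ZZ" by (simp add: cst_def ZZ_def)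
  then show ?thesis by (simp add: sub_const)
qed

lemma comp_T2: "comp_aut ([:[:b, a:]:], [:p, [:c:]:]) (u, v) = (cst b + cst a * u, evp u p + cst c * v)"
  by (simp add: comp_aut_eq sub_const sub_pair evp_pCons mult.commute)

lemma comp_swap: "comp_aut swap_aut (u, v) = (v, u)"
  by (simp add: comp_aut_eq swap_aut_def varY_def varZ_def YY_def[symmetric] ZZ_def[symmetric])

lemma T2E:
  assumes "t \<in> T2"
  obtains a b c p where "t = ([:[:b, a:]:], [:p, [:c:]:])" "a \<noteq> 0" "c \<noteq> 0"
  using assms by (auto simp: T2_def)

lemma T2I: "a \<noteq> 0 \<Longrightarrow> c \<noteq> 0 \<Longrightarrow> ([:[:b, a:]:], [:p, [:c:]:]) \<in> T2"
  by (auto simp: T2_def)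

lemma evp_affine: "evp (cst b + cst a * u) p = evp u (pcompose p [:b, a:])"
  by (induction p) (simp_all add: evp_pCons pcompose_pCons evp_add evp_mult evp_smult algebra_simps)

text \<open>Adjacent triangular factors merge, so they do not lengthen a swap chain.\<close>

lemma T2_comp:
  assumes "t \<in> T2" "s \<in> T2"
  obtains r where "r \<in> T2" "\<forall>u v. comp_aut t (comp_aut s (u, v)) = comp_aut r (u, v)"
proof -
  obtain a b c p where t: "t = ([:[:b, a:]:], [:p, [:c:]:])" "a \<noteq> 0" "c \<noteq> 0" using T2E[OF assms(1)] .
  obtain a' b' c' p' where s: "s = ([:[:b', a':]:], [:p', [:c':]:])" "a' \<noteq> 0" "c' \<noteq> 0" using T2E[OF assms(2)] .
  show thesis
  proof (rule that)
    show "([:[:b + a * b', a * a':]:], [:pcompose p [:b', a':] + smult c p', [:c * c':]:]) \<in> T2"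
      using t s by (intro T2I) auto
    show "\<forall>u v. comp_aut t (comp_aut s (u, v)) =
      comp_aut ([:[:b + a * b', a * a':]:], [:pcompose p [:b', a':] + smult c p', [:c * c':]:]) (u, v)"
      unfolding t(1) s(1) comp_T2 evp_affine
      by (simp add: evp_add evp_smult cst.hom_add cst.hom_mult algebra_simps)
  qed
qed

lemma comp_T2_id: "comp_aut ([:[:0, 1:]:], [:0, [:1:]:]) (u, v) = (u, v)"
  by (simp add: comp_T2 cst.hom_one)

lemma evp_inj:
  fixes u v :: "'f::field_char_0 poly poly"
  assumes "gen u v" "evp u p = evp u q"
  shows "p = q"
proof -
  obtain c where c: "Jac u v = cst c" "c \<noteq> 0" using gen_Jac_field[OF assms(1)] .
  have "sub u v [:p - q:] = 0" using assms(2) by (simp add: sub_const evp_diff)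
  then show ?thesis using sub_eq_0_imp[of u v "[:p - q:]"] c by simp
qed

text \<open>\<open>u\<close> is a polynomial q in \<open>F\<close>, and since the Jacobian of
  \<open>u\<close>, \<open>v\<close> is a nonzero constant, the derivative of q is a unit and q is
  affine. A suitable multiple of \<open>G\<close> then makes the rest of \<open>v\<close> a
  polynomial in \<open>F\<close>.\<close>

lemma triangular_of_same_kernel:
  fixes F G u v :: "'k::field_char_0 poly fract poly poly"
  assumes FG: "gen F G" and uv: "gen u v" and J: "Jac F u = 0"
  obtains t where "t \<in> T2" "comp_aut t (F, G) = (u, v)"
proof -
  obtain q where q: "u = evp F q" using Jac_eq_0_imp_evp[OF FG J] .
  obtain \<kappa> where \<kappa>: "Jac u v = cst \<kappa>" "\<kappa> \<noteq> 0" using gen_Jac_field[OF uv] .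
  obtain \<gamma> where \<gamma>: "Jac F G = cst \<gamma>" "\<gamma> \<noteq> 0" using gen_Jac_field[OF FG] .
  have e: "evp F (pderiv q) * Jac F v = cst \<kappa>" using \<kappa>(1) by (simp add: q Jac_evp_left)
  have "cst \<kappa> * cst (inverse \<kappa>) = 1" using \<kappa>(2) by (simp add: cst.hom_one flip: cst.hom_mult)
  then have "cst \<kappa> dvd 1" by (rule dvdI[OF sym])
  moreover have "evp F (pderiv q) dvd cst \<kappa>" by (rule dvdI[OF sym[OF e]])
  ultimately have "evp F (pderiv q) dvd 1" by (rule dvd_trans[rotated])
  then obtain a where "evp F (pderiv q) = cst a" "a dvd 1" by (elim unit_poly2)
  then have a: "pderiv q = [:a:]" "a \<noteq> 0" using evp_inj[OF FG, of "pderiv q" "[:a:]"] by auto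
  have "degree q = 1"
    using degree_pderiv[of q] a by (metis One_nat_def Suc_pred degree_pCons_0 gr0I pCons_eq_0_iff pderiv_eq_0_iff)
  then obtain b a' where qq: "q = [:b, a':]"
    by (metis degree1_coeffs)
  with a have "a' = a" by (simp add: pderiv_pCons)
  with qq have u: "u = cst b + cst a * F" by (simp add: q evp_pCons mult.commute)
  \<comment> \<open>Solved from a c \<gamma> = \<kappa>, so that \<open>v\<close> and
    \<open>c G\<close> have the same Jacobian with \<open>F\<close>.\<close>
  define c where "c = \<kappa> / (a * \<gamma>)"
  have "cst a * Jac F v = cst \<kappa>" using e a by simp
  moreover have "cst a * (cst c * Jac F G) = cst \<kappa>" using a \<gamma> unfolding \<gamma>(1) c_def
    by (simp flip: cst.hom_mult)
  ultimately have "cst a * Jac F (v - cst c * G) = 0" by (simp add: Jac_diff_right Jac_cst_mult right_diff_distrib)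
  then have "Jac F (v - cst c * G) = 0" using a by simp
  then obtain p where "v - cst c * G = evp F p" using Jac_eq_0_imp_evp[OF FG] by blast
  then have v: "v = evp F p + cst c * G" by (simp add: algebra_simps)
  show thesis
  proof (rule that)
    show "([:[:b, a:]:], [:p, [:c:]:]) \<in> T2" using a \<kappa> \<gamma> by (intro T2I) (auto simp: c_def)
    show "comp_aut ([:[:b, a:]:], [:p, [:c:]:]) (F, G) = (u, v)" unfolding comp_T2 u v by simp
  qed
qed

lemma cst_power_evp: "cst c * u ^ n = evp u (monom c n)"
  by (induction n) (simp_all add: monom_0 monom_Suc evp_pCons mult_ac flip: One_nat_def)

text \<open>The tame word is undone from the pair back to (\<open>YY\<close>, \<open>ZZ\<close>). A
  swap demotes the old first factor to the list and puts the identity in front; a shear is absorbed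
  by the first factor.\<close>

lemma tame_swapchain:
  fixes u v :: "'k::field poly fract poly poly"
  assumes "tame u v"
  shows "\<exists>t0 ts. t0 \<in> T2 \<and> set ts \<subseteq> T2 \<and> swapchain ts (comp_aut t0 (u, v)) = (YY, ZZ)"
  using assms
proof (induction rule: tame.induct)
  case tame_id
  show ?case
    by (rule exI[of _ "([:[:0, 1:]:], [:0, [:1:]:])"], rule exI[of _ "[]"]) (simp add: T2I comp_T2_id)
next
  case (tame_swap u v)
  then obtain t0 ts where t: "t0 \<in> T2" "set ts \<subseteq> T2" "swapchain ts (comp_aut t0 (u, v)) = (YY, ZZ)" by blast
  show ?case
    by (rule exI[of _ "([:[:0, 1:]:], [:0, [:1:]:])"], rule exI[of _ "t0 # ts"])
      (use t in \<open>simp add: T2I comp_T2_id comp_swap\<close>)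
next
  case (tame_shear u v c n)
  then obtain t0 ts where t: "t0 \<in> T2" "set ts \<subseteq> T2" "swapchain ts (comp_aut t0 (u, v)) = (YY, ZZ)" by blast
  define s :: "'k aut" where "s = ([:[:0, 1:]:], [:monom c n, [:1:]:])"
  have s: "s \<in> T2" unfolding s_def by (rule T2I) simp_all
  obtain r where r: "r \<in> T2" "\<forall>u v. comp_aut t0 (comp_aut s (u, v)) = comp_aut r (u, v)"
    using T2_comp[OF t(1) s] .
  have "comp_aut s (u, v - cst c * u ^ n) = (u, v)"
    unfolding s_def comp_T2 by (simp add: cst.hom_one cst_power_evp)
  with t(3) have "swapchain ts (comp_aut r (u, v - cst c * u ^ n)) = (YY, ZZ)" using r(2) by metis
  with r t show ?case by blast
qed

lemma is_LND_cst_Jac: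
  fixes u v :: "'f::field_char_0 poly poly"
  assumes "gen u v"
  shows "is_LND cst (\<lambda>f. cst c * Jac u f)"
proof (rule is_LND_generators)
  show d: "is_der cst (\<lambda>f. cst c * Jac u f)"
    using is_der_Jac[of u] by (simp add: is_der_def algebra_simps)
  show "gen u v" by fact
  obtain \<kappa> where \<kappa>: "Jac u v = cst \<kappa>" using gen_Jac_field[OF assms] .
  fix s assume "s \<in> {u, v}"
  moreover have "((\<lambda>f. cst c * Jac u f) ^^ 1) u = 0" by simp
  moreover have "((\<lambda>f. cst c * Jac u f) ^^ 2) v = 0" by (simp add: numeral_2_eq_2 \<kappa> flip: cst.hom_mult)
  ultimately show "\<exists>n. ((\<lambda>f. cst c * Jac u f) ^^ n) s = 0" by blast
qed

text \<open>Rentschler's theorem for \<open>Jac F\<close> supplies a tame pair with the same kernel;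
  a triangular automorphism leads from (F, G) to it.\<close>

theorem swapchain_exists:
  fixes F G :: "'k::field_char_0 poly fract poly poly"
  assumes FG: "gen F G"
  obtains t0 ts where "t0 \<in> T2" "set ts \<subseteq> T2" "swapchain ts (comp_aut t0 (F, G)) = (YY, ZZ)"
proof -
  interpret d: lnd "\<lambda>f. cst 1 * Jac F f" by (rule lnd.intro[OF is_LND_cst_Jac[OF FG]])
  obtain \<kappa> where \<kappa>: "Jac F G = cst \<kappa>" "\<kappa> \<noteq> 0" using gen_Jac_field[OF FG] .
  have "F \<notin> range cst" using \<kappa> by auto
  moreover have "cst 1 * Jac F F = 0" by simp
  ultimately obtain u v where uv: "tame u v" "cst 1 * Jac F u = 0" using d.Rentschler by blast
  then obtain t where t: "t \<in> T2" "comp_aut t (F, G) = (u, v)"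
    using triangular_of_same_kernel[OF FG tame_gen[OF uv(1)]] by auto
  obtain t0 ts where ts: "t0 \<in> T2" "set ts \<subseteq> T2" "swapchain ts (comp_aut t0 (u, v)) = (YY, ZZ)"
    using tame_swapchain[OF uv(1)] by blast
  obtain r where r: "r \<in> T2" "\<forall>u v. comp_aut t0 (comp_aut t (u, v)) = comp_aut r (u, v)"
    using T2_comp[OF ts(1) t(1)] .
  show thesis
    by (rule that[OF r(1) ts(2)]) (use r(2) t(2) ts(3) in metis)
qed

section \<open>Chains of derivations\<close>

text \<open>The partial derivative by x: in the coefficients k[x][y], the inner variable, which
  \<open>dy\<close> differentiates, is x.\<close>

definition dX :: "'k::field B3 \<Rightarrow> 'k B3" where "dX = map_poly dy"

lemma is_der_dX: "is_der constB (dX :: 'k::field B3 \<Rightarrow> 'k B3)"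
  and dX_simps [simp]: "dX varX = (1 :: 'k B3)" "dX YY = (0 :: 'k B3)" "dX ZZ = (0 :: 'k B3)"
proof -
  have z: "dy 0 = (0 :: 'k poly poly)" by (simp add: dy_def)
  have "dX (f + g) = dX f + dX g" for f g :: "'k B3"
    unfolding dX_def by (rule poly_eqI) (simp add: coeff_map_poly z dy_add)
  moreover have "dX (f * g) = f * dX g + g * dX f" for f g :: "'k B3"
    unfolding dX_def by (rule map_poly_derivation) (simp_all add: dy_add dy_mult)
  moreover have p: "dX [:p:] = [:dy p:]" for p :: "'k poly poly"
    by (simp add: dX_def map_poly_pCons z)
  moreover have "dX ZZ = (0 :: 'k B3)"
    by (rule poly_eqI) (simp add: dX_def ZZ_def coeff_map_poly z dy_def coeff_pCons map_poly_1 split: nat.splits)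
  ultimately show "is_der constB (dX :: 'k B3 \<Rightarrow> 'k B3)" "dX ZZ = (0 :: 'k B3)"
    by (simp_all add: is_der_def constB_def dy_def map_poly_pCons pderiv_pCons)
  show "dX varX = (1 :: 'k B3)"
    unfolding varX_def p by (simp add: dy_def map_poly_pCons pderiv_pCons one_pCons)
  show "dX YY = (0 :: 'k B3)"
    unfolding YY_def p by (simp add: dy_def map_poly_pCons pderiv_pCons one_pCons)
qed

lemma is_der_constB: "is_der cst d \<Longrightarrow> is_der constB d"
  by (simp add: is_der_cst_iff)

lemma der_eq_partials:
  assumes K: "kalg constB {y1, y2, y3} = UNIV"
    and d1: "is_partial d1 y1 y2 y3" and d2: "is_partial d2 y2 y1 y3"
    and \<delta>: "is_der constB \<delta>" "\<delta> y3 = 0"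
  shows "\<delta> f = d1 f * \<delta> y1 + d2 f * \<delta> y2"
proof -
  have "f \<in> {f. \<delta> f = d1 f * \<delta> y1 + d2 f * \<delta> y2}"
    by (rule kalg_least[of f constB "{y1, y2, y3}"])
      (use assms in \<open>auto simp: is_partial_def is_der_def algebra_simps\<close>)
  then show ?thesis by simp
qed

text \<open>\<open>k[x,y,z]\<close> is not generated by two elements: the \<open>3 \<times> 3\<close> identity matrix would factor
  through rank two.\<close>
lemma partials_nonconst:
  assumes K: "kalg constB {y1, y2, y3} = UNIV"
    and d1: "is_partial d1 y1 y2 y3" and d2: "is_partial d2 y2 y1 y3"
  shows "y3 \<noteq> constB c"
proof
  assume y3: "y3 = constB c"
  have e: "\<delta> f = d1 f * \<delta> y1 + d2 f * \<delta> y2" if "is_der constB \<delta>" for \<delta> f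
    by (rule der_eq_partials[OF assms that]) (use that y3 in \<open>simp add: is_der_def\<close>)
  have dd: "is_der constB (dy :: 'a B3 \<Rightarrow> _)" "is_der constB (dz :: 'a B3 \<Rightarrow> _)"
    by (simp_all add: is_der_def constB_cst dy_add dz_add dy_mult dz_mult)
  have v: "dy varX = (0 :: 'a B3)" "dz varX = (0 :: 'a B3)" by (simp_all add: varX_cst)
  have det: "(p1*a1+q1*b1) * ((p2*a2+q2*b2) * (p3*a3+q3*b3) - (p2*a3+q2*b3) * (p3*a2+q3*b2))
    - (p2*a1+q2*b1) * ((p1*a2+q1*b2) * (p3*a3+q3*b3) - (p1*a3+q1*b3) * (p3*a2+q3*b2))
    + (p3*a1+q3*b1) * ((p1*a2+q1*b2) * (p2*a3+q2*b3) - (p1*a3+q1*b3) * (p2*a2+q2*b2)) = 0"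
    for p1 p2 p3 q1 q2 q3 a1 a2 a3 b1 b2 b3 :: "'a B3"
    by (simp add: algebra_simps)
  from det[of "d1 varX" "dX y1" "d2 varX" "dX y2" "d1 YY" "dy y1" "d2 YY" "dy y2" "d1 ZZ" "dz y1" "d2 ZZ" "dz y2"]
  show False
    by (simp add: e[OF is_der_dX, symmetric] e[OF dd(1), symmetric] e[OF dd(2), symmetric] v)
qed

section \<open>Derivations proportional over K to a Jacobian derivation\<close>

definition propJ :: "('k::field_char_0 B3 \<Rightarrow> 'k B3) \<Rightarrow> 'k KYZ \<Rightarrow> bool" where
  "propJ E F \<longleftrightarrow> (\<exists>c. c \<noteq> 0 \<and> (\<forall>f. toK (E f) = cst c * Jac F (toK f)))"

lemma propJ_der:
  assumes "propJ E F"
  shows "is_der cst E"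
proof -
  obtain c where c: "toK (E f) = cst c * Jac F (toK f)" for f
    using assms by (auto simp: propJ_def)
  show ?thesis unfolding is_der_def
  proof (intro conjI allI)
    show "E (cst a) = 0" for a using c[of "cst a"] by simp
    have "toK (E (f + g)) = toK (E f + E g)" for f g
      by (simp add: c toK.hom_add Jac_add_right distrib_left)
    then show "E (f + g) = E f + E g" for f g by simp
    have "toK (E (f * g)) = toK (f * E g + g * E f)" for f g
      by (simp add: c toK.hom_add toK.hom_mult Jac_mult_right algebra_simps)
    then show "E (f * g) = f * E g + g * E f" for f g by simp
  qed
qed

lemma propJ_LND:
  assumes "propJ E F" "gen F G"
  shows "is_LND cst E"
proof -
  obtain c where c: "toK (E f) = cst c * Jac F (toK f)" for f
    using assms by (auto simp: propJ_def)
  have p: "toK ((E ^^ n) f) = ((\<lambda>f. cst c * Jac F f) ^^ n) (toK f)" for n f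
    by (induction n) (simp_all add: c)
  have "\<exists>n. (E ^^ n) f = 0" for f
  proof -
    obtain n where "((\<lambda>f. cst c * Jac F f) ^^ n) (toK f) = 0"
      using is_LND_cst_Jac[OF assms(2), of c] unfolding is_LND_def by blast
    then have "(E ^^ n) f = 0" by (simp flip: p)
    then show ?thesis ..
  qed
  with propJ_der[OF assms(1)] show ?thesis by (simp add: is_LND_def)
qed

lemma irreducible_der_iff: "irreducible_der d \<longleftrightarrow> (\<forall>g. (\<forall>f. g dvd d f) \<longrightarrow> g dvd 1)"
proof -
  have u: "{g * h |h. True} = UNIV \<longleftrightarrow> g dvd 1" for g :: 'a
  proof
    assume "g dvd 1"
    then obtain h where h: "1 = g * h" by auto
    have "x = g * (h * x)" for x using h by (metis mult.assoc mult_1)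
    then show "{g * h |h. True} = UNIV" by blast
  next
    assume "{g * h |h. True} = UNIV"
    then have "1 \<in> {g * h |h. True}" by simp
    then obtain h where "1 = g * h" by auto
    then show "g dvd 1" by (rule dvdI)
  qed
  have "range d \<subseteq> {g * h |h. True} \<longleftrightarrow> (\<forall>f. g dvd d f)" for g
    by (auto simp: dvd_def)
  with u show ?thesis by (auto simp: irreducible_der_def)
qed

lemma dvd_cst_imp:
  fixes f :: "'c::idom poly poly"
  assumes "f dvd cst c" "c \<noteq> 0"
  obtains a where "f = cst a" "a dvd c"
proof -
  obtain g where g: "cst c = f * g" using assms(1) by auto
  then have nz: "f \<noteq> 0" "g \<noteq> 0" using assms(2) by auto
  have "degree f + degree g = 0" using degree_mult_eq[OF nz] g by (simp add: cst_def flip: g)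
  then obtain p q where pq: "f = [:p:]" "g = [:q:]" by (metis add_is_0 degree_eq_zeroE)
  with g have e: "[:c:] = p * q" by (simp add: cst_def mult.commute)
  then have nz: "p \<noteq> 0" "q \<noteq> 0" using assms(2) by auto
  have "degree p + degree q = 0" using degree_mult_eq[OF nz] by (simp flip: e)
  then obtain a b where ab: "p = [:a:]" "q = [:b:]" by (metis add_is_0 degree_eq_zeroE)
  with e have "c = a * b" by (simp add: mult.commute)
  then show thesis using that[of a] pq ab by (simp add: cst_def)
qed

lemma coeff2_cst: "coeff (coeff (cst c) j) i = (if i = 0 \<and> j = 0 then c else 0)"
  by (simp add: cst_def coeff_pCons split: nat.splits)

lemma toK_eq_cst:
  assumes "toK w = cst c"
  obtains a where "w = cst a" "c = fr a"
proof -
  have j: "w = cst (coeff (coeff w 0) 0)"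
  proof (rule poly_eqI, rule poly_eqI)
    fix j i
    have "fr (coeff (coeff w j) i) = coeff (coeff (cst c) j) i"
      using assms coeff_mapc[OF rhom_fr, of w j i] by (simp add: toK_mapc)
    then show "coeff (coeff w j) i = coeff (coeff (cst (coeff (coeff w 0) 0)) j) i"
      by (simp add: coeff2_cst split: if_splits)
  qed
  from arg_cong[OF j, of toK] have "cst c = cst (fr (coeff (coeff w 0) 0))"
    unfolding assms toK_simps .
  then have "c = fr (coeff (coeff w 0) 0)" unfolding cst_eq_iff .
  show thesis by (rule that[OF j]) fact
qed

lemma divide_nonzero: "a \<noteq> 0 \<Longrightarrow> b \<noteq> 0 \<Longrightarrow> a / b \<noteq> 0" for a b :: "'a::field"
  by simp

lemma mult_divide_same: "b \<noteq> 0 \<Longrightarrow> b * (a / b) = a" for a b :: "'a::field"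
  by simp

text \<open>Denominators of \<open>Jac F\<close> are cleared, then a common factor from k[x] of the
  largest degree is divided out. This suffices for irreducibility, because any common divisor of the
  values already lies in k[x].\<close>

lemma irreducible_derivation_exists:
  assumes FG: "gen F G"
  obtains E where "is_LND cst E" "irreducible_der E" "propJ E F"
proof -
  obtain \<kappa> where \<kappa>: "Jac F G = cst \<kappa>" "\<kappa> \<noteq> 0" using gen_Jac_field[OF FG] .
  obtain r1 a1 where 1: "r1 \<noteq> 0" "cst (fr r1) * Jac F YY = toK a1" using clear_denominators .
  obtain r2 a2 where 2: "r2 \<noteq> 0" "cst (fr r2) * Jac F ZZ = toK a2" using clear_denominators .
  define A0 B0 where "A0 = cst r2 * a1" and "B0 = cst r1 * a2"
  have JK: "Jac F g = dy g * Jac F YY + dz g * Jac F ZZ" for g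
    by (rule is_der_eq[OF is_der_Jac])
  have A0B0: "toK A0 = cst (fr (r1 * r2)) * Jac F YY" "toK B0 = cst (fr (r1 * r2)) * Jac F ZZ"
    unfolding A0_def B0_def toK.hom_mult toK_simps 1(2)[symmetric] 2(2)[symmetric] fr.hom_mult cst.hom_mult
    by (simp_all only: mult_ac)
  define S where "S g \<longleftrightarrow> g \<noteq> 0 \<and> (\<exists>A B. A0 = cst g * A \<and> B0 = cst g * B)" for g
  have S1: "S 1" by (simp add: S_def cst.hom_one)
  have ne: "A0 \<noteq> 0 \<or> B0 \<noteq> 0"
  proof (rule ccontr)
    assume "\<not> ?thesis"
    then have "Jac F YY = 0" "Jac F ZZ = 0" using A0B0 1 2 by auto
    then have "Jac F G = 0" using JK[of G] by simp
    with \<kappa> show False by simp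
  qed
  have "\<exists>n. \<forall>g. S g \<longrightarrow> degree g < n"
  proof -
    obtain C where C: "C \<noteq> 0" "C = A0 \<or> C = B0" using ne by blast
    then obtain i j where ij: "coeff (coeff C j) i \<noteq> 0" by (metis coeff_0 poly_eqI)
    have "degree g \<le> degree (coeff (coeff C j) i)" if "S g" for g
    proof -
      have "cst g dvd A0" "cst g dvd B0" using that by (auto simp: S_def)
      then have "cst g dvd C" using C(2) by blast
      then obtain C' where "C = cst g * C'" by blast
      then have "g dvd coeff (coeff C j) i" by (simp add: coeff2_cst_mult)
      then show ?thesis using ij by (rule dvd_imp_degree_le)
    qed
    then show ?thesis by (meson le_imp_less_Suc)
  qed
  then obtain n where "\<forall>g. S g \<longrightarrow> degree g < n" by blast
  from ex_has_greatest_nat[OF S1 this] obtain g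
    where g: "S g" "\<And>g'. S g' \<Longrightarrow> degree g' \<le> degree g" by blast
  then obtain A B where AB: "g \<noteq> 0" "A0 = cst g * A" "B0 = cst g * B" by (auto simp: S_def)
  define E where "E f = dy f * A + dz f * B" for f
  define c where "c = fr (r1 * r2) / fr g"
  have c: "c \<noteq> 0" unfolding c_def using 1 2 AB by (intro divide_nonzero) simp_all
  have A: "toK A = cst c * Jac F YY" and B: "toK B = cst c * Jac F ZZ"
  proof -
    have gc: "fr g * c = fr (r1 * r2)" unfolding c_def using AB by (intro mult_divide_same) simp
    have "cst (fr g) * toK A = cst (fr g) * (cst c * Jac F YY)" "cst (fr g) * toK B = cst (fr g) * (cst c * Jac F ZZ)"
      unfolding mult.assoc[symmetric] cst.hom_mult[symmetric] gc
      using A0B0 unfolding AB toK.hom_mult toK_simps by simp_all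
    then show "toK A = cst c * Jac F YY" "toK B = cst c * Jac F ZZ" using AB by simp_all
  qed
  have EJ: "toK (E f) = cst c * Jac F (toK f)" for f
    unfolding E_def JK[of "toK f"] by (simp add: toK.hom_add toK.hom_mult A B dy_toK dz_toK algebra_simps)
  then have P: "propJ E F" using c by (auto simp: propJ_def)
  have "irreducible_der E" unfolding irreducible_der_iff
  proof (intro allI impI)
    fix g0 assume g0: "\<forall>f. g0 dvd E f"
    have "g0 dvd A" "g0 dvd B" using g0[rule_format, of YY] g0[rule_format, of ZZ] by (simp_all add: E_def)
    then obtain A1 B1 where A1: "A = g0 * A1" "B = g0 * B1" unfolding dvd_def by blast
    \<comment> \<open>A multiple of \<open>G\<close> without denominators has a nonzero value in
      k[x]; as \<open>g0\<close> divides this value, \<open>g0\<close> is in k[x] and maximality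
      applies.\<close>
    obtain s v where s: "s \<noteq> 0" "cst (fr s) * G = toK v" using clear_denominators .
    have "toK (E v) = cst (c * fr s * \<kappa>)"
      unfolding EJ s(2)[symmetric] by (simp add: Jac_cst_mult \<kappa> cst.hom_mult)
    then obtain a where a: "E v = cst a" "c * fr s * \<kappa> = fr a" by (elim toK_eq_cst)
    have "a \<noteq> 0" using a(2) c s \<kappa> by auto
    moreover have "g0 dvd cst a" using g0 a(1) by metis
    ultimately obtain g1 where g1: "g0 = cst g1" "g1 dvd a" by (elim dvd_cst_imp)
    have "S (g * g1)" unfolding S_def using AB A1 g1 \<open>a \<noteq> 0\<close>
      by (auto simp: cst.hom_mult mult.assoc)
    then have "degree (g * g1) \<le> degree g" by (rule g(2))
    moreover have "g1 \<noteq> 0" using g1 \<open>a \<noteq> 0\<close> by auto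
    ultimately have "degree g1 = 0" using AB by (simp add: degree_mult_eq)
    then obtain e where "g1 = [:e:]" "e \<noteq> 0" using \<open>g1 \<noteq> 0\<close> by (metis degree_eq_zeroE pCons_0_0)
    then have "g1 dvd 1" by (simp add: is_unit_poly_iff dvd_field_iff)
    then show "g0 dvd 1" unfolding g1 by (metis cst.hom_mult cst.hom_one dvdE dvdI)
  qed
  then show thesis using that propJ_LND[OF P FG] P by blast
qed

lemma cst_inverse: "a \<noteq> 0 \<Longrightarrow> cst (inverse a) * cst a = 1" for a :: "'a::field"
  by (simp add: cst.hom_one flip: cst.hom_mult)

lemma propJ_partial:
  assumes uv: "gen u v" and d: "is_der cst d" "d u = 1" "d v = 0"
  shows "propJ d (toK v)"
proof -
  obtain c where c: "Jac v u = cst c" "c dvd 1" using gen_Jac[OF gen_swap[OF uv]] .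
  then have c0: "c \<noteq> 0" by auto
  have "toK (d f) = cst (inverse (fr c)) * Jac (toK v) (toK f)" for f
  proof -
    obtain \<Phi> where \<Phi>: "f = sub u v \<Phi>" using uv unfolding kalg2_eq by (metis UNIV_I imageE)
    have "Jac v f = d f * cst c"
      unfolding \<Phi> der_sub[OF is_der_Jac, of v u v] der_sub[OF d(1), of u v] by (simp add: d c)
    then have "Jac (toK v) (toK f) = toK (d f) * cst (fr c)" by (simp add: Jac_toK toK.hom_mult)
    moreover have "cst (inverse (fr c)) * (toK (d f) * cst (fr c)) = toK (d f) * (cst (inverse (fr c)) * cst (fr c))"
      by (simp only: mult_ac)
    moreover have "cst (inverse (fr c)) * cst (fr c) = 1"
      by (rule cst_inverse) (simp add: c0)
    ultimately show ?thesis by simp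
  qed
  moreover have "inverse (fr c) \<noteq> 0" by (rule nonzero_imp_inverse_nonzero) (simp add: c0)
  ultimately show ?thesis unfolding propJ_def by blast
qed

lemma antiderivative:
  fixes s :: "'f::field_char_0 poly"
  obtains p where "pderiv p = s"
proof -
  have "pderiv (\<Sum>i\<in>A. monom (coeff s i / of_nat (Suc i)) (Suc i)) = (\<Sum>i\<in>A. monom (coeff s i) i)" for A
    by (induction A rule: infinite_finite_induct) (simp_all add: pderiv_add pderiv_monom del: of_nat_Suc)
  then show thesis using that[of "\<Sum>i\<le>degree s. monom (coeff s i / of_nat (Suc i)) (Suc i)"]
    by (simp add: poly_as_sum_of_monoms)
qed

lemma gen_shear:
  assumes "gen F G"
  shows "gen (G - evp F p) F"
proof (rule gen_subset[OF assms])
  let ?S = "kalg cst {G - evp F p, F}"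
  show F: "F \<in> ?S" by (rule kalg.gen) simp
  have "evp F p \<in> ?S" using evp_in_kalg[of F p] kalg_mono_gen[of "{F}" cst "{G - evp F p, F}"] F by auto
  moreover have "G - evp F p \<in> ?S" by (rule kalg.gen) simp
  ultimately have "(G - evp F p) + evp F p \<in> ?S" by (intro kalg.add)
  then show "G \<in> ?S" by simp
qed

text \<open>The induction on the prefix length \<open>n\<close> tracks the last two derivations, as
  a relation involves both predecessors. The new pair is (G - p(F), F): the swap followed by the
  shear with p leads back to (F, G).\<close>

theorem chain_to_swapchain:
  fixes d :: "'k::field_char_0 B3 \<Rightarrow> 'k B3"
  assumes chain: "MC_chain y1 y2 y3 ds d" and co: "coordsys y1 y2 y3" and y3: "y3 = cst \<xi>"
    and n: "2 \<le> n" "n \<le> length ds"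
  shows "\<exists>F G ts. set ts \<subseteq> T2 \<and> length ts = n - 2 \<and> swapchain ts (F, G) = (toK y1, toK y2) \<and>
    gen F G \<and> propJ (ds ! (n - 1)) F \<and> propJ (ds ! (n - 2)) G"
proof -
  have len: "length ds \<ge> 2" and elt: "\<And>e. e \<in> set ds \<Longrightarrow> is_LND constB e \<and> irreducible_der e \<and> e y3 = 0"
    and p1: "is_partial (ds ! 0) y1 y2 y3" and p2: "is_partial (ds ! 1) y2 y1 y3"
    and step: "\<And>i. 2 \<le> i \<Longrightarrow> i < length ds \<Longrightarrow> (\<exists>\<sigma> f h. (ds ! (i - 1)) \<sigma> = 0 \<and>
           f \<in> kalg constB {y3} \<and> f \<noteq> 0 \<and> h \<in> kalg constB {y3} \<and> h \<noteq> 0 \<and>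
           (\<forall>g. h * (ds ! i) g = \<sigma> * (ds ! (i - 1)) g + f * (ds ! (i - 2)) g))"
    using chain by (auto simp: MC_chain_def)
  have K: "kalg constB {y1, y2, y3} = UNIV" using co by (simp add: coordsys_def)
  \<comment> \<open>A derivation sends \<open>cst \<xi>\<close> to the derivative of \<xi> times its
    value at x; as the former is killed, every chain member kills x and is a derivation over
    k[x].\<close>
  have "pderiv \<xi> \<noteq> 0"
  proof
    assume "pderiv \<xi> = 0"
    then obtain c where "\<xi> = [:c:]" by (metis degree_eq_zeroE pderiv_eq_0_iff)
    then have "y3 = constB c" by (simp add: y3 constB_cst)
    with partials_nonconst[OF K p1 p2] show False by blast
  qed
  have der: "is_der cst e" if "e \<in> set ds" for e
  proof -
    have d: "is_der constB e" "e y3 = 0" using elt[OF that] by (auto simp: is_LND_def)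
    have "e (cst a) = cst (pderiv a) * e varX" for a
    proof (induction a)
      case 0
      show ?case using is_der_zero[OF d(1)] by simp
    next
      case (pCons c a)
      then show ?case unfolding cst_pCons pderiv_pCons using d(1)
        by (simp add: is_der_def cst.hom_add cst_pCons algebra_simps)
          (simp add: constB_cst)
    qed
    with d(2) y3 \<open>pderiv \<xi> \<noteq> 0\<close> have "e varX = 0" by simp
    with d show ?thesis by (simp add: is_der_cst_iff)
  qed
  have y3k: "kalg constB {y3} \<subseteq> range cst"
    unfolding kalg_varX_eq[symmetric] by (rule kalg_mono_gen) (simp add: y3 cst_in_kalg)
  have g12: "gen y1 y2" using gen_of_coordsys co unfolding y3 .
  show ?thesis
    using n
  proof (induction n rule: dec_induct)
    case base
    have "propJ (ds ! 0) (toK y2)"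
      using p1 len by (intro propJ_partial[OF g12]) (auto simp: is_partial_def intro!: der nth_mem)
    moreover have "propJ (ds ! 1) (toK y1)"
      using p2 len by (intro propJ_partial[OF gen_swap[OF g12]]) (auto simp: is_partial_def intro!: der nth_mem)
    ultimately show ?case
      by (intro exI[of _ "toK y1"] exI[of _ "toK y2"] exI[of _ "[]"]) (simp add: gen_toK[OF g12])
  next
    case (step n)
    then obtain F G ts where IH: "set ts \<subseteq> T2" "length ts = n - 2" "swapchain ts (F, G) = (toK y1, toK y2)"
      "gen F G" "propJ (ds ! (n - 1)) F" "propJ (ds ! (n - 2)) G" by auto
    obtain \<sigma> f h where \<sigma>: "(ds ! (n - 1)) \<sigma> = 0" "f \<in> kalg constB {y3}" "f \<noteq> 0" "h \<in> kalg constB {y3}" "h \<noteq> 0"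
      "\<And>g. h * (ds ! n) g = \<sigma> * (ds ! (n - 1)) g + f * (ds ! (n - 2)) g"
      using assms(1) step.hyps step.prems by (auto simp: MC_chain_def)
    obtain f0 h0 where fh: "f = cst f0" "h = cst h0" "f0 \<noteq> 0" "h0 \<noteq> 0" using \<sigma>(2-5) y3k
      by (metis cst.hom_zero imageE subsetD)
    obtain c1 where c1: "c1 \<noteq> 0" "\<And>f. toK ((ds ! (n - 1)) f) = cst c1 * Jac F (toK f)"
      using IH(5) by (auto simp: propJ_def)
    obtain c0 where c0: "c0 \<noteq> 0" "\<And>f. toK ((ds ! (n - 2)) f) = cst c0 * Jac G (toK f)"
      using IH(6) by (auto simp: propJ_def)
    have "Jac F (toK \<sigma>) = 0" using c1(2)[of \<sigma>] c1(1) \<sigma>(1) by simp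
    then obtain s where s: "toK \<sigma> = evp F s" using Jac_eq_0_imp_evp[OF IH(4)] by blast
    \<comment> \<open>\<open>Jac F'\<close> is \<open>Jac G\<close> minus p'(F) times
      \<open>Jac F\<close>; matching it with f c0 \<open>Jac G\<close> + s(F) c1
      \<open>Jac F\<close> forces this derivative of p.\<close>
    obtain p where p: "pderiv p = smult (- c1 / (fr f0 * c0)) s" using antiderivative .
    define F' where "F' = G - evp F p"
    have JF': "Jac F' g = Jac G g + cst (c1 / (fr f0 * c0)) * evp F s * Jac F g" for g
      by (simp add: F'_def Jac_diff_left Jac_evp_left p evp_smult evp_uminus cst.hom_uminus)
    have new: "toK ((ds ! n) g) = cst (fr f0 * c0 / fr h0) * Jac F' (toK g)" for g
    proof -
      have "cst (fr h0) * toK ((ds ! n) g) = toK (h * (ds ! n) g)" by (simp add: fh toK.hom_mult)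
      also have "\<dots> = evp F s * (cst c1 * Jac F (toK g)) + cst (fr f0) * (cst c0 * Jac G (toK g))"
        unfolding \<sigma>(6) by (simp add: toK.hom_add toK.hom_mult c1(2) c0(2) s fh(1) del: One_nat_def)
      also have "\<dots> = cst (fr f0 * c0) * Jac F' (toK g)"
        unfolding JF' distrib_left using fh c0(1)
        by (simp add: mult.assoc[symmetric] cst.hom_mult[symmetric])
      also have "\<dots> = cst (fr h0) * (cst (fr f0 * c0 / fr h0) * Jac F' (toK g))"
        using fh mult_divide_same[of "fr h0" "fr f0 * c0"]
        unfolding mult.assoc[symmetric] cst.hom_mult[symmetric] by (simp del: mult_fract)
      finally show ?thesis using fh by simp
    qed
    define t :: "'k aut" where "t = ([:[:0, 1:]:], [:p, [:1:]:])"
    have t: "t \<in> T2" unfolding t_def by (rule T2I) simp_all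
    have "comp_aut t (comp_aut swap_aut (F', F)) = (F, G)"
      unfolding comp_swap t_def comp_T2 by (simp add: cst.hom_one F'_def)
    then have "swapchain (t # ts) (F', F) = (toK y1, toK y2)" using IH by simp
    moreover have "gen F' F" unfolding F'_def by (rule gen_shear[OF IH(4)])
    moreover have "propJ (ds ! n) F'"
      unfolding propJ_def using new fh c0(1) by (intro exI[of _ "fr f0 * c0 / fr h0"]) auto
    moreover have "length (t # ts) = Suc n - 2" using IH(2) step.hyps by simp
    ultimately show ?case using IH(1,5) t step.hyps
      by (intro exI[of _ F'] exI[of _ F] exI[of _ "t # ts"]) simp
  qed
qed

lemma irreducible_der_one: "1 \<in> range d \<Longrightarrow> irreducible_der d"
  unfolding irreducible_der_iff by (metis rangeE)

lemma gen_scale: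
  fixes c :: "'c::comm_ring_1"
  assumes "gen u v" "c' * c = 1"
  shows "gen u (cst c * v)"
proof (rule gen_subset[OF assms(1)])
  let ?S = "kalg cst {u, cst c * v}"
  show "u \<in> ?S" by (rule kalg.gen) simp
  have "cst c' * (cst c * v) \<in> ?S" by (intro kalg.mult kalg.const kalg.gen) simp
  then show "v \<in> ?S" using assms(2) by (simp add: mult.assoc[symmetric] cst.hom_one flip: cst.hom_mult)
qed

lemma gen_triangular:
  fixes u v :: "'f::field poly poly"
  assumes uv: "gen u v" and "a \<noteq> 0" "c \<noteq> 0"
  shows "gen (cst b + cst a * u) (evp u p + cst c * v)" (is "gen ?F ?G")
proof (rule gen_subset[OF uv])
  let ?S = "kalg cst {?F, ?G}"
  have S: "?F \<in> ?S" "?G \<in> ?S" by (rule kalg.gen; simp)+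
  have "cst (inverse a) * (?F + cst (- b)) \<in> ?S" by (intro kalg.mult kalg.add kalg.const S)
  moreover have "cst (inverse a) * (?F + cst (- b)) = u"
    using assms(2) cst_inverse[of a] by (simp add: cst.hom_uminus mult.assoc[symmetric])
  ultimately show u: "u \<in> ?S" by simp
  have "evp u (- p) \<in> ?S" using evp_in_kalg[of u "- p"] kalg_mono_gen[of "{u}" cst "{?F, ?G}"] u by auto
  then have "cst (inverse c) * (?G + evp u (- p)) \<in> ?S" by (intro kalg.mult kalg.add kalg.const S)
  moreover have "cst (inverse c) * (?G + evp u (- p)) = v"
    using assms(3) cst_inverse[of c] by (simp add: evp_uminus mult.assoc[symmetric])
  ultimately show "v \<in> ?S" by simp
qed

text \<open>The swap chain is consumed from the side of \<open>E\<close>, whose predecessor is an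
  irreducible derivation with kernel generated by \<open>F1\<close>, that is by \<open>G\<close>.
  The statement also records the penultimate derivation, since extending a chain needs its last two
  members.\<close>

theorem swapchain_to_chain:
  fixes E :: "'k::field_char_0 B3 \<Rightarrow> 'k B3"
  assumes "gen F G" "set ts \<subseteq> T2" "swapchain ts (F, G) = (toK g1, toK g2)" "gen g1 g2"
    "irreducible_der E" "propJ E F"
  shows "\<exists>y1 y2 ds. gen y1 y2 \<and> MC_chain y1 y2 varX ds E \<and> length ds = length ts + 2 \<and>
    propJ (ds ! length ts) G"
  using assms
proof (induction ts arbitrary: F G E)
  case Nil
  then have FG: "F = toK g1" "G = toK g2" by simp_all
  have dE: "is_der cst E" and LE: "is_LND cst E"
    using propJ_der propJ_LND Nil.prems by blast+
  obtain \<kappa> where \<kappa>: "Jac g1 g2 = cst \<kappa>" "\<kappa> dvd 1" using gen_Jac[OF \<open>gen g1 g2\<close>] .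
  then obtain \<kappa>' where \<kappa>': "1 = \<kappa> * \<kappa>'" by auto
  obtain c where c: "c \<noteq> 0" "\<And>f. toK (E f) = cst c * Jac (toK g1) (toK f)"
    using Nil.prems(6) FG by (auto simp: propJ_def)
  have E1: "E g1 = 0" using c(2)[of g1] by simp
  have "toK (E f * Jac g1 g2) = toK (Jac g1 f * E g2)" for f
    by (simp add: toK.hom_mult c(2) Jac_toK[symmetric])
  then have e: "E f * cst \<kappa> = Jac g1 f * E g2" for f by (simp add: \<kappa>)
  have "E f = Jac g1 f * E g2 * cst \<kappa>'" for f
    unfolding e[symmetric] using \<kappa>' by (simp add: mult.assoc cst.hom_one flip: cst.hom_mult)
  \<comment> \<open>All values of \<open>E\<close> are multiples of \<open>E g2\<close>, so
    irreducibility makes it a unit; rescaling \<open>g2\<close> turns \<open>E\<close> into a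
    partial derivative.\<close>
  then have "E g2 dvd E f" for f by (metis dvd_mult dvd_mult2 dvd_refl)
  then have "E g2 dvd 1" using Nil.prems(5) unfolding irreducible_der_iff by blast
  then obtain a where a: "E g2 = cst a" "a dvd 1" by (elim unit_poly2)
  then obtain a' where a': "a * a' = 1" by (metis dvdE)
  define y2 where "y2 = cst a' * g2"
  have y: "gen g1 y2" unfolding y2_def by (rule gen_scale[OF \<open>gen g1 g2\<close> a'])
  have E2: "E y2 = 1"
    using dE a a' by (simp add: is_der_def y2_def cst.hom_one mult.commute flip: cst.hom_mult)
  obtain \<mu> where \<mu>: "Jac y2 g1 = cst \<mu>" "\<mu> dvd 1" using gen_Jac[OF gen_swap[OF y]] .
  then obtain \<mu>' where \<mu>': "\<mu> * \<mu>' = 1" by (metis dvdE)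
  define d1 where "d1 f = cst \<mu>' * Jac y2 f" for f
  have d1: "is_der cst d1" using is_der_Jac[of y2] by (simp add: is_der_def d1_def algebra_simps)
  have d1v: "d1 g1 = 1" "d1 y2 = 0"
    using \<mu>' by (simp_all add: d1_def \<mu> cst.hom_one mult.commute flip: cst.hom_mult)
  have y2K: "toK y2 = cst (fr a') * toK g2" by (simp add: y2_def toK.hom_mult)
  have "a' \<noteq> 0" "\<mu>' \<noteq> 0" using a' \<mu>' by auto
  have P1: "propJ d1 G"
    unfolding propJ_def
  proof (intro exI conjI allI)
    show "fr (\<mu>' * a') \<noteq> 0" using \<open>a' \<noteq> 0\<close> \<open>\<mu>' \<noteq> 0\<close> by simp
    show "toK (d1 f) = cst (fr (\<mu>' * a')) * Jac G (toK f)" for f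
      unfolding d1_def toK.hom_mult toK_simps Jac_toK[symmetric] y2K Jac_cst_mult FG fr.hom_mult cst.hom_mult
      by (simp only: mult_ac)
  qed
  have P1': "is_LND cst d1"
  proof (rule is_LND_generators[OF d1 y])
    fix s assume "s \<in> {g1, y2}"
    then have "(d1 ^^ 2) s = 0" using d1v is_der_zero[OF d1] d1
      by (auto simp: numeral_2_eq_2 is_der_def) (metis cst.hom_one)
    then show "\<exists>n. (d1 ^^ n) s = 0" ..
  qed
  have "MC_chain g1 y2 varX [d1, E] E"
    unfolding MC_chain_def
  proof (intro conjI ballI allI impI)
    fix e assume "e \<in> set [d1, E]"
    then consider "e = d1" | "e = E" by auto
    then show "is_LND constB e" "irreducible_der e" "e varX = 0"
      using P1' LE Nil.prems(5) irreducible_der_one[of d1] d1v(1)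
      by (cases; force simp: is_LND_cst_iff)+
  qed (use d1 d1v dE E1 E2 in \<open>auto simp: is_partial_def is_der_cst_iff\<close>)
  then show ?case using y P1 by (intro exI[of _ g1] exI[of _ y2] exI[of _ "[d1, E]"]) simp
next
  case (Cons t ts)
  obtain a b c p where t: "t = ([:[:b, a:]:], [:p, [:c:]:])" "a \<noteq> 0" "c \<noteq> 0"
    using T2E Cons.prems(2) by (metis list.set_intros(1) subsetD)
  define F1 G1 where "F1 = cst b + cst a * G" and "G1 = evp G p + cst c * F"
  have tFG: "comp_aut t (comp_aut swap_aut (F, G)) = (F1, G1)"
    unfolding t comp_swap comp_T2 F1_def G1_def ..
  have gen1: "gen F1 G1"
    unfolding F1_def G1_def by (rule gen_triangular[OF gen_swap[OF Cons.prems(1)] t(2,3)])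
  obtain E1 where E1: "is_LND cst E1" "irreducible_der E1" "propJ E1 F1"
    using irreducible_derivation_exists[OF gen1] .
  have sc: "swapchain ts (F1, G1) = (toK g1, toK g2)" using Cons.prems(3) by (simp add: tFG)
  obtain y1 y2 ds where IH: "gen y1 y2" "MC_chain y1 y2 varX ds E1" "length ds = length ts + 2"
      "propJ (ds ! length ts) G1"
    using Cons.IH[OF gen1 _ sc Cons.prems(4) E1(2,3)] Cons.prems(2) by auto
  define E0 where "E0 = ds ! length ts"
  have last: "ds ! Suc (length ts) = E1"
    using IH(2,3) by (auto simp: MC_chain_def last_conv_nth) (metis diff_Suc_1 last_conv_nth length_0_conv nat.simps(3))
  obtain l where l: "l \<noteq> 0" "\<And>f. toK (E f) = cst l * Jac F (toK f)"
    using Cons.prems(6) by (auto simp: propJ_def)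
  obtain l1 where l1: "l1 \<noteq> 0" "\<And>f. toK (E1 f) = cst l1 * Jac F1 (toK f)"
    using E1(3) by (auto simp: propJ_def)
  obtain m where m: "m \<noteq> 0" "\<And>f. toK (E0 f) = cst m * Jac G1 (toK f)"
    using IH(4) by (auto simp: propJ_def E0_def)
  have J1: "Jac F1 g = cst a * Jac G g" for g
    by (simp add: F1_def Jac_add_left Jac_cst_mult)
  have J2: "Jac G1 g = evp G (pderiv p) * Jac G g + cst c * Jac F g" for g
    by (simp add: G1_def Jac_add_left Jac_cst_mult Jac_evp_left)
  \<comment> \<open>\<open>Jac G1\<close> is p'(G) \<open>Jac G\<close> plus c \<open>Jac F\<close>;
    solving for \<open>Jac F\<close> and inserting the three proportionality scalars gives the
    coefficients of \<open>E0\<close> and \<open>E1\<close>.\<close>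
  define A S where "A = l / (c * m)" and "S = - (cst (l / (c * (l1 * a))) * evp G (pderiv p))"
  have A0: "A \<noteq> 0" using l m t by (simp add: A_def)
  have rel: "toK (E g) = cst A * toK (E0 g) + S * toK (E1 g)" for g
  proof -
    have 1: "cst A * cst m = cst (l / c)" "cst (l / (c * (l1 * a))) * cst l1 * cst a = cst (l / c)"
      "cst (l / c) * cst c = cst l"
      using m t l1 by (simp_all add: A_def flip: cst.hom_mult)
    have "cst A * toK (E0 g) + S * toK (E1 g) =
      (cst A * cst m) * (evp G (pderiv p) * Jac G (toK g) + cst c * Jac F (toK g))
      - (cst (l / (c * (l1 * a))) * cst l1 * cst a) * (evp G (pderiv p) * Jac G (toK g))"
      by (simp add: m(2) l1(2) J1 J2 S_def mult_ac)
    also have "\<dots> = cst (l / c) * cst c * Jac F (toK g)" unfolding 1(1,2) by (simp add: algebra_simps)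
    finally show ?thesis using 1(3) l(2)[of g] by metis
  qed
  \<comment> \<open>The denominators of \<open>A\<close> and \<open>S\<close> are cleared
    separately; their product becomes the factor h of the chain relation.\<close>
  obtain r1 f1 where r1: "r1 \<noteq> 0" "fr r1 * A = fr f1"
  proof -
    obtain u v where "A = Fract u v" "v \<noteq> 0" by (cases A)
    then have "fr v * A = fr u" by (simp add: eq_fract)
    with \<open>v \<noteq> 0\<close> that show thesis by blast
  qed
  have f1: "f1 \<noteq> 0" using r1 A0 by (metis divisors_zero fr.hom_zero fr_eq_0_iff)
  obtain r2 s where r2: "r2 \<noteq> 0" "cst (fr r2) * S = toK s" using clear_denominators .
  have rel': "cst (r1 * r2) * E g = cst r1 * s * E1 g + cst (f1 * r2) * E0 g" for g
  proof -
    have "toK (cst (r1 * r2) * E g) = cst (fr (r1 * r2)) * (cst A * toK (E0 g) + S * toK (E1 g))"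
      by (simp add: toK.hom_mult rel)
    also have "\<dots> = cst (fr r1) * (cst (fr r2) * S) * toK (E1 g) + cst (fr r1 * A) * cst (fr r2) * toK (E0 g)"
      unfolding fr.hom_mult cst.hom_mult by (simp only: algebra_simps)
    also have "\<dots> = toK (cst r1 * s * E1 g + cst (f1 * r2) * E0 g)"
      unfolding r1 r2 toK.hom_add toK.hom_mult toK_simps fr.hom_mult cst.hom_mult ..
    finally show ?thesis by simp
  qed
  have "cst (fr r2) * S = evp G (smult (fr r2) (- smult (l / (c * (l1 * a))) (pderiv p)))"
    by (simp only: S_def evp_smult evp_uminus)
  then have "Jac G (toK s) = 0" unfolding r2(2) by simp
  then have "toK (E1 s) = 0" using l1(2)[of s] by (simp add: J1)
  then have "E1 s = 0" by simp
  then have \<sigma>: "E1 (cst r1 * s) = 0" using E1(1) by (simp add: is_LND_def is_der_def)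
  have LE: "is_LND constB E" "E varX = 0"
    using propJ_LND[OF Cons.prems(6,1)] by (simp_all add: is_LND_cst_iff)
  have "MC_chain y1 y2 varX (ds @ [E]) E"
    unfolding MC_chain_def
  proof (intro conjI ballI allI impI)
    fix e assume "e \<in> set (ds @ [E])"
    then have "e \<in> set ds \<or> e = E" by auto
    then show "is_LND constB e" "irreducible_der e" "e varX = 0"
      using IH(2) LE Cons.prems(5) by (auto simp: MC_chain_def)
  next
    fix i assume i: "2 \<le> i \<and> i < length (ds @ [E])"
    show "\<exists>\<sigma> f h. ((ds @ [E]) ! (i - 1)) \<sigma> = 0 \<and> f \<in> kalg constB {varX} \<and> f \<noteq> 0 \<and>
        h \<in> kalg constB {varX} \<and> h \<noteq> 0 \<and>
        (\<forall>g. h * ((ds @ [E]) ! i) g = \<sigma> * ((ds @ [E]) ! (i - 1)) g + f * ((ds @ [E]) ! (i - 2)) g)"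
    proof (cases "i < length ds")
      case True
      then show ?thesis using i IH(2) by (simp add: MC_chain_def nth_append less_imp_diff_less)
    next
      case False
      then have il: "i = length ts + 2" using i IH(3) by simp
      have nth: "(ds @ [E]) ! i = E" "(ds @ [E]) ! (i - 1) = E1" "(ds @ [E]) ! (i - 2) = E0"
        using IH(3) last by (simp_all add: il nth_append E0_def)
      show ?thesis unfolding nth
        by (rule exI[of _ "cst r1 * s"], rule exI[of _ "cst (f1 * r2)"], rule exI[of _ "cst (r1 * r2)"])
          (use \<sigma> rel' r1 r2 f1 in \<open>simp add: cst_in_kalg\<close>)
    qed
  qed (use IH(2,3) in \<open>auto simp: MC_chain_def nth_append\<close>)
  moreover have "propJ ((ds @ [E]) ! length (t # ts)) G"
    unfolding propJ_def
  proof (intro exI conjI allI)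
    show "l1 * a \<noteq> 0" using l1 t by simp
    show "toK (((ds @ [E]) ! length (t # ts)) f) = cst (l1 * a) * Jac G (toK f)" for f
      using IH(3) last by (simp add: nth_append l1(2) J1 cst.hom_mult mult.assoc)
  qed
  ultimately show ?case using IH(1,3)
    by (intro exI[of _ y1] exI[of _ y2] exI[of _ "ds @ [E]"]) simp
qed

section \<open>Reduction modulo primes of k[x]\<close>

text \<open>Evaluation at a root of \<open>h\<close> in the algebraic closure: it realizes reduction
  modulo an irreducible factor p with an integral domain as target. Here p is a kernel element of
  least degree, hence generates the kernel.\<close>

lemma ex_place:
  fixes h :: "'k::field poly"
  assumes "h \<noteq> 0" "degree h > 0"
  obtains e :: "'k poly \<Rightarrow> 'k alg_closure" and p where "rhom e" "degree p > 0" "p dvd h" "\<forall>f. e f = 0 \<longleftrightarrow> p dvd f"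
proof -
  have ac: "rhom (to_ac :: 'k \<Rightarrow> 'k alg_closure)" by standard simp_all
  obtain c where c: "poly (map_poly to_ac h) c = 0"
    using alg_closed_imp_poly_has_root[of "map_poly to_ac h"] assms by (auto simp: degree_map_poly)
  define e where "e f = poly (map_poly to_ac f) c" for f :: "'k poly"
  have e: "rhom e" unfolding e_def by (rule rhom.rhom_poly_map_poly[OF ac])
  interpret e: rhom e by (rule e)
  have "h \<noteq> 0 \<and> e h = 0" using c assms by (simp add: e_def)
  from ex_has_least_nat[of "\<lambda>f. f \<noteq> 0 \<and> e f = 0", OF this, of degree]
  obtain p where p: "p \<noteq> 0" "e p = 0" "\<And>f. f \<noteq> 0 \<Longrightarrow> e f = 0 \<Longrightarrow> degree p \<le> degree f" by blast
  have iff: "e f = 0 \<longleftrightarrow> p dvd f" for f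
  proof
    assume "e f = 0"
    have "e (f mod p) = 0"
      using \<open>e f = 0\<close> p(2) by (simp add: minus_div_mult_eq_mod[symmetric] e.hom_diff e.hom_mult)
    then have "f mod p = 0" using p(3)[of "f mod p"] degree_mod_less'[OF p(1), of f] by linarith
    then show "p dvd f" by auto
  qed (auto simp: e.hom_mult p)
  have "degree p > 0"
  proof (rule ccontr)
    assume "\<not> ?thesis"
    then obtain a where "p = [:a:]" by (auto elim: degree_eq_zeroE)
    then show False using p by (simp add: e_def map_poly_pCons)
  qed
  moreover have "p dvd h" using c by (simp flip: iff) (simp add: e_def)
  ultimately show thesis using that[of e p] e iff by blast
qed

locale place =
  fixes e :: "'k::field_char_0 poly \<Rightarrow> 'k alg_closure" and p :: "'k poly"
  assumes rhom_e: "rhom e" and deg_p: "degree p > 0" and e_eq_0: "e f = 0 \<longleftrightarrow> p dvd f"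
begin

sublocale e: rhom e by (rule rhom_e)
sublocale m: rhom "mapc e" by (rule rhom_mapc[OF rhom_e])

lemma p_nonzero: "p \<noteq> 0"
  using deg_p by auto

lemma mapc_eq_0: "mapc e f = 0 \<longleftrightarrow> cst p dvd f"
proof
  assume "mapc e f = 0"
  then have "p dvd coeff (coeff f j) i" for i j
    using coeff_mapc[OF rhom_e, of f j i] by (simp add: e_eq_0)
  then show "cst p dvd f" unfolding cst_def by (simp add: const_poly_dvd_iff)
next
  assume "cst p dvd f"
  then show "mapc e f = 0" by (auto simp: m.hom_mult mapc_simps[OF rhom_e] e_eq_0)
qed

lemma prime_p: "cst p dvd f * g \<Longrightarrow> cst p dvd f \<or> cst p dvd g"
  by (simp add: m.hom_mult flip: mapc_eq_0)

lemma not_dvd_unit: "\<not> cst p dvd cst [:c:]" if "c \<noteq> 0"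
proof
  assume "cst p dvd cst [:c:]"
  then have "[:p:] dvd coeff [:[:[:c:]:]:] 0" unfolding cst_def const_poly_dvd_iff by blast
  then have "p dvd coeff (coeff [:[:[:c:]:]:] 0) 0" unfolding const_poly_dvd_iff by blast
  then have "p dvd [:c:]" by simp
  then have "degree p \<le> degree [:c:]" using that by (intro dvd_imp_degree_le) simp_all
  with deg_p show False by simp
qed

end

section \<open>Polynomials in one nonconstant element\<close>

lemma evp_pcompose: "evp q T = pcompose (map_poly (\<lambda>c. [:c:]) T) q"
  by (simp add: evp_def pcompose_altdef cst_def[abs_def] map_poly_map_poly o_def)

lemma evp_pcompose_const: "evp [:q:] T = [:pcompose T q:]"
  by (induction T) (simp_all add: evp_pCons pcompose_pCons cst_def)

lemma degree_map_const: "degree (map_poly (\<lambda>c. [:c:]) T) = degree T" for T :: "'a::idom poly"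
  by (rule degree_map_poly) simp

text \<open>Substituting \<open>q\<close> multiplies degrees by the positive degree of
  \<open>q\<close> in a variable in which it is not constant, so a nonzero \<open>g\<close> would
  make the left side too large. If \<open>q\<close> is free of z, the equation first forces
  \<open>g\<close> to be free of z too.\<close>

lemma evp_division_unique:
  fixes q :: "'l::idom poly poly"
  assumes q: "q \<notin> range cst" and eq: "evp q T * g = evp q r" and T: "T \<noteq> 0"
    and r: "r = 0 \<or> degree r < degree T"
  shows "g = 0"
proof -
  have T': "map_poly (\<lambda>c. [:c:]) T \<noteq> 0" using T by (simp add: map_poly_eq_0_iff)
  show ?thesis
  proof (cases "degree q > 0")
    case True
    have Tn: "evp q T \<noteq> 0"
      unfolding evp_pcompose using T' True by (simp add: pcompose_eq_0_iff)
    show ?thesis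
    proof (rule ccontr)
      assume g: "g \<noteq> 0"
      then have "r \<noteq> 0" using eq Tn by auto
      with r have "degree r < degree T" by simp
      moreover have "degree T * degree q + degree g = degree r * degree q"
        using arg_cong[OF eq, of degree] Tn g
        by (simp add: degree_mult_eq) (simp add: evp_pcompose degree_pcompose degree_map_const)
      ultimately show False using True by (metis add_leE leD le_refl mult_less_mono1)
    qed
  next
    case False
    then obtain q1 where q1: "q = [:q1:]" by (auto elim: degree_eq_zeroE)
    have d1: "degree q1 > 0"
    proof (rule ccontr)
      assume "\<not> degree q1 > 0"
      then obtain c where "q1 = [:c:]" by (auto elim: degree_eq_zeroE)
      then have "q = cst c" by (simp add: q1 cst_def)
      with q show False by simp
    qed
    have Tn: "pcompose T q1 \<noteq> 0" using T d1 by (simp add: pcompose_eq_0_iff)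
    have e: "smult (pcompose T q1) g = [:pcompose r q1:]"
      using eq by (simp add: q1 evp_pcompose_const)
    have "degree g = 0" using arg_cong[OF e, of degree] Tn by simp
    then obtain g1 where g1: "g = [:g1:]" by (auto elim: degree_eq_zeroE)
    with e have e1: "pcompose T q1 * g1 = pcompose r q1" by simp
    show ?thesis
    proof (rule ccontr)
      assume "g \<noteq> 0"
      then have g: "g1 \<noteq> 0" using g1 by simp
      then have "r \<noteq> 0" using e1 Tn by auto
      with r have "degree r < degree T" by simp
      moreover have "degree T * degree q1 + degree g1 = degree r * degree q1"
        using arg_cong[OF e1, of degree] Tn g by (simp add: degree_mult_eq degree_pcompose)
      ultimately show False using d1 by (metis add_leE leD le_refl mult_less_mono1)
    qed
  qed
qed

lemma evp_eq_0_imp: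
  fixes q :: "'l::idom poly poly"
  assumes "q \<notin> range cst" "evp q T = 0"
  shows "T = 0"
proof (rule ccontr)
  assume "T \<noteq> 0"
  with evp_division_unique[OF assms(1), of T 1 0] assms(2) show False by simp
qed

text \<open>An integral multiple of \<open>F\<close> is improved by subtracting an element of k[x]
  and dividing by a factor in k[x] of the largest possible degree. The result is nonconstant modulo
  every prime of k[x], as needed for generating the kernel over k[x] and not only over K.\<close>

lemma kernel_generator:
  fixes F G :: "'k::field_char_0 KYZ"
  assumes FG: "gen F G"
  obtains P a b where "a \<noteq> 0" "toK P = cst a * F + cst b"
    "\<forall>p u w. degree p > 0 \<longrightarrow> P \<noteq> cst u + cst p * w"
proof -
  obtain r P0 where r: "r \<noteq> 0" "cst (fr r) * F = toK P0" using clear_denominators .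
  obtain \<kappa> where \<kappa>: "Jac F G = cst \<kappa>" "\<kappa> \<noteq> 0" using gen_Jac_field[OF FG] .
  have P0: "P0 \<notin> range cst"
  proof
    assume "P0 \<in> range cst"
    then have "Jac (cst (fr r) * F) G = 0" by (auto simp: r(2))
    then show False using r(1) \<kappa> by (simp add: Jac_cst_mult)
  qed
  define S where "S g \<longleftrightarrow> g \<noteq> 0 \<and> (\<exists>u w. P0 = cst u + cst g * w)" for g
  have S1: "S 1" unfolding S_def by (rule conjI, simp, rule exI[of _ 0]) (simp add: cst.hom_one)
  \<comment> \<open>Every admissible factor divides each coefficient except the constant one, so a
    nonzero such coefficient bounds its degree.\<close>
  have "\<exists>i j. \<not> (i = 0 \<and> j = 0) \<and> coeff (coeff P0 j) i \<noteq> 0"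
  proof (rule ccontr)
    assume n: "\<not> ?thesis"
    have z: "coeff (coeff P0 j) i = 0" if ij: "i = 0 \<longrightarrow> j \<noteq> 0" for i j
    proof (rule ccontr)
      assume "coeff (coeff P0 j) i \<noteq> 0"
      with ij have "\<not> (i = 0 \<and> j = 0) \<and> coeff (coeff P0 j) i \<noteq> 0" by auto
      then have "\<exists>i j. \<not> (i = 0 \<and> j = 0) \<and> coeff (coeff P0 j) i \<noteq> 0" by (intro exI)
      with n show False by (rule notE)
    qed
    have "P0 = cst (coeff (coeff P0 0) 0)"
      by (rule poly_eqI, rule poly_eqI) (simp add: coeff2_cst z)
    with P0 show False by auto
  qed
  then obtain i j where ij: "\<not> (i = 0 \<and> j = 0)" "coeff (coeff P0 j) i \<noteq> 0" by blast
  have "\<forall>g. S g \<longrightarrow> degree g < Suc (degree (coeff (coeff P0 j) i))"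
  proof (intro allI impI)
    fix g assume "S g"
    then obtain u w where "P0 = cst u + cst g * w" by (auto simp: S_def)
    then have "coeff (coeff P0 j) i = g * coeff (coeff w j) i"
      using ij(1) by (auto simp: coeff2_cst_mult coeff2_cst)
    then have "g dvd coeff (coeff P0 j) i" by (rule dvdI)
    then show "degree g < Suc (degree (coeff (coeff P0 j) i))"
      using ij(2) by (simp add: dvd_imp_degree_le less_Suc_eq_le)
  qed
  from ex_has_greatest_nat[OF S1 this] obtain g
    where g: "S g" "\<And>g'. S g' \<Longrightarrow> degree g' \<le> degree g" by blast
  then obtain u P where P: "g \<noteq> 0" "P0 = cst u + cst g * P" by (auto simp: S_def)
  have "\<forall>p u w. degree p > 0 \<longrightarrow> P \<noteq> cst u + cst p * w"
  proof (intro allI impI notI)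
    fix p u' w assume p: "degree p > 0" "P = cst u' + cst p * w"
    have "P0 = cst (u + g * u') + cst (g * p) * w"
      unfolding P(2) p(2) by (simp add: cst.hom_add cst.hom_mult algebra_simps)
    moreover have "p \<noteq> 0" using p by auto
    ultimately have "S (g * p)" using P(1) unfolding S_def by (intro conjI exI) simp_all
    then have "degree (g * p) \<le> degree g" by (rule g(2))
    then show False using P(1) \<open>p \<noteq> 0\<close> p(1) by (simp add: degree_mult_eq)
  qed
  moreover have "toK P = cst (inverse (fr g) * fr r) * F + cst (inverse (fr g) * - fr u)"
  proof -
    have "toK P = cst (inverse (fr g)) * cst (fr g) * toK P"
      using P(1) by (subst cst_inverse) simp_all
    also have "cst (inverse (fr g)) * cst (fr g) * toK P = cst (inverse (fr g)) * (toK P0 - cst (fr u))"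
      unfolding P(2) by (simp add: toK.hom_add toK.hom_mult mult.assoc)
    also have "\<dots> = cst (inverse (fr g)) * (cst (fr r) * F - cst (fr u))" by (simp only: r(2))
    finally show ?thesis by (simp only: cst.hom_mult cst.hom_uminus right_diff_distrib mult.assoc mult_minus_right add_uminus_conv_diff)
  qed
  moreover have "inverse (fr g) * fr r \<noteq> 0"
    unfolding mult_eq_0_iff de_Morgan_disj using P(1) r(1) by (intro conjI nonzero_imp_inverse_nonzero) simp_all
  ultimately show thesis using that by blast
qed

text \<open>A constant value could be any element of the algebraic closure; that it lifts to k[x] is
  seen from the constant coefficient of \<open>P\<close>, of which it is the residue.\<close>

lemma (in place) residue_nonconstant:
  assumes P: "\<forall>p u w. degree p > 0 \<longrightarrow> P \<noteq> cst u + cst p * w"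
  shows "mapc e P \<notin> range cst"
proof
  assume "mapc e P \<in> range cst"
  then obtain l where l: "mapc e P = cst l" by auto
  then have "l = e (coeff (coeff P 0) 0)"
    using coeff_mapc[OF rhom_e, of P 0 0] by (simp add: coeff2_cst)
  then have "mapc e (P - cst (coeff (coeff P 0) 0)) = 0"
    by (simp add: m.hom_diff l mapc_simps[OF rhom_e])
  then obtain w where "P - cst (coeff (coeff P 0) 0) = cst p * w" unfolding mapc_eq_0 by (auto elim: dvdE)
  then have "P = cst (coeff (coeff P 0) 0) + cst p * w" by (simp add: algebra_simps)
  with P deg_p show False by blast
qed

text \<open>Over K the element is a polynomial in \<open>P\<close>. If a denominator of least degree
  had a prime factor p, then T(P) would vanish modulo p; as \<open>P\<close> is nonconstant there, p
  divides T and can be cancelled.\<close>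

lemma kernel_eq_polynomials:
  fixes F G :: "'k::field_char_0 KYZ"
  assumes FG: "gen F G" and a: "a \<noteq> 0" "toK P = cst a * F + cst b"
    and P: "\<forall>p u w. degree p > 0 \<longrightarrow> P \<noteq> cst u + cst p * w"
    and f: "Jac F (toK f) = 0"
  obtains T where "f = evp P T"
proof -
  obtain s where s: "toK f = evp F s" using Jac_eq_0_imp_evp[OF FG f] .
  have "cst (inverse a) * toK P = (cst (inverse a) * cst a) * F + cst (inverse a) * cst b"
    unfolding a(2) by (simp only: distrib_left mult.assoc)
  then have "F = cst (- (inverse a * b)) + cst (inverse a) * toK P"
    using cst_inverse[OF a(1)] by (simp add: cst.hom_uminus cst.hom_mult)
  then have "toK f = evp (toK P) (pcompose s [:- (inverse a * b), inverse a:])"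
    unfolding s by (metis evp_affine)
  then obtain s' where s': "toK f = evp (toK P) s'" by blast
  \<comment> \<open>The univariate polynomial is placed in degree 0 of the outer variable, so that
    denominators can be cleared as in two variables.\<close>
  obtain r g where r: "r \<noteq> 0" "cst (fr r) * [:s':] = toK g" using clear_denominators .
  define T where "T = coeff g 0"
  have T: "smult (fr r) s' = map_poly fr T"
  proof -
    have "coeff (cst (fr r) * [:s':]) 0 = smult (fr r) s'" by (simp add: cst_def)
    then show ?thesis unfolding r(2) by (simp add: toK_mapc T_def coeff_map_poly)
  qed
  have "toK (cst r * f) = toK (evp P T)"
    by (simp add: toK.hom_mult toK_evp s' flip: T evp_smult)
  then have "r \<noteq> 0 \<and> (\<exists>T. cst r * f = evp P T)" using r by auto
  from ex_has_least_nat[of "\<lambda>r. r \<noteq> 0 \<and> (\<exists>T. cst r * f = evp P T)", OF this, of degree]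
  obtain r T where r: "r \<noteq> 0" "cst r * f = evp P T"
    and min: "\<And>r' T'. r' \<noteq> 0 \<Longrightarrow> cst r' * f = evp P T' \<Longrightarrow> degree r \<le> degree r'" by blast
  have "degree r = 0"
  proof (rule ccontr)
    assume "degree r \<noteq> 0"
    then obtain e :: "'k poly \<Rightarrow> 'k alg_closure" and p
      where "rhom e" "degree p > 0" "p dvd r" "\<forall>f. e f = 0 \<longleftrightarrow> p dvd f" using ex_place[OF r(1)] by auto
    then interpret place e p by (intro place.intro) auto
    obtain r' where r': "r = p * r'" using \<open>p dvd r\<close> by auto
    have "evp (mapc e P) (map_poly e T) = mapc e (cst r * f)"
      unfolding r(2) by (rule mapc_evp[OF rhom_e, symmetric])
    also have "\<dots> = 0" using \<open>p dvd r\<close> by (simp add: m.hom_mult mapc_simps[OF rhom_e] e_eq_0)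
    finally have "map_poly e T = 0" by (rule evp_eq_0_imp[OF residue_nonconstant[OF P]])
    then have "p dvd coeff T n" for n
      using coeff_map_poly[of e T n] by (simp add: e_eq_0)
    then have "[:p:] dvd T" by (simp add: const_poly_dvd_iff)
    then obtain T' where T': "T = smult p T'" by (auto elim: dvdE)
    have "cst p * (cst r' * f) = cst p * evp P T'"
      using r(2) by (simp add: r' T' evp_smult cst.hom_mult mult.assoc)
    then have "cst r' * f = evp P T'" using p_nonzero by simp
    moreover have "r' \<noteq> 0" using r r' by auto
    ultimately have "degree r \<le> degree r'" by (intro min)
    then show False using r' p_nonzero \<open>r' \<noteq> 0\<close> deg_p by (simp add: degree_mult_eq)
  qed
  then obtain c where c: "r = [:c:]" "c \<noteq> 0" using r(1) by (metis degree_eq_zeroE pCons_0_0)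
  have "f = cst [:inverse c:] * (cst r * f)"
    using c by (simp add: mult.assoc[symmetric] cst.hom_one one_pCons flip: cst.hom_mult)
      (simp add: cst.hom_one flip: one_pCons)
  also have "\<dots> = evp P (smult [:inverse c:] T)" by (simp only: r(2) evp_smult)
  finally show thesis by (rule that)
qed

section \<open>A second coordinate in the kernel\<close>

text \<open>The last iterate of \<open>v\<close> but one before the zero is taken.\<close>

lemma (in lnd) ex_local_slice:
  assumes "D (D v) \<noteq> 0"
  obtains s where "D s \<noteq> 0" "D (D s) = 0"
proof -
  define n where "n = (LEAST n. (D ^^ n) v = 0)"
  have n: "(D ^^ n) v = 0" unfolding n_def by (rule LeastI_ex[OF nilpotent])
  have min: "(D ^^ m) v \<noteq> 0" if "m < n" for m using that not_less_Least unfolding n_def by blast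
  have "n \<noteq> 0" "n \<noteq> 1"
    using n assms by (auto dest: arg_cong[of _ _ D] intro!: gr0I)
  then obtain m where m: "n = Suc (Suc m)" by (metis One_nat_def not0_implies_Suc)
  show thesis using that[of "(D ^^ m) v"] n min[of "Suc m"] by (simp add: m)
qed

definition extK :: "('k::field_char_0 B3 \<Rightarrow> 'k B3) \<Rightarrow> 'k KYZ \<Rightarrow> 'k KYZ" where
  "extK E f = dy f * toK (E YY) + dz f * toK (E ZZ)"

lemma extK_toK:
  assumes "is_der cst E"
  shows "extK E (toK f) = toK (E f)"
  unfolding extK_def is_der_eq[OF assms, of f] by (simp add: toK.hom_add toK.hom_mult dy_toK dz_toK)

lemma is_LND_extK:
  assumes "is_LND cst E"
  shows "is_LND cst (extK E)"
proof (rule is_LND_generators[OF _ gen_YY_ZZ])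
  show "is_der cst (extK E)"
    by (simp add: is_der_def extK_def dy_add dz_add dy_mult dz_mult algebra_simps)
  have der: "is_der cst E" using assms by (simp add: is_LND_def)
  have p: "(extK E ^^ n) (toK f) = toK ((E ^^ n) f)" for n f
    by (induction n) (simp_all add: extK_toK[OF der])
  fix s :: "'a KYZ" assume "s \<in> {YY, ZZ}"
  then obtain f where f: "s = toK f" by (metis insertE singletonD toK_simps(2,3))
  obtain n where "(E ^^ n) f = 0" using assms unfolding is_LND_def by blast
  then have "(extK E ^^ n) s = 0" by (simp add: f p)
  then show "\<exists>n. (extK E ^^ n) s = 0" ..
qed

text \<open>After extension to \<open>K[y,z]\<close>, Rentschler's theorem makes the derivation a multiple of a
  partial derivative with a kernel element as factor; clearing denominators gives the claim.\<close>
lemma divisible_derivation: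
  fixes E :: "'k::field_char_0 B3 \<Rightarrow> 'k B3"
  assumes E: "is_LND cst E" and c: "E c = 0" "c \<notin> range cst"
  obtains t r b1 b2 where "r \<noteq> 0" "E (E t) = 0" "cst r * E YY = E t * b1" "cst r * E ZZ = E t * b2"
proof -
  have der: "is_der cst E" using E by (simp add: is_LND_def)
  interpret K: lnd "extK E" by (rule lnd.intro[OF is_LND_extK[OF E]])
  have "toK c \<notin> range cst" using c(2) toK_eq_cst by blast
  moreover have "extK E (toK c) = 0" by (simp add: extK_toK[OF der] c)
  ultimately obtain u v where uv: "tame u v" "extK E u = 0" using K.Rentschler by blast
  have g: "gen u v" by (rule tame_gen[OF uv(1)])
  obtain \<kappa> where \<kappa>: "Jac u v = cst \<kappa>" "\<kappa> \<noteq> 0" using gen_Jac_field[OF g] .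
  have EK: "cst \<kappa> * extK E f = Jac u f * extK E v" for f
  proof -
    obtain \<Phi> where \<Phi>: "f = sub u v \<Phi>" using g unfolding kalg2_eq by (metis UNIV_I imageE)
    show ?thesis unfolding \<Phi> der_sub[OF K.der, of u v] der_sub[OF is_der_Jac, of u u v]
      by (simp add: uv(2) \<kappa> mult_ac)
  qed
  \<comment> \<open>All values are multiples of \<open>extK E v\<close> up to a scalar, in
    particular the nonzero kernel value at a local slice; a divisor of a kernel element has degree
    0.\<close>
  have EEv: "extK E (extK E v) = 0"
  proof (rule ccontr)
    assume n: "extK E (extK E v) \<noteq> 0"
    then obtain s where s: "extK E s \<noteq> 0" "extK E (extK E s) = 0" by (rule K.ex_local_slice)
    have "extK E v dvd cst \<kappa> * extK E s" unfolding EK by simp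
    moreover have "cst \<kappa> * extK E s \<noteq> 0" using s \<kappa> by simp
    ultimately have "K.ddeg (extK E v) \<le> K.ddeg (cst \<kappa> * extK E s)" by (rule K.ddeg_dvd_le)
    also have "K.ddeg (cst \<kappa> * extK E s) = 0" using s by (simp add: K.D_cst_mult flip: K.D_eq_0_iff)
    finally show False using n by (simp add: K.D_eq_0_iff)
  qed
  obtain r0 t where t: "r0 \<noteq> 0" "cst (fr r0) * v = toK t" using clear_denominators .
  have Et: "toK (E t) = cst (fr r0) * extK E v"
    by (simp add: extK_toK[OF der, symmetric] t(2)[symmetric] K.D_cst_mult)
  have "toK (E (E t)) = extK E (toK (E t))" by (simp only: extK_toK[OF der])
  also have "\<dots> = 0" unfolding Et by (simp add: K.D_cst_mult EEv)
  finally have "toK (E (E t)) = 0" .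
  then have EEt: "E (E t) = 0" by simp
  have div: "\<exists>r b. r \<noteq> 0 \<and> cst r * E f = E t * b" for f
  proof -
    define q where "q = cst (inverse (\<kappa> * fr r0)) * Jac u (toK f)"
    have k: "\<kappa> * fr r0 \<noteq> 0" using \<kappa> t by simp
    have "cst (\<kappa> * fr r0) * toK (E f) = cst (fr r0) * (cst \<kappa> * extK E (toK f))"
      by (simp only: extK_toK[OF der] cst.hom_mult mult_ac)
    also have "\<dots> = Jac u (toK f) * toK (E t)" unfolding EK Et by (simp only: mult_ac)
    finally have e: "cst (\<kappa> * fr r0) * toK (E f) = Jac u (toK f) * toK (E t)" .
    have "toK (E f) = cst (inverse (\<kappa> * fr r0)) * cst (\<kappa> * fr r0) * toK (E f)"
      by (simp only: cst_inverse[OF k] mult_1)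
    also have "\<dots> = q * toK (E t)" unfolding q_def by (simp only: mult.assoc e)
    finally have q: "toK (E f) = q * toK (E t)" .
    obtain r b where r: "r \<noteq> 0" "cst (fr r) * q = toK b" using clear_denominators .
    have "toK (cst r * E f) = toK (E t * b)"
      unfolding toK.hom_mult toK_simps q by (simp only: r(2)[symmetric] mult_ac)
    then show ?thesis using r(1) by auto
  qed
  obtain r1 b1 where 1: "r1 \<noteq> 0" "cst r1 * E YY = E t * b1" using div by blast
  obtain r2 b2 where 2: "r2 \<noteq> 0" "cst r2 * E ZZ = E t * b2" using div by blast
  show thesis
  proof (rule that)
    show "r1 * r2 \<noteq> 0" using 1 2 by simp
    show "E (E t) = 0" by (rule EEt)
    have "cst (r1 * r2) * E YY = cst r2 * (cst r1 * E YY)" by (simp only: cst.hom_mult mult_ac)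
    also have "\<dots> = E t * (cst r2 * b1)" unfolding 1 by (simp only: mult_ac)
    finally show "cst (r1 * r2) * E YY = E t * (cst r2 * b1)" .
    have "cst (r1 * r2) * E ZZ = cst r1 * (cst r2 * E ZZ)" by (simp only: cst.hom_mult mult_ac)
    also have "\<dots> = E t * (cst r1 * b2)" unfolding 2 by (simp only: mult_ac)
    finally show "cst (r1 * r2) * E ZZ = E t * (cst r1 * b2)" .
  qed
qed

lemma dvd_dz_self: "f dvd dz f \<Longrightarrow> dz f = 0" for f :: "'c::{idom,ring_char_0} poly poly"
  unfolding dz_def
  by (metis degree_pderiv diff_less dvd_imp_degree_le gr0I leD less_one pderiv_eq_0_iff)

text \<open>The cofactor has degree 0 in the outer variable, so comparing leading coefficients
  reduces the claim to one variable.\<close>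

lemma dvd_dy_self:
  fixes f :: "'c::{idom,ring_char_0} poly poly"
  assumes "f dvd dy f"
  shows "dy f = 0"
proof (rule ccontr)
  assume nz: "dy f \<noteq> 0"
  obtain g where g: "dy f = f * g" using assms by auto
  then have nz': "f \<noteq> 0" "g \<noteq> 0" using nz by auto
  have "degree (dy f) \<le> degree f" by (intro degree_le) (simp add: coeff_dy coeff_eq_0)
  then have "degree g = 0" using g nz' by (simp add: degree_mult_eq)
  then obtain g0 where g0: "g = [:g0:]" by (auto elim: degree_eq_zeroE)
  have "pderiv (lead_coeff f) = lead_coeff f * g0"
    using arg_cong[OF g, of "\<lambda>p. coeff p (degree f)"] by (simp add: coeff_dy g0 mult.commute)
  then have "lead_coeff f dvd pderiv (lead_coeff f)" by simp
  then have "pderiv (lead_coeff f) = 0"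
    by (metis degree_pderiv diff_less dvd_imp_degree_le gr0I leD less_one pderiv_eq_0_iff)
  with \<open>pderiv (lead_coeff f) = lead_coeff f * g0\<close> nz' g0 show False by auto
qed

lemma dy_dz_eq_0_imp_cst:
  fixes f :: "'c::{idom,ring_char_0} poly poly"
  assumes "dy f = 0" "dz f = 0"
  shows "f \<in> range cst"
proof -
  obtain p where p: "f = [:p:]" using assms(2) unfolding dz_def by (metis degree_eq_zeroE pderiv_eq_0_iff)
  then have "pderiv p = 0" using assms(1) coeff_dy[of f 0] by simp
  then obtain c where "p = [:c:]" by (metis degree_eq_zeroE pderiv_eq_0_iff)
  then show ?thesis using p by (simp add: cst_def)
qed

lemma rhom_constB: "rhom constB"
  by standard (simp_all add: constB_def one_pCons)

section \<open>Coordinates whose third member is not in k[x]\<close>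

locale other_coordinates =
  fixes y1 y2 w :: "'k::field_char_0 B3" and d1 d2
  assumes K: "kalg constB {y1, y2, w} = UNIV"
    and d1: "is_partial d1 y1 y2 w" and d2: "is_partial d2 y2 y1 w"
    and w: "w \<notin> range cst"
begin

definition hw :: "'k poly \<Rightarrow> 'k B3" where "hw a = poly (map_poly constB a) w"

text \<open>The automorphism of k[x,y,z] over k with x, y, z going to \<open>w\<close>,
  \<open>y1\<close>, \<open>y2\<close>. Conjugation by it turns a derivation that kills
  \<open>w\<close> into one over k[x], to which the earlier results apply.\<close>

definition \<Omega> :: "'k B3 \<Rightarrow> 'k B3" where "\<Omega> = ev2 hw y1 y2"

definition \<Omega>i :: "'k B3 \<Rightarrow> 'k B3" where "\<Omega>i = inv_into UNIV \<Omega>"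

sublocale hw: rhom hw
  unfolding hw_def by (rule rhom.rhom_poly_map_poly[OF rhom_constB])

sublocale \<Omega>: rhom \<Omega>
  unfolding \<Omega>_def by (rule rhom_ev2[OF hw.rhom_axioms])

lemma \<Omega>_simps [simp]: "\<Omega> (cst a) = hw a" "\<Omega> YY = y1" "\<Omega> ZZ = y2"
  by (simp_all add: \<Omega>_def ev2_simps[OF hw.rhom_axioms])

lemma hw_const [simp]: "hw [:c:] = constB c"
  by (simp add: hw_def map_poly_pCons constB_def)

lemma der_hw:
  assumes "is_der constB d"
  shows "d (hw a) = hw (pderiv a) * d w"
proof -
  interpret c: rhom "constB :: 'k \<Rightarrow> _" by (rule rhom_constB)
  have h: "hw (pCons c a) = constB c + w * hw a" for c a
    by (simp add: hw_def c.map_poly_pCons_hom)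
  have d: "d (constB c) = 0" "d (f + g) = d f + d g" "d (f * g) = f * d g + g * d f" for c f g
    using assms by (simp_all add: is_der_def)
  show ?thesis
    by (induction a)
      (simp_all add: d is_der_zero[OF assms] h pderiv_pCons hw.hom_add c.hom_zero algebra_simps)
qed

lemma ex_derivation_w:
  obtains d where "is_der cst d" "d w \<noteq> 0"
proof (cases "dy w = 0")
  case True
  then have "dz w \<noteq> 0" using w dy_dz_eq_0_imp_cst by blast
  then show thesis by (intro that[of dz]) (simp_all add: is_der_def dz_add dz_mult)
next
  case False
  then show thesis by (intro that[of dy]) (simp_all add: is_der_def dy_add dy_mult)
qed

lemma hw_eq_0_imp: "hw a = 0 \<Longrightarrow> a = 0"
proof (induction "degree a" arbitrary: a rule: less_induct)
  case less
  obtain d where d: "is_der cst d" "d w \<noteq> 0" by (rule ex_derivation_w)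
  have "hw (pderiv a) * d w = 0"
    using der_hw[OF is_der_constB[OF d(1)], of a] less.prems is_der_zero[OF d(1)] by simp
  then have "hw (pderiv a) = 0" using d by simp
  then have "pderiv a = 0"
    using less.hyps[of "pderiv a"] by (metis degree_pderiv diff_less gr0I less_one pderiv_eq_0_iff)
  then obtain c where "a = [:c:]" by (metis degree_eq_zeroE pderiv_eq_0_iff)
  then show ?case using less.prems by (simp add: constB_def)
qed

text \<open>That is, k[w] and k[x] meet in k: a derivation over k[x] that moves \<open>w\<close>
  kills the right side, hence annihilates the derivative of \<open>a\<close>.\<close>

lemma hw_in_cst_imp_const:
  assumes "hw a = cst b"
  obtains c where "a = [:c:]"
proof -
  obtain d where d: "is_der cst d" "d w \<noteq> 0" by (rule ex_derivation_w)
  have "d (cst b) = 0" using d(1) by (simp add: is_der_def)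
  then have "hw (pderiv a) * d w = 0"
    using der_hw[OF is_der_constB[OF d(1)], of a] assms by simp
  then have "pderiv a = 0" using d hw_eq_0_imp by simp
  then show thesis using that by (metis degree_eq_zeroE pderiv_eq_0_iff)
qed

lemma d1_\<Omega>: "d1 (\<Omega> f) = \<Omega> (dy f)" and d2_\<Omega>: "d2 (\<Omega> f) = \<Omega> (dz f)"
proof -
  have der: "is_der constB d1" "is_der constB d2" "d1 w = 0" "d2 w = 0"
    using d1 d2 by (simp_all add: is_partial_def)
  have "der_along \<Omega> (\<lambda>f. d1 (\<Omega> f))" "der_along \<Omega> (\<lambda>f. d2 (\<Omega> f))"
    using der by (simp_all add: der_along_def is_der_def \<Omega>.hom_add \<Omega>.hom_mult)
  from der_along_eq[OF \<Omega>.rhom_axioms this(1), of f] der_along_eq[OF \<Omega>.rhom_axioms this(2), of f]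
  show "d1 (\<Omega> f) = \<Omega> (dy f)" "d2 (\<Omega> f) = \<Omega> (dz f)"
    using d1 d2 by (simp_all add: der_hw[OF der(1)] der_hw[OF der(2)] der is_partial_def)
qed

lemma \<Omega>_eq_0_imp: "\<Omega> f = 0 \<Longrightarrow> f = 0"
proof -
  have der: "is_der constB d1" "is_der constB d2" using d1 d2 by (simp_all add: is_partial_def)
  have c: "p = 0" if "\<Omega> [:p:] = 0" for p
    using that
  proof (induction "degree p" arbitrary: p rule: less_induct)
    case less
    have "dy [:p:] = [:pderiv p:]" by (simp add: dy_def map_poly_pCons)
    then have "\<Omega> [:pderiv p:] = 0"
      using d1_\<Omega>[of "[:p:]"] less.prems is_der_zero[OF der(1)] by simp
    then have "pderiv p = 0"
      using less.hyps[of "pderiv p"] by (metis degree_pderiv diff_less gr0I less_one pderiv_eq_0_iff)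
    then obtain a where a: "p = [:a:]" by (metis degree_eq_zeroE pderiv_eq_0_iff)
    then have "hw a = 0" using less.prems \<Omega>_simps(1)[of a] by (simp add: cst_def)
    then show ?case using hw_eq_0_imp a by simp
  qed
  show "\<Omega> f = 0 \<Longrightarrow> f = 0"
  proof (induction "degree f" arbitrary: f rule: less_induct)
    case less
    have "\<Omega> (dz f) = 0" using d2_\<Omega>[of f] less.prems is_der_zero[OF der(2)] by simp
    then have "pderiv f = 0"
      using less.hyps[of "dz f"] unfolding dz_def
      by (metis degree_pderiv diff_less gr0I less_one pderiv_eq_0_iff)
    then obtain p where "f = [:p:]" by (metis degree_eq_zeroE pderiv_eq_0_iff)
    then show ?case using less.prems c by simp
  qed
qed

lemma \<Omega>_varX: "\<Omega> varX = w"
  by (simp add: varX_cst hw_def map_poly_pCons constB_def flip: one_pCons)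

lemma \<Omega>_surj: "surj \<Omega>"
proof -
  have "f \<in> range \<Omega>" for f
  proof (rule kalg_least[of f constB "{y1, y2, w}"])
    show "f \<in> kalg constB {y1, y2, w}" using K by simp
    show "constB c \<in> range \<Omega>" for c
      by (rule range_eqI[of _ _ "cst [:c:]"]) simp
    show "{y1, y2, w} \<subseteq> range \<Omega>"
      using \<Omega>_simps(2,3) \<Omega>_varX by (metis empty_subsetI insert_subset rangeI)
  qed (auto simp flip: \<Omega>.hom_add \<Omega>.hom_mult)
  then show ?thesis by auto
qed

lemma \<Omega>\<Omega>i [simp]: "\<Omega> (\<Omega>i f) = f"
  unfolding \<Omega>i_def by (rule surj_f_inv_f[OF \<Omega>_surj])

lemma \<Omega>_eq_iff: "\<Omega> f = \<Omega> g \<longleftrightarrow> f = g"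
  using \<Omega>_eq_0_imp[of "f - g"] by (auto simp: \<Omega>.hom_diff)

lemma \<Omega>i_eq_iff: "\<Omega>i f = g \<longleftrightarrow> f = \<Omega> g"
  by (metis \<Omega>\<Omega>i \<Omega>_eq_iff)

lemma \<Omega>i_ring: "\<Omega>i (f + g) = \<Omega>i f + \<Omega>i g" "\<Omega>i (f * g) = \<Omega>i f * \<Omega>i g"
  by (simp_all add: \<Omega>i_eq_iff \<Omega>.hom_add \<Omega>.hom_mult)

text \<open>A prime of \<open>k[x]\<close> dividing a nonzero element of \<open>k[w]\<close> would divide its images under
  \<open>d1\<close> and \<open>d2\<close>, hence be killed by them, hence lie in \<open>k[w]\<close>, which meets \<open>k[x]\<close> only in \<open>k\<close>.\<close>
lemma place_not_dvd_hw:
  assumes pl: "place e p" and r: "r \<noteq> 0"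
  shows "\<not> cst p dvd hw r"
proof
  interpret place e p by (rule pl)
  assume "cst p dvd hw r"
  with r have "r \<noteq> 0 \<and> cst p dvd hw r" by simp
  from ex_has_least_nat[of "\<lambda>r. r \<noteq> 0 \<and> cst p dvd hw r", OF this, of degree]
  obtain r where r: "r \<noteq> 0" "cst p dvd hw r"
    and min: "\<And>r'. r' \<noteq> 0 \<Longrightarrow> cst p dvd hw r' \<Longrightarrow> degree r \<le> degree r'" by blast
  obtain b where b: "hw r = cst p * b" using r(2) by auto
  have dr: "degree r \<noteq> 0"
  proof
    assume "degree r = 0"
    then obtain c where "r = [:c:]" by (auto elim: degree_eq_zeroE)
    then show False using not_dvd_unit[of c] r by (auto simp: constB_cst)
  qed
  then have r': "pderiv r \<noteq> 0" by (simp add: pderiv_eq_0_iff)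
  \<comment> \<open>The partial derivative by \<open>w\<close> in the coordinates \<open>y1\<close>,
    \<open>y2\<close>, \<open>w\<close>.\<close>
  define dw where "dw f = \<Omega> (dX (\<Omega>i f))" for f
  have dw: "is_der constB dw"
  proof -
    have "\<Omega>i (constB c) = constB c" for c by (simp add: \<Omega>i_eq_iff constB_cst[of c])
    moreover have "dX (constB c) = 0" "dX (f + g) = dX f + dX g" "dX (f * g) = f * dX g + g * dX f"
      for c :: 'k and f g :: "'k B3"
      using is_der_dX[where ?'k = 'k] by (simp_all add: is_der_def)
    ultimately show ?thesis
      by (simp add: is_der_def dw_def \<Omega>i_ring \<Omega>.hom_add \<Omega>.hom_mult)
  qed
  have "\<Omega>i w = varX" by (simp add: \<Omega>i_eq_iff \<Omega>_varX)
  then have dww: "dw w = 1" by (simp add: dw_def \<Omega>.hom_one)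
  \<comment> \<open>If the square of p divided \<open>hw r\<close>, then p would divide its
    derivative by \<open>w\<close>, which is \<open>hw\<close> of a polynomial of smaller
    degree.\<close>
  have nb: "\<not> cst p dvd b"
  proof
    assume "cst p dvd b"
    then obtain b' where b': "b = cst p * b'" by auto
    have dm: "dw (f * g) = f * dw g + g * dw f" for f g using dw by (simp add: is_der_def)
    have "hw (pderiv r) = dw (hw r)" using der_hw[OF dw, of r] dww by simp
    also have "\<dots> = cst p * (dw (cst p * b') + b' * dw (cst p))"
      unfolding b b' dm by (simp add: algebra_simps)
    finally have "cst p dvd hw (pderiv r)" by simp
    then have "degree r \<le> degree (pderiv r)" by (intro min r')
    then show False using dr by (simp add: degree_pderiv)
  qed
  define p' where "p' = \<Omega>i (cst p)"
  have \<Omega>p': "\<Omega> p' = cst p" by (simp add: p'_def)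
  \<comment> \<open>\<open>d\<close> kills \<open>hw r\<close>, which is p times b; by Leibniz p
    divides b times \<open>d (cst p)\<close>, and p is prime and does not divide b.\<close>
  have self: "cst p dvd d (cst p)" if d: "is_der constB d" "d w = 0" for d
  proof -
    have "0 = d (cst p * b)" using der_hw[OF d(1), of r] d(2) by (simp add: b)
    also have "\<dots> = cst p * d b + b * d (cst p)" using d(1) by (simp add: is_der_def)
    finally have "b * d (cst p) = cst p * (- d b)" by (simp add: algebra_simps eq_neg_iff_add_eq_0)
    then have "cst p dvd b * d (cst p)" by simp
    then show ?thesis using nb prime_p by blast
  qed
  have \<Omega>dvd: "f dvd g" if dv: "\<Omega> f dvd \<Omega> g" for f g
  proof -
    obtain k where "\<Omega> g = \<Omega> f * k" using dv by (rule dvdE)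
    then have "\<Omega> g = \<Omega> f * \<Omega> (\<Omega>i k)" by simp
    then have "\<Omega> g = \<Omega> (f * \<Omega>i k)" by (simp only: \<Omega>.hom_mult)
    then show ?thesis by (simp only: \<Omega>_eq_iff) simp
  qed
  \<comment> \<open>The degree arguments of \<open>dvd_dy_self\<close> and
    \<open>dvd_dz_self\<close> concern the variables \<open>YY\<close>, \<open>ZZ\<close>, hence the
    passage to the preimage of p.\<close>
  have "\<Omega> p' dvd \<Omega> (dy p')" "\<Omega> p' dvd \<Omega> (dz p')"
    using self[of d1] self[of d2] d1 d2
    by (simp_all add: is_partial_def \<Omega>p' d1_\<Omega>[symmetric] d2_\<Omega>[symmetric])
  then have "dy p' = 0" "dz p' = 0" using \<Omega>dvd dvd_dy_self dvd_dz_self by blast+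
  then obtain a where "p' = cst a" using dy_dz_eq_0_imp_cst by blast
  then have hp: "hw a = cst p" using \<Omega>p' by simp
  then obtain c where "a = [:c:]" by (rule hw_in_cst_imp_const)
  with hp have "p = [:c:]" by (simp add: constB_cst)
  then show False using deg_p by simp
qed

end

section \<open>Slices, rank and the main theorem\<close>

text \<open>Over k[w] the element x serves as a kernel element that is not a constant. The resulting
  relation makes every \<open>hw r * D f\<close> a multiple of the value at \<open>t\<close>; a
  prime of k[x] dividing that value does not divide \<open>hw r\<close>, so it would divide all
  values of \<open>D\<close>, against irreducibility.\<close>

lemma (in other_coordinates) ex_image_avoiding_places:
  assumes D: "is_LND constB D" "irreducible_der D" "D varX = 0" "D w = 0"
  obtains t where "D (D t) = 0" "\<forall>e p. place e p \<longrightarrow> \<not> cst p dvd D t"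
proof -
  have der: "is_der constB D" using D(1) by (simp add: is_LND_def)
  define E where "E f = \<Omega>i (D (\<Omega> f))" for f
  have pow: "\<Omega> ((E ^^ n) f) = (D ^^ n) (\<Omega> f)" for n f
    by (induction n) (simp_all add: E_def)
  have "is_LND cst E" unfolding is_LND_def
  proof (intro conjI allI)
    have "D (hw a) = 0" for a using der_hw[OF der, of a] D(4) by simp
    moreover have "D (f + g) = D f + D g" "D (f * g) = f * D g + g * D f" for f g
      using der by (simp_all add: is_der_def)
    ultimately show "is_der cst E"
      by (simp add: is_der_def E_def \<Omega>i_eq_iff \<Omega>.hom_add \<Omega>.hom_mult)
    fix f
    obtain n where "(D ^^ n) (\<Omega> f) = 0" using D(1) unfolding is_LND_def by blast
    then have "(E ^^ n) f = 0" using \<Omega>_eq_0_imp by (simp flip: pow)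
    then show "\<exists>n. (E ^^ n) f = 0" ..
  qed
  moreover have "E (\<Omega>i varX) = 0" by (simp add: E_def D \<Omega>i_eq_iff)
  moreover have "\<Omega>i varX \<notin> range cst"
  proof
    assume "\<Omega>i varX \<in> range cst"
    then obtain a where "hw a = cst [:0, 1:]" by (auto simp: \<Omega>i_eq_iff varX_cst)
    moreover from this obtain c where "a = [:c:]" by (rule hw_in_cst_imp_const)
    ultimately show False by (simp add: constB_cst)
  qed
  ultimately obtain t r b1 b2 where t: "r \<noteq> 0" "E (E t) = 0" "cst r * E YY = E t * b1" "cst r * E ZZ = E t * b2"
    by (rule divisible_derivation)
  have \<Omega>E: "\<Omega> (E f) = D (\<Omega> f)" for f by (simp add: E_def)
  have 1: "hw r * D y1 = D (\<Omega> t) * \<Omega> b1" and 2: "hw r * D y2 = D (\<Omega> t) * \<Omega> b2"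
    using arg_cong[OF t(3), of \<Omega>] arg_cong[OF t(4), of \<Omega>] by (simp_all add: \<Omega>.hom_mult \<Omega>E)
  have DD: "D (D (\<Omega> t)) = 0" using arg_cong[OF t(2), of \<Omega>] by (simp add: \<Omega>E)
  have div: "hw r * D f = D (\<Omega> t) * (d1 f * \<Omega> b1 + d2 f * \<Omega> b2)" for f
  proof -
    have "hw r * D f = d1 f * (hw r * D y1) + d2 f * (hw r * D y2)"
      unfolding der_eq_partials[OF K d1 d2 der D(4), of f] by (simp add: algebra_simps)
    then show ?thesis unfolding 1 2 by (simp add: algebra_simps)
  qed
  have "\<not> cst p dvd D (\<Omega> t)" if pl: "place e p" for e p
  proof
    interpret place e p by (rule pl)
    assume d: "cst p dvd D (\<Omega> t)"
    have "cst p dvd D f" for f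
    proof -
      have "cst p dvd hw r * D f" unfolding div using d by simp
      then show ?thesis using prime_p place_not_dvd_hw[OF pl t(1)] by blast
    qed
    then have "cst p dvd cst [:1:]"
      using D(2) unfolding irreducible_der_iff by (metis cst.hom_one one_pCons)
    then show False using not_dvd_unit[of 1] by simp
  qed
  with DD show thesis using that by blast
qed

text \<open>The coefficients lie in k[x,y], which is not a field; the inverses of the integers are
  inserted as constants from k.\<close>

lemma antiderivative_z:
  fixes \<Phi> :: "'k::field_char_0 B3"
  obtains \<Psi> where "dz \<Psi> = \<Phi>"
proof -
  let ?c = "\<lambda>i. [:[:inverse (of_nat (Suc i)):]:] * coeff \<Phi> i"
  have c: "of_nat (Suc i) * ?c i = coeff \<Phi> i" for i
  proof -
    have "of_nat (Suc i) * ?c i = [:[:of_nat (Suc i) * inverse (of_nat (Suc i)):]:] * coeff \<Phi> i"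
      by (simp add: of_nat_poly mult.assoc[symmetric] del: of_nat_Suc)
    also have "of_nat (Suc i) * inverse (of_nat (Suc i)) = (1 :: 'k)" by (simp del: of_nat_Suc)
    finally show ?thesis by (simp flip: one_pCons)
  qed
  have "pderiv (\<Sum>i\<in>A. monom (?c i) (Suc i)) = (\<Sum>i\<in>A. monom (coeff \<Phi> i) i)" for A
    by (induction A rule: infinite_finite_induct)
      (simp_all only: pderiv_add pderiv_monom c sum.infinite sum.empty sum.insert pderiv_0 diff_Suc_1 not_False_eq_True)
  then show thesis
    using that[of "\<Sum>i\<le>degree \<Phi>. monom (?c i) (Suc i)"] by (simp add: dz_def poly_as_sum_of_monoms)
qed

text \<open>The slice theorem, by induction on the nilpotency order: integrating the expression of
  \<open>D f\<close> with respect to \<open>s\<close> yields an element that differs from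
  \<open>f\<close> by a kernel element.\<close>

lemma gen_of_slice:
  fixes D :: "'k::field_char_0 B3 \<Rightarrow> 'k B3"
  assumes D: "is_LND cst D" and P: "D P = 0" "\<And>f. D f = 0 \<Longrightarrow> \<exists>T. f = evp P T" and s: "D s = 1"
  shows "gen s P"
proof -
  have der: "is_der cst D" using D by (simp add: is_LND_def)
  have add: "D (f + g) = D f + D g" for f g using der by (simp add: is_der_def)
  have "f \<in> range (sub P s)" if "(D ^^ n) f = 0" for n f
    using that
  proof (induction n arbitrary: f)
    case 0
    then show ?case using range_eqI[of 0 "sub P s" 0] by simp
  next
    case (Suc n)
    then have "D f \<in> range (sub P s)" by (simp add: funpow_swap1)
    then obtain \<Phi> where \<Phi>: "D f = sub P s \<Phi>" by auto
    obtain \<Psi> where \<Psi>: "dz \<Psi> = \<Phi>" by (rule antiderivative_z)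
    have "D (sub P s \<Psi>) = D f" unfolding der_sub[OF der] by (simp add: P s \<Phi> \<Psi>)
    then have "D (f - sub P s \<Psi>) = 0" using add[of "f - sub P s \<Psi>" "sub P s \<Psi>"] by simp
    then obtain T where "f - sub P s \<Psi> = evp P T" using P(2) by blast
    then have "f = sub P s (\<Psi> + [:T:])" by (simp add: sub_const[symmetric] algebra_simps)
    then show ?case by (rule range_eqI)
  qed
  moreover have "\<exists>n. (D ^^ n) f = 0" for f using D by (simp add: is_LND_def)
  ultimately have "gen P s" unfolding kalg2_eq by blast
  then show ?thesis by (rule gen_swap)
qed

lemma rank_le_one:
  assumes "gen s P" "is_der cst D" "D P = 0"
  shows "rank_der D \<le> 1"
  unfolding rank_der_def
proof (rule Least_le, intro exI conjI)
  show "coordsys s varX P"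
    using kalg_varX[of "{s, P}"] assms(1) by (simp add: coordsys_def insert_commute)
  have "x \<in> ker D" if "x \<in> kalg constB {varX, P}" for x
    using that by (rule kalg_least)
      (use assms(2,3) in \<open>auto simp: ker_def is_der_def constB_cst varX_cst\<close>)
  then show "kalg constB (set (drop 1 [s, varX, P])) \<subseteq> ker D" by auto
qed

text \<open>If \<open>D s = h(x)\<close> and \<open>D t = Q\<close> with \<open>Q\<close> in the kernel, then \<open>Q s - h t\<close> is in the kernel
  \<open>k[x,P]\<close>; modulo a prime \<open>p\<close> dividing \<open>h\<close> but not \<open>Q\<close> this forces \<open>s\<close> to be congruent to an element of
  \<open>k[x,P]\<close>, so that \<open>h\<close> can be divided by \<open>p\<close>.\<close>
theorem (in other_coordinates) no_other_coordinate:
  assumes D: "is_LND constB D" "irreducible_der D" "D varX = 0" "D w = 0"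
    and FG: "gen F G" and DF: "propJ D F" and rank: "rank_der D = 2"
  shows False
proof -
  have der: "is_der cst D" and LND: "is_LND cst D" using D by (simp_all add: is_LND_cst_iff is_LND_def is_der_cst_iff)
  have d: "D (cst a) = 0" "D (f + g) = D f + D g" "D (f * g) = f * D g + g * D f" for a f g
    using der by (simp_all add: is_der_def)
  have dd: "D (f - g) = D f - D g" for f g using d(2)[of "f - g" g] by simp
  have dc: "D (cst a * f) = cst a * D f" for a f by (simp add: d)
  obtain c where c: "c \<noteq> 0" "\<And>f. toK (D f) = cst c * Jac F (toK f)" using DF by (auto simp: propJ_def)
  obtain P a b where a: "a \<noteq> 0" "toK P = cst a * F + cst b"
    and P: "\<forall>p u w. degree p > 0 \<longrightarrow> P \<noteq> cst u + cst p * w"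
    using kernel_generator[OF FG] .
  have DP: "D P = 0"
  proof -
    have "toK (D P) = 0" unfolding c(2) a(2) by (simp add: Jac_add_right Jac_cst_mult)
    then show ?thesis by simp
  qed
  have ker: "\<exists>T. f = evp P T" if "D f = 0" for f
  proof -
    have "Jac F (toK f) = 0" using c(2)[of f] c(1) that by simp
    then show ?thesis using kernel_eq_polynomials[OF FG a P] by blast
  qed
  have kerI: "D (evp P T) = 0" for T using der_evp[OF der, of P T] DP by simp
  have ex_h: "\<exists>h. h \<noteq> 0 \<and> (\<exists>s. D s = cst h)"
  proof -
    obtain \<kappa> where \<kappa>: "Jac F G = cst \<kappa>" "\<kappa> \<noteq> 0" using gen_Jac_field[OF FG] .
    obtain r v where r: "r \<noteq> 0" "cst (fr r) * G = toK v" using clear_denominators .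
    have "toK (D v) = cst (c * fr r * \<kappa>)"
      unfolding c(2) r(2)[symmetric] by (simp add: Jac_cst_mult \<kappa> cst.hom_mult)
    then obtain h where h: "D v = cst h" "c * fr r * \<kappa> = fr h" by (elim toK_eq_cst)
    then have "h \<noteq> 0" using c r \<kappa> by auto
    with h show ?thesis by blast
  qed
  then obtain h0 where "h0 \<noteq> 0 \<and> (\<exists>s. D s = cst h0)" ..
  from ex_has_least_nat[of "\<lambda>h. h \<noteq> 0 \<and> (\<exists>s. D s = cst h)", OF this, of degree]
  obtain h s where h: "h \<noteq> 0" "D s = cst h"
    and min: "\<And>h' s'. h' \<noteq> 0 \<Longrightarrow> D s' = cst h' \<Longrightarrow> degree h \<le> degree h'" by blast
  \<comment> \<open>The elements of k[x] that occur as values of \<open>D\<close> form an ideal, of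
    which a nonzero member of least degree is a generator.\<close>
  have hdvd: "h dvd h'" if "D s' = cst h'" for h' s'
  proof -
    have "D (s' - cst (h' div h) * s) = cst (h' - h' div h * h)"
      by (simp add: dd dc that h(2) cst.hom_diff cst.hom_mult)
    then have "D (s' - cst (h' div h) * s) = cst (h' mod h)" by (simp add: minus_div_mult_eq_mod)
    then have "h' mod h = 0" using min[of "h' mod h"] degree_mod_less'[OF h(1), of h'] by fastforce
    then show ?thesis by auto
  qed
  have "degree h = 0"
  proof (rule ccontr)
    assume "degree h \<noteq> 0"
    then obtain e :: "'k poly \<Rightarrow> 'k alg_closure" and p
      where ep: "rhom e" "degree p > 0" "p dvd h" "\<forall>f. e f = 0 \<longleftrightarrow> p dvd f" using ex_place[OF h(1)] by auto
    then have pl: "place e p" by (intro place.intro) auto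
    interpret place e p by (rule pl)
    interpret me: rhom "map_poly e" by (rule e.rhom_map_poly)
    let ?P = "mapc e P"
    have Pn: "?P \<notin> range cst" by (rule residue_nonconstant[OF P])
    have mevp: "mapc e (evp P T) = evp ?P (map_poly e T)" for T by (rule mapc_evp[OF rhom_e])
    obtain t where t: "D (D t) = 0" "\<forall>e p. place e p \<longrightarrow> \<not> cst p dvd D t"
      by (rule ex_image_avoiding_places[OF D])
    obtain C where C: "D t = evp P C" using ker t(1) by blast
    have "D (D t * s - cst h * t) = 0"
      by (simp add: dd d(1,3) t(1) h(2))
    then obtain A where A: "D t * s - cst h * t = evp P A" using ker by blast
    \<comment> \<open>Coefficients divisible by p are replaced by 0. The residue does not change,
      but now the leading coefficient survives the reduction, so \<open>C1\<close> and its residue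
      have the same degree.\<close>
    define C1 where "C1 = map_poly (\<lambda>c. if e c = 0 then 0 else c) C"
    have C1: "map_poly e C1 = map_poly e C"
      unfolding C1_def by (rule poly_eqI) (simp add: coeff_map_poly)
    have "mapc e (D t) \<noteq> 0" using t(2) pl by (simp add: mapc_eq_0)
    then have "map_poly e C \<noteq> 0" by (auto simp: C mevp)
    then have C1n: "map_poly e C1 \<noteq> 0" "C1 \<noteq> 0" using C1 by auto
    let ?l = "coeff C1 (degree C1)"
    have "?l = (if e (coeff C (degree C1)) = 0 then 0 else coeff C (degree C1))"
      unfolding C1_def by (simp add: coeff_map_poly)
    moreover have "?l \<noteq> 0" using C1n by simp
    ultimately have l: "e ?l \<noteq> 0" by (simp split: if_splits)
    have degC1: "degree (map_poly e C1) = degree C1"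
      by (rule map_poly_degree_eq) (rule l)
    \<comment> \<open>k[x] is not a field, so the division is a pseudo-division; the extra power of
      the leading coefficient is nonzero modulo p.\<close>
    obtain q r where qr: "pseudo_divmod A C1 = (q, r)" by force
    define n where "n = Suc (degree A) - degree C1"
    have pd: "smult (?l ^ n) A = C1 * q + r" "r = 0 \<or> degree r < degree C1"
      using pseudo_divmod[OF C1n(2) qr] by (simp_all add: n_def)
    have h0: "mapc e (cst h) = 0" unfolding mapc_eq_0 using ep(3) by (auto simp: cst.hom_mult)
    have "mapc e (D t) * mapc e s = mapc e (D t * s - cst h * t)"
      by (simp add: m.hom_diff m.hom_mult h0)
    then have QA: "evp ?P (map_poly e C1) * mapc e s = evp ?P (map_poly e A)"
      unfolding A unfolding C mevp C1 .
    have "cst (e ?l ^ n) * evp ?P (map_poly e A) = evp ?P (map_poly e (smult (?l ^ n) A))"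
    proof -
      have "map_poly e (smult (?l ^ n) A) = smult (e ?l ^ n) (map_poly e A)"
        by (rule poly_eqI) (simp add: coeff_map_poly e.hom_mult e.hom_power)
      then show ?thesis by (simp only: evp_smult)
    qed
    also have "\<dots> = evp ?P (map_poly e C1) * evp ?P (map_poly e q) + evp ?P (map_poly e r)"
      unfolding pd(1) by (simp only: me.hom_add me.hom_mult evp_add evp_mult)
    finally have "evp ?P (map_poly e C1) * (cst (e ?l ^ n) * mapc e s - evp ?P (map_poly e q)) = evp ?P (map_poly e r)"
      unfolding QA[symmetric] by (simp add: algebra_simps)
    moreover have "map_poly e r = 0 \<or> degree (map_poly e r) < degree (map_poly e C1)"
    proof -
      have "degree (map_poly e r) \<le> degree r" by (intro degree_le) (simp add: coeff_map_poly coeff_eq_0)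
      with pd(2) show ?thesis by (auto simp: degC1)
    qed
    \<comment> \<open>Modulo p the remainder has too small a degree to be a nonzero multiple of
      C1(P), so up to a unit \<open>s\<close> is congruent to q(P).\<close>
    ultimately have "cst (e ?l ^ n) * mapc e s - evp ?P (map_poly e q) = 0"
      by (rule evp_division_unique[OF Pn _ C1n(1)])
    then have "mapc e (cst (?l ^ n) * s - evp P q) = 0"
      by (simp add: m.hom_diff m.hom_mult mapc_simps[OF rhom_e] mevp e.hom_power)
    then obtain s' where s': "cst (?l ^ n) * s - evp P q = cst p * s'" unfolding mapc_eq_0 by (rule dvdE)
    obtain h1 where h1: "h = p * h1" using ep(3) by auto
    \<comment> \<open>Hence ?l^n h / p is a value of \<open>D\<close> in k[x] and so a multiple of
      \<open>h\<close>, which would make p divide a power of the leading coefficient.\<close>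
    have "cst p * D s' = cst (?l ^ n) * cst h"
      using arg_cong[OF s', of D] by (simp add: dd dc kerI h(2))
    also have "\<dots> = cst p * cst (?l ^ n * h1)" unfolding h1 by (simp only: cst.hom_mult mult_ac)
    finally have "D s' = cst (?l ^ n * h1)" using p_nonzero by simp
    then have "h dvd ?l ^ n * h1" by (rule hdvd)
    then have "p * h1 dvd ?l ^ n * h1" by (simp add: h1)
    then have "p dvd ?l ^ n" using h(1) h1 by simp
    then have "e (?l ^ n) = 0" by (simp add: e_eq_0)
    then show False using l by (simp add: e.hom_power)
  qed
  then obtain k where k: "h = [:k:]" "k \<noteq> 0" using h(1) by (metis degree_eq_zeroE pCons_0_0)
  have "D (cst [:inverse k:] * s) = cst ([:inverse k:] * [:k:])" by (simp only: dc h(2) k(1) cst.hom_mult)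
  also have "[:inverse k:] * [:k:] = 1" using k(2) by (simp add: one_pCons)
  finally have "D (cst [:inverse k:] * s) = 1" by (simp add: cst.hom_one)
  then have "gen (cst [:inverse k:] * s) P" using gen_of_slice[OF LND DP ker] by blast
  from rank_le_one[OF this der DP] rank show False by simp
qed

lemma Least_shift:
  fixes P Q :: "nat \<Rightarrow> bool"
  assumes "\<exists>m. P m" "\<And>m. P m \<Longrightarrow> Q (m + k)" "\<And>l. Q l \<Longrightarrow> k \<le> l \<and> P (l - k)"
  shows "(LEAST l. Q l) = (LEAST m. P m) + k"
proof (rule Least_equality)
  show "Q ((LEAST m. P m) + k)" using assms(1,2) LeastI_ex by blast
  fix l assume "Q l"
  with assms(3) have "k \<le> l" "(LEAST m. P m) \<le> l - k" by (auto intro: Least_le)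
  then show "(LEAST m. P m) + k \<le> l" by linarith
qed

text \<open>Comparing the values at the two variables shows that the gradients of \<open>F\<close>
  and \<open>F'\<close> are proportional.\<close>

lemma propJ_same_kernel:
  assumes "propJ D F" "propJ D F'"
  shows "Jac F F' = 0"
proof -
  obtain c where c: "c \<noteq> 0" "\<And>f. toK (D f) = cst c * Jac F (toK f)" using assms(1) by (auto simp: propJ_def)
  obtain c' where c': "c' \<noteq> 0" "\<And>f. toK (D f) = cst c' * Jac F' (toK f)" using assms(2) by (auto simp: propJ_def)
  have "cst c * Jac F g = cst c' * Jac F' g" if "g \<in> {YY, ZZ}" for g
    using c(2)[of YY] c'(2)[of YY] c(2)[of ZZ] c'(2)[of ZZ] that by auto
  from this[of YY] this[of ZZ]
  have e: "cst c * dy F = cst c' * dy F'" "cst c * dz F = cst c' * dz F'"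
    by (simp_all add: Jac_def)
  have "cst c * Jac F F' = (cst c * dy F) * dz F' - (cst c * dz F) * dy F'"
    by (simp add: Jac_def algebra_simps)
  also have "\<dots> = 0" unfolding e by simp
  finally show ?thesis using c(1) by simp
qed

theorem theorem4p9:
  fixes D :: "'k::field_char_0 poly poly poly \<Rightarrow> 'k poly poly poly"
    and \<alpha> :: "'k poly fract poly poly \<times> 'k poly fract poly poly"
  assumes "is_LND constB D"
    and "irreducible_der D"
    and "rank_der D = 2"
    and "D varX = 0"
    and "\<alpha> \<in> Psi D"
  shows "ulev D = complexity \<alpha> + 2"
proof -
  obtain u v where \<alpha>: "\<alpha> = (u, v)" by (cases \<alpha>)
  from assms(5) obtain dt c where uv: "gen u v" and dt: "is_LND cst dt" "\<And>f. dt (toK f) = toK (D f)"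
    "ker dt = kalg cst {u}" "c \<noteq> 0" "dt v = cst c"
    by (auto simp: Psi_def \<alpha> embK_cst)
  have du: "dt u = 0"
    using kalg.gen[of u "{u}" cst] unfolding dt(3)[symmetric] by (simp add: ker_def)
  obtain \<kappa> where \<kappa>: "Jac u v = cst \<kappa>" "\<kappa> \<noteq> 0" using gen_Jac_field[OF uv] .
  \<comment> \<open>In the coordinates \<open>u\<close>, \<open>v\<close> both \<open>dt\<close> and
    \<open>Jac u\<close> are constant multiples of the partial derivative by
    \<open>v\<close>.\<close>
  have Du: "propJ D u"
    unfolding propJ_def
  proof (intro exI conjI allI)
    show "c * inverse \<kappa> \<noteq> 0" using dt \<kappa> by simp
    fix f
    obtain \<Phi> where \<Phi>: "toK f = sub u v \<Phi>" using uv unfolding kalg2_eq by (metis UNIV_I imageE)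
    have "is_der cst dt" using dt(1) by (simp add: is_LND_def)
    then have A: "dt (toK f) = sub u v (dz \<Phi>) * cst c"
      unfolding \<Phi> by (simp add: der_sub du dt(5))
    have B: "Jac u (toK f) = sub u v (dz \<Phi>) * cst \<kappa>"
      unfolding \<Phi> by (simp add: der_sub[OF is_der_Jac] \<kappa>)
    have C: "cst (c * inverse \<kappa>) * (sub u v (dz \<Phi>) * cst \<kappa>) =
        (cst (inverse \<kappa>) * cst \<kappa>) * (sub u v (dz \<Phi>) * cst c)" by (simp only: cst.hom_mult mult_ac)
    show "toK (D f) = cst (c * inverse \<kappa>) * Jac u (toK f)"
      unfolding dt(2)[symmetric] A B C cst_inverse[OF \<kappa>(2)] by simp
  qed
  show ?thesis
    unfolding ulev_def complexity_def
  proof (rule Least_shift)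
    \<comment> \<open>At least one swap chain is required, since \<open>LEAST\<close> of an
      unsatisfiable property has no specified value.\<close>
    obtain t0 ts where t: "t0 \<in> T2" "set ts \<subseteq> T2" "swapchain ts (comp_aut t0 (u, v)) = (YY, ZZ)"
      using swapchain_exists[OF uv] .
    show "\<exists>m t0 ts. t0 \<in> T2 \<and> set ts \<subseteq> T2 \<and> length ts = m \<and>
      (let \<phi> = swapchain ts (comp_aut t0 \<alpha>) in
        \<exists>g1 g2. toK g1 = fst \<phi> \<and> toK g2 = snd \<phi> \<and> coordsys varX g1 g2)"
      by (rule exI[of _ "length ts"], rule exI[of _ t0], rule exI[of _ ts], simp add: t \<alpha>,
          rule exI[of _ YY], simp, rule exI[of _ ZZ]) (simp add: coordsys_varX gen_YY_ZZ)
  next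
    fix m
    assume "\<exists>t0 ts. t0 \<in> T2 \<and> set ts \<subseteq> T2 \<and> length ts = m \<and>
      (let \<phi> = swapchain ts (comp_aut t0 \<alpha>) in
        \<exists>g1 g2. toK g1 = fst \<phi> \<and> toK g2 = snd \<phi> \<and> coordsys varX g1 g2)"
    then obtain t0 ts g1 g2 where t: "t0 \<in> T2" "set ts \<subseteq> T2" "length ts = m"
      "toK g1 = fst (swapchain ts (comp_aut t0 \<alpha>))" "toK g2 = snd (swapchain ts (comp_aut t0 \<alpha>))"
      "gen g1 g2"
      by (auto simp: Let_def coordsys_varX)
    \<comment> \<open>The initial triangular factor replaces \<open>u\<close> by an affine function
      of it, which only changes the proportionality scalar.\<close>
    obtain a b e p where t0: "t0 = ([:[:b, a:]:], [:p, [:e:]:])" "a \<noteq> 0" "e \<noteq> 0" using T2E[OF t(1)] .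
    define F G where "F = cst b + cst a * u" and "G = evp u p + cst e * v"
    have FG: "comp_aut t0 \<alpha> = (F, G)" unfolding \<alpha> t0 comp_T2 F_def G_def ..
    have "gen F G" unfolding F_def G_def by (rule gen_triangular[OF uv t0(2,3)])
    moreover have "propJ D F"
    proof -
      obtain l where l: "l \<noteq> 0" "\<And>f. toK (D f) = cst l * Jac u (toK f)" using Du by (auto simp: propJ_def)
      have "toK (D f) = cst (l / a) * Jac F (toK f)" for f
        using t0(2) by (simp add: l(2) F_def Jac_add_left Jac_cst_mult mult.assoc[symmetric] flip: cst.hom_mult)
      moreover have "l / a \<noteq> 0" using l(1) t0(2) by simp
      ultimately show ?thesis unfolding propJ_def by blast
    qed
    moreover have "swapchain ts (F, G) = (toK g1, toK g2)" using t(4,5) by (simp add: FG)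
    ultimately obtain y1 y2 ds where "gen y1 y2" "MC_chain y1 y2 varX ds D" "length ds = m + 2"
      using swapchain_to_chain[of F G ts g1 g2 D] t assms(2) by auto
    then show "\<exists>y1 y2 y3. coordsys y1 y2 y3 \<and> D y3 = 0 \<and> (\<exists>ds. MC_chain y1 y2 y3 ds D \<and> length ds = m + 2)"
      using assms(4) coordsys_varX' by blast
  next
    fix l
    assume "\<exists>y1 y2 y3. coordsys y1 y2 y3 \<and> D y3 = 0 \<and> (\<exists>ds. MC_chain y1 y2 y3 ds D \<and> length ds = l)"
    then obtain y1 y2 y3 ds where ch: "coordsys y1 y2 y3" "D y3 = 0" "MC_chain y1 y2 y3 ds D" "length ds = l"
      by blast
    have l2: "2 \<le> length ds" using ch(3) by (simp add: MC_chain_def)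
    then have "ds \<noteq> []" by auto
    then have last: "ds ! (length ds - 1) = D"
      using ch(3) last_conv_nth[of ds] by (simp add: MC_chain_def)
    have "y3 \<in> range cst"
    proof (rule ccontr)
      assume "y3 \<notin> range cst"
      then interpret other_coordinates y1 y2 y3 "ds ! 0" "ds ! 1"
        using ch(1,3) by (intro other_coordinates.intro) (auto simp: coordsys_def MC_chain_def)
      show False by (rule no_other_coordinate[OF assms(1,2,4) ch(2) uv Du assms(3)])
    qed
    then obtain \<xi> where \<xi>: "y3 = cst \<xi>" by auto
    obtain F G ts where FG: "set ts \<subseteq> T2" "length ts = l - 2" "swapchain ts (F, G) = (toK y1, toK y2)"
      "gen F G" "propJ D F"
      using chain_to_swapchain[OF ch(3,1) \<xi> l2 order_refl] last ch(4) by auto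
    \<comment> \<open>Both first members generate the kernel of the extension of \<open>D\<close>,
      so a triangular automorphism connects the given pair with the one from the chain, at no cost
      in swaps.\<close>
    obtain t0 where t0: "t0 \<in> T2" "comp_aut t0 (u, v) = (F, G)"
      using triangular_of_same_kernel[OF uv FG(4) propJ_same_kernel[OF Du FG(5)]] .
    have "gen y1 y2" using gen_of_coordsys ch(1) unfolding \<xi> .
    then show "2 \<le> l \<and> (\<exists>t0 ts. t0 \<in> T2 \<and> set ts \<subseteq> T2 \<and> length ts = l - 2 \<and>
      (let \<phi> = swapchain ts (comp_aut t0 \<alpha>) in
        \<exists>g1 g2. toK g1 = fst \<phi> \<and> toK g2 = snd \<phi> \<and> coordsys varX g1 g2))"
      using l2 ch(4) FG t0
      by (intro conjI exI[of _ t0] exI[of _ ts]) (simp_all add: Let_def \<alpha> coordsys_varX)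
  qed
qed

end
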